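(* For each $L\in\{\mathsf{MN},\mathsf{MNF}\}$ there exists a $\Sigma_1$ provability predicate $\mathrm{Pr}_T(x)$ of $T$ satisfying condition $\mathbf{M}$ such that: (1) for every modal formula $A$ and every arithmetical interpretation $f$ based on $\mathrm{Pr}_T(x)$, if $L\vdash A$ then $\mathsf{PA}\vdash f(A)$; and (2) there exists an arithmetical interpretation $f$ based on $\mathrm{Pr}_T(x)$ such that for every modal formula $A$, $L\vdash A$ if and only if $T\vdash f(A)$.
   Context: $T$ is a primitive recursively axiomatized consistent extension of Peano Arithmetic $\mathsf{PA}$ in the language of first-order arithmetic; $\ulcorner\varphi\urcorner$ is the numeral of the Gödel number of $\varphi$. A provability predicate of $T$ is a formula $\mathrm{Pr}_T(x)$ such that for every $n\in\omega$, $\mathsf{PA}\vdash\mathrm{Pr}_T(\overline{n})$ iff $n$ is the Gödel number of a theorem of $T$. Condition $\mathbf{M}$: if $T\vdash\varphi\to\psi$ then $T\vdash\mathrm{Pr}_T(\ulcorner\varphi\urcorner)\to\mathrm{Pr}_T(\ulcorner\psi\urcorner)$. The modal language has propositional variables, $\bot$, $\to$, $\Box$. An arithmetical interpretation based on $\mathrm{Pr}_T$ is a map $f$ from modal formulas to arithmetic sentences (arbitrary on propositional variables) with $f(\bot)$ being $0=1$, $f(A\to B)=f(A)\to f(B)$, $f(\Box A)=\mathrm{Pr}_T(\ulcorner f(A)\urcorner)$. $\mathsf{MN}$ is the modal logic whose axioms are all tautologies and whose rules are modus ponens, necessitation ($A/\Box A$) and RM ($A\to B/\Box A\to\Box B$);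 $\mathsf{MNF}$ is $\mathsf{MN}$ plus the scheme $\Box A\to\Box\Box A$. *)

theory Defs
  imports Main "HOL-Library.Nat_Bijection"
begin

datatype trm = Var nat | Zero | Sc trm | Plus trm trm | Times trm trm

datatype fm = Bot | Eq trm trm | Lt trm trm | Imp fm fm | All fm

definition Neg :: "fm \<Rightarrow> fm" where "Neg \<phi> = Imp \<phi> Bot"
definition Conj :: "fm \<Rightarrow> fm \<Rightarrow> fm" where "Conj \<phi> \<psi> = Neg (Imp \<phi> (Neg \<psi>))"
definition Iff :: "fm \<Rightarrow> fm \<Rightarrow> fm" where "Iff \<phi> \<psi> = Conj (Imp \<phi> \<psi>) (Imp \<psi> \<phi>)"
definition Ex :: "fm \<Rightarrow> fm" where "Ex \<phi> = Neg (All (Neg \<phi>))"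

fun lift_trm :: "nat \<Rightarrow> trm \<Rightarrow> trm" where
  "lift_trm k (Var i) = (if i < k then Var i else Var (Suc i))"
| "lift_trm k Zero = Zero"
| "lift_trm k (Sc t) = Sc (lift_trm k t)"
| "lift_trm k (Plus s t) = Plus (lift_trm k s) (lift_trm k t)"
| "lift_trm k (Times s t) = Times (lift_trm k s) (lift_trm k t)"

fun lift_fm :: "nat \<Rightarrow> fm \<Rightarrow> fm" where
  "lift_fm k Bot = Bot"
| "lift_fm k (Eq s t) = Eq (lift_trm k s) (lift_trm k t)"
| "lift_fm k (Lt s t) = Lt (lift_trm k s) (lift_trm k t)"
| "lift_fm k (Imp \<phi> \<psi>) = Imp (lift_fm k \<phi>) (lift_fm k \<psi>)"
| "lift_fm k (All \<phi>) = All (lift_fm (Suc k) \<phi>)"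

fun subst_trm :: "nat \<Rightarrow> trm \<Rightarrow> trm \<Rightarrow> trm" where
  "subst_trm k u (Var i) = (if i < k then Var i else if i = k then u else Var (i - 1))"
| "subst_trm k u Zero = Zero"
| "subst_trm k u (Sc t) = Sc (subst_trm k u t)"
| "subst_trm k u (Plus s t) = Plus (subst_trm k u s) (subst_trm k u t)"
| "subst_trm k u (Times s t) = Times (subst_trm k u s) (subst_trm k u t)"

fun subst_fm :: "nat \<Rightarrow> trm \<Rightarrow> fm \<Rightarrow> fm" where
  "subst_fm k u Bot = Bot"
| "subst_fm k u (Eq s t) = Eq (subst_trm k u s) (subst_trm k u t)"
| "subst_fm k u (Lt s t) = Lt (subst_trm k u s) (subst_trm k u t)"
| "subst_fm k u (Imp \<phi> \<psi>) = Imp (subst_fm k u \<phi>) (subst_fm k u \<psi>)"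
| "subst_fm k u (All \<phi>) = All (subst_fm (Suc k) (lift_trm 0 u) \<phi>)"

fun fv_trm :: "trm \<Rightarrow> nat set" where
  "fv_trm (Var i) = {i}"
| "fv_trm Zero = {}"
| "fv_trm (Sc t) = fv_trm t"
| "fv_trm (Plus s t) = fv_trm s \<union> fv_trm t"
| "fv_trm (Times s t) = fv_trm s \<union> fv_trm t"

fun fv :: "fm \<Rightarrow> nat set" where
  "fv Bot = {}"
| "fv (Eq s t) = fv_trm s \<union> fv_trm t"
| "fv (Lt s t) = fv_trm s \<union> fv_trm t"
| "fv (Imp \<phi> \<psi>) = fv \<phi> \<union> fv \<psi>"
| "fv (All \<phi>) = (\<lambda>i. i - 1) ` (fv \<phi> - {0})"

definition sentence :: "fm \<Rightarrow> bool" where "sentence \<phi> \<longleftrightarrow> fv \<phi> = {}"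

fun num :: "nat \<Rightarrow> trm" where
  "num 0 = Zero"
| "num (Suc n) = Sc (num n)"

inductive prv :: "fm set \<Rightarrow> fm \<Rightarrow> bool" for Ax :: "fm set" where
  ax: "\<phi> \<in> Ax \<Longrightarrow> prv Ax \<phi>"
| ax_K: "prv Ax (Imp \<phi> (Imp \<psi> \<phi>))"
| ax_S: "prv Ax (Imp (Imp \<phi> (Imp \<psi> \<chi>)) (Imp (Imp \<phi> \<psi>) (Imp \<phi> \<chi>)))"
| ax_DN: "prv Ax (Imp (Neg (Neg \<phi>)) \<phi>)"
| ax_inst: "prv Ax (Imp (All \<phi>) (subst_fm 0 t \<phi>))"
| ax_allimp: "prv Ax (Imp (All (Imp (lift_fm 0 \<phi>) \<psi>)) (Imp \<phi> (All \<psi>)))"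
| ax_refl: "prv Ax (Eq t t)"
| ax_leibniz: "prv Ax (Imp (Eq s t) (Imp (subst_fm 0 s \<phi>) (subst_fm 0 t \<phi>)))"
| mp: "prv Ax (Imp \<phi> \<psi>) \<Longrightarrow> prv Ax \<phi> \<Longrightarrow> prv Ax \<psi>"
| gen: "prv Ax \<phi> \<Longrightarrow> prv Ax (All \<phi>)"

definition ind_fm :: "fm \<Rightarrow> fm" where
  "ind_fm \<phi> = Imp (subst_fm 0 Zero \<phi>)
     (Imp (All (Imp \<phi> (subst_fm 0 (Sc (Var 0)) (lift_fm 1 \<phi>)))) (All \<phi>))"

definition PA :: "fm set" where
  "PA = {All (Neg (Eq (Sc (Var 0)) Zero)),
         All (All (Imp (Eq (Sc (Var 1)) (Sc (Var 0))) (Eq (Var 1) (Var 0)))),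
         All (Eq (Plus (Var 0) Zero) (Var 0)),
         All (All (Eq (Plus (Var 1) (Sc (Var 0))) (Sc (Plus (Var 1) (Var 0))))),
         All (Eq (Times (Var 0) Zero) Zero),
         All (All (Eq (Times (Var 1) (Sc (Var 0))) (Plus (Times (Var 1) (Var 0)) (Var 1)))),
         All (All (Iff (Lt (Var 1) (Var 0)) (Ex (Eq (Plus (Sc (Var 0)) (Var 2)) (Var 1)))))}
    \<union> {(All ^^ n) (ind_fm \<phi>) | \<phi> n. sentence ((All ^^ n) (ind_fm \<phi>))}"

inductive Delta0 :: "fm \<Rightarrow> bool" where
  "Delta0 Bot"
| "Delta0 (Eq s t)"
| "Delta0 (Lt s t)"
| "Delta0 \<phi> \<Longrightarrow> Delta0 \<psi> \<Longrightarrow> Delta0 (Imp \<phi> \<psi>)"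
| "Delta0 \<phi> \<Longrightarrow> Delta0 (All (Imp (Lt (Var 0) (lift_trm 0 t)) \<phi>))"

inductive Sigma1 :: "fm \<Rightarrow> bool" where
  "Delta0 \<phi> \<Longrightarrow> Sigma1 \<phi>"
| "Sigma1 \<phi> \<Longrightarrow> Sigma1 (Ex \<phi>)"

fun code_trm :: "trm \<Rightarrow> nat" where
  "code_trm (Var i) = prod_encode (0, i)"
| "code_trm Zero = prod_encode (1, 0)"
| "code_trm (Sc t) = prod_encode (2, code_trm t)"
| "code_trm (Plus s t) = prod_encode (3, prod_encode (code_trm s, code_trm t))"
| "code_trm (Times s t) = prod_encode (4, prod_encode (code_trm s, code_trm t))"

fun code :: "fm \<Rightarrow> nat" where
  "code Bot = prod_encode (0, 0)"
| "code (Eq s t) = prod_encode (1, prod_encode (code_trm s, code_trm t))"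
| "code (Lt s t) = prod_encode (2, prod_encode (code_trm s, code_trm t))"
| "code (Imp \<phi> \<psi>) = prod_encode (3, prod_encode (code \<phi>, code \<psi>))"
| "code (All \<phi>) = prod_encode (4, code \<phi>)"

datatype prfun = PZ | PS | PProj nat | PComp prfun "prfun list" | PRec prfun prfun

fun peval :: "prfun \<Rightarrow> nat list \<Rightarrow> nat" where
  "peval PZ xs = 0"
| "peval PS xs = (case xs of [] \<Rightarrow> 1 | x # _ \<Rightarrow> Suc x)"
| "peval (PProj i) xs = (if i < length xs then xs ! i else 0)"
| "peval (PComp f gs) xs = peval f (map (\<lambda>g. peval g xs) gs)"
| "peval (PRec f g) [] = 0"
| "peval (PRec f g) (n # xs) = rec_nat (peval f xs) (\<lambda>m r. peval g (r # m # xs)) n"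

definition prim_rec_set :: "nat set \<Rightarrow> bool" where
  "prim_rec_set S \<longleftrightarrow> (\<exists>f. \<forall>n. peval f [n] = (if n \<in> S then 1 else 0))"

definition pr_axiomatized_consistent_ext_PA :: "fm set \<Rightarrow> bool" where
  "pr_axiomatized_consistent_ext_PA T \<longleftrightarrow>
     (\<forall>\<phi>\<in>T. sentence \<phi>) \<and> prim_rec_set (code ` T) \<and>
     (\<forall>\<phi>. prv PA \<phi> \<longrightarrow> prv T \<phi>) \<and> \<not> prv T Bot"

definition PrAt :: "fm \<Rightarrow> fm \<Rightarrow> fm" where
  "PrAt Pr \<phi> = subst_fm 0 (num (code \<phi>)) Pr"

definition prov_pred :: "fm set \<Rightarrow> fm \<Rightarrow> bool" where
  "prov_pred T Pr \<longleftrightarrow> fv Pr \<subseteq> {0} \<and>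
     (\<forall>n. prv PA (subst_fm 0 (num n) Pr) \<longleftrightarrow> (\<exists>\<phi>. code \<phi> = n \<and> prv T \<phi>))"

definition cond_M :: "fm set \<Rightarrow> fm \<Rightarrow> bool" where
  "cond_M T Pr \<longleftrightarrow> (\<forall>\<phi> \<psi>. prv T (Imp \<phi> \<psi>) \<longrightarrow> prv T (Imp (PrAt Pr \<phi>) (PrAt Pr \<psi>)))"

datatype mfm = PVar nat | MBot | MImp mfm mfm | Box mfm

fun meval :: "(mfm \<Rightarrow> bool) \<Rightarrow> mfm \<Rightarrow> bool" where
  "meval v (PVar p) = v (PVar p)"
| "meval v MBot = False"
| "meval v (MImp A B) = (meval v A \<longrightarrow> meval v B)"
| "meval v (Box A) = v (Box A)"

definition taut :: "mfm \<Rightarrow> bool" where "taut A \<longleftrightarrow> (\<forall>v. meval v A)"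

datatype logic = MN | MNF

inductive mprv :: "logic \<Rightarrow> mfm \<Rightarrow> bool" for L :: logic where
  taut: "taut A \<Longrightarrow> mprv L A"
| mmp: "mprv L (MImp A B) \<Longrightarrow> mprv L A \<Longrightarrow> mprv L B"
| nec: "mprv L A \<Longrightarrow> mprv L (Box A)"
| rm: "mprv L (MImp A B) \<Longrightarrow> mprv L (MImp (Box A) (Box B))"
| four: "L = MNF \<Longrightarrow> mprv L (MImp (Box A) (Box (Box A)))"

fun interp :: "fm \<Rightarrow> (nat \<Rightarrow> fm) \<Rightarrow> mfm \<Rightarrow> fm" where
  "interp Pr \<sigma> (PVar p) = \<sigma> p"
| "interp Pr \<sigma> MBot = Eq Zero (Sc Zero)"
| "interp Pr \<sigma> (MImp A B) = Imp (interp Pr \<sigma> A) (interp Pr \<sigma> B)"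
| "interp Pr \<sigma> (Box A) = PrAt Pr (interp Pr \<sigma> A)"

end

theory Submission
  imports Defs "HOL-Library.Countable_Set"
begin

text \<open>
  By diagonalisation \<open>Pr\<close> and the sentences \<open>\<sigma>\<^sub>j\<close> may refer to their own codes. An event
  is a stage \<open>p\<close> at which \<open>T\<close> has proved a Boolean combination of sentences \<open>Pr(x)\<close>, \<open>\<sigma>\<^sub>j\<close> that
  is falsified by a finite assignment \<open>e\<close> whose negative part is disjoint from the closure of its
  positive part and of the theorems of \<open>T\<close> found before \<open>p\<close> under the rule \<open>x \<turnstile> y\<close> whenever
  \<open>T \<turnstile> x \<rightarrow> y\<close> (and, for MNF, \<open>x \<turnstile> Pr(x)\<close>). \<open>Pr\<close> enumerates the closures stage by stage and, at the
  first event, makes \<open>e\<close> the true assignment and stops. If an event happened, every model of \<open>T\<close>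
  would satisfy \<open>e\<close> and hence refute a theorem of \<open>T\<close>; so there is none, and \<open>Pr\<close> defines
  provability. In any model of PA, \<open>Pr\<close> is closed under the rule: at a standard stage by truth in the
  standard model, at a nonstandard stage because standard instances of the rule are available there.
  By Goedel's completeness theorem this gives M and, for MNF, the scheme 4.

  For arithmetical completeness let \<open>\<L>\<close> consist of the modal formulas whose interpretation is
  provable in \<open>T\<close>. If \<open>\<L>\<close> exceeded the modal logic, some \<open>D\<close> in \<open>\<L>\<close> would fail under a valuation of
  the variables together with a set of formulas \<open>A\<close> (those with \<open>Box A\<close> true) closed under
  \<open>\<L>\<close>-consequence, and the restriction of this valuation to \<open>D\<close> would be an event.
\<close>

section \<open>Simultaneous substitution\<close>

text \<open>Provability of M and 4 in PA is read off from the models of PA. Events are excluded only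
  in the standard model: a nonstandard stage of another model may carry one, and there
  \<open>Pr\<close> may hold of non-theorems. The rule behind M is therefore imposed on the closure
  itself, and the closure is defined as an intersection of closed sets, which makes it closed in
  every model directly from its definition. Stopping at the first event protects the chosen
  assignment from later stages, and disjointness of its negative part from the closure is what
  allows \<open>Pr\<close> to realise the assignment at all. \<open>T\<close> is consistent but
  possibly false, so the contradiction from an event is sought in a model of \<open>T\<close> and
  not in the standard one. Finally, an event sees provability in \<open>T\<close>, that is,
  consequence in \<open>\<L>\<close> and not in the modal logic to be matched. The completeness
  criterion thus has to recover the logic from truth under valuations closed under the still unknown
  \<open>\<L>\<close>.\<close>

fun ssubst_trm :: "(nat \<Rightarrow> trm) \<Rightarrow> trm \<Rightarrow> trm" where
  "ssubst_trm s (Var i) = s i"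
| "ssubst_trm s Zero = Zero"
| "ssubst_trm s (Sc t) = Sc (ssubst_trm s t)"
| "ssubst_trm s (Plus t u) = Plus (ssubst_trm s t) (ssubst_trm s u)"
| "ssubst_trm s (Times t u) = Times (ssubst_trm s t) (ssubst_trm s u)"

definition up_subst :: "(nat \<Rightarrow> trm) \<Rightarrow> nat \<Rightarrow> trm" where
  "up_subst s = case_nat (Var 0) (\<lambda>i. lift_trm 0 (s i))"

text \<open>Lifting and single substitution are both instances of this operation, so the commutation
  laws for de Bruijn indices follow from the one composition law \<open>ssubst_fm_comp\<close> and a
  pointwise comparison of substitutions.\<close>

fun ssubst_fm :: "(nat \<Rightarrow> trm) \<Rightarrow> fm \<Rightarrow> fm" where
  "ssubst_fm s Bot = Bot"
| "ssubst_fm s (Eq t u) = Eq (ssubst_trm s t) (ssubst_trm s u)"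
| "ssubst_fm s (Lt t u) = Lt (ssubst_trm s t) (ssubst_trm s u)"
| "ssubst_fm s (Imp \<phi> \<psi>) = Imp (ssubst_fm s \<phi>) (ssubst_fm s \<psi>)"
| "ssubst_fm s (All \<phi>) = All (ssubst_fm (up_subst s) \<phi>)"

lemma up_subst_simps [simp]:
  "up_subst s 0 = Var 0" "up_subst s (Suc i) = lift_trm 0 (s i)"
  by (simp_all add: up_subst_def)

lemma ssubst_fm_connectives [simp]:
  "ssubst_fm s (Neg \<phi>) = Neg (ssubst_fm s \<phi>)"
  "ssubst_fm s (Conj \<phi> \<psi>) = Conj (ssubst_fm s \<phi>) (ssubst_fm s \<psi>)"
  "ssubst_fm s (Ex \<phi>) = Ex (ssubst_fm (up_subst s) \<phi>)"
  by (simp_all add: Neg_def Conj_def Ex_def)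

lemma lift_trm_ssubst: "lift_trm k t = ssubst_trm (\<lambda>i. if i < k then Var i else Var (Suc i)) t"
  by (induction t) auto

lemma lift_trm_0: "lift_trm 0 t = ssubst_trm (\<lambda>i. Var (Suc i)) t"
  by (simp add: lift_trm_ssubst)

lemma subst_trm_ssubst:
  "subst_trm k u t = ssubst_trm (\<lambda>i. if i < k then Var i else if i = k then u else Var (i - 1)) t"
  by (induction t) auto

lemma lift_fm_ssubst: "lift_fm k \<phi> = ssubst_fm (\<lambda>i. if i < k then Var i else Var (Suc i)) \<phi>"
proof (induction \<phi> arbitrary: k)
  case (All \<phi>)
  have "up_subst (\<lambda>i. if i < k then Var i else Var (Suc i)) =
        (\<lambda>i. if i < Suc k then Var i else Var (Suc i))"
    by (rule ext, simp add: up_subst_def split: nat.split)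
  then show ?case using All by simp
qed (simp_all add: lift_trm_ssubst)

lemma subst_fm_ssubst:
  "subst_fm k u \<phi> = ssubst_fm (\<lambda>i. if i < k then Var i else if i = k then u else Var (i - 1)) \<phi>"
proof (induction \<phi> arbitrary: k u)
  case (All \<phi>)
  have "up_subst (\<lambda>i. if i < k then Var i else if i = k then u else Var (i - 1)) =
        (\<lambda>i. if i < Suc k then Var i else if i = Suc k then lift_trm 0 u else Var (i - 1))"
    by (rule ext, auto simp add: up_subst_def split: nat.split)
  then show ?case using All by simp
qed (simp_all add: subst_trm_ssubst)

lemma ssubst_trm_cong: "(\<And>i. i \<in> fv_trm t \<Longrightarrow> s i = s' i) \<Longrightarrow> ssubst_trm s t = ssubst_trm s' t"
  by (induction t) auto

lemma ssubst_fm_cong: "(\<And>i. i \<in> fv \<phi> \<Longrightarrow> s i = s' i) \<Longrightarrow> ssubst_fm s \<phi> = ssubst_fm s' \<phi>"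
proof (induction \<phi> arbitrary: s s')
  case (All \<phi>)
  have "ssubst_fm (up_subst s) \<phi> = ssubst_fm (up_subst s') \<phi>"
  proof (rule All.IH)
    fix i assume "i \<in> fv \<phi>"
    then show "up_subst s i = up_subst s' i"
      using All.prems by (cases i) force+
  qed
  then show ?case by simp
next
  case (Eq t u) then show ?case by (auto intro!: ssubst_trm_cong)
next
  case (Lt t u) then show ?case by (auto intro!: ssubst_trm_cong)
next
  case (Imp \<phi> \<psi>)
  have "ssubst_fm s \<phi> = ssubst_fm s' \<phi>" by (rule Imp.IH) (simp add: Imp.prems)
  moreover have "ssubst_fm s \<psi> = ssubst_fm s' \<psi>" by (rule Imp.IH) (simp add: Imp.prems)
  ultimately show ?case by simp
qed simp

lemma ssubst_trm_comp: "ssubst_trm s (ssubst_trm s' t) = ssubst_trm (\<lambda>i. ssubst_trm s (s' i)) t"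
  by (induction t) auto

lemma ssubst_trm_up_lift: "ssubst_trm (up_subst s) (lift_trm 0 t) = lift_trm 0 (ssubst_trm s t)"
  by (induction t) auto

lemma ssubst_fm_comp: "ssubst_fm s (ssubst_fm s' \<phi>) = ssubst_fm (\<lambda>i. ssubst_trm s (s' i)) \<phi>"
proof (induction \<phi> arbitrary: s s')
  case (All \<phi>)
  have "(\<lambda>i. ssubst_trm (up_subst s) (up_subst s' i)) = up_subst (\<lambda>i. ssubst_trm s (s' i))"
    by (rule ext, simp add: up_subst_def ssubst_trm_up_lift[unfolded up_subst_def] split: nat.split)
  then show ?case using All by simp
qed (simp_all add: ssubst_trm_comp)

lemma ssubst_trm_Var [simp]: "ssubst_trm Var t = t"
  by (induction t) auto

lemma up_subst_Var [simp]: "up_subst Var = Var"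
  by (rule ext, simp add: up_subst_def split: nat.split)

lemma ssubst_fm_Var [simp]: "ssubst_fm Var \<phi> = \<phi>"
  by (induction \<phi>) auto

lemma ssubst_sentence: "sentence \<phi> \<Longrightarrow> ssubst_fm s \<phi> = \<phi>"
  using ssubst_fm_cong[of \<phi> s Var] by (simp add: sentence_def)

lemma ssubst_subst_0:
  "ssubst_fm s (subst_fm 0 t \<phi>) = subst_fm 0 (ssubst_trm s t) (ssubst_fm (up_subst s) \<phi>)"
  unfolding subst_fm_ssubst ssubst_fm_comp
  by (rule ssubst_fm_cong) (auto simp: up_subst_def lift_trm_0 ssubst_trm_comp split: nat.split)

lemma ssubst_lift_0: "ssubst_fm (up_subst s) (lift_fm 0 \<phi>) = lift_fm 0 (ssubst_fm s \<phi>)"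
  unfolding lift_fm_ssubst ssubst_fm_comp
  by (rule ssubst_fm_cong) (auto simp: lift_trm_0)

text \<open>The logical schemes are stable because instantiation and lifting commute with
  substitution, and the members of \<open>Ax\<close> are sentences, hence fixed. This later turns a
  fresh variable into a bound one.\<close>

lemma prv_ssubst:
  assumes "\<forall>\<chi>\<in>Ax. sentence \<chi>" and "prv Ax \<phi>"
  shows "prv Ax (ssubst_fm s \<phi>)"
  using assms(2)
proof (induction arbitrary: s)
  case (ax \<phi>)
  then show ?case using assms(1) by (simp add: ssubst_sentence prv.ax)
next
  case (ax_inst \<phi> t)
  then show ?case by (simp add: ssubst_subst_0 prv.ax_inst)
next
  case (ax_allimp \<phi> \<psi>)
  then show ?case by (simp add: ssubst_lift_0 prv.ax_allimp)
next
  case (ax_leibniz a b \<phi>)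
  then show ?case by (simp add: ssubst_subst_0 prv.ax_leibniz)
next
  case (mp \<phi> \<psi>)
  then show ?case by (metis prv.mp ssubst_fm.simps(4))
qed (auto intro: prv.intros)

section \<open>Structures, soundness\<close>

datatype 'a struct = Struct (zer: 'a) (suc: "'a \<Rightarrow> 'a") (plus: "'a \<Rightarrow> 'a \<Rightarrow> 'a")
  (times: "'a \<Rightarrow> 'a \<Rightarrow> 'a") (less: "'a \<Rightarrow> 'a \<Rightarrow> bool")

fun eval_trm :: "'a struct \<Rightarrow> (nat \<Rightarrow> 'a) \<Rightarrow> trm \<Rightarrow> 'a" where
  "eval_trm M e (Var i) = e i"
| "eval_trm M e Zero = zer M"
| "eval_trm M e (Sc t) = suc M (eval_trm M e t)"
| "eval_trm M e (Plus t u) = plus M (eval_trm M e t) (eval_trm M e u)"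
| "eval_trm M e (Times t u) = times M (eval_trm M e t) (eval_trm M e u)"

fun eval_fm :: "'a struct \<Rightarrow> (nat \<Rightarrow> 'a) \<Rightarrow> fm \<Rightarrow> bool" where
  "eval_fm M e Bot \<longleftrightarrow> False"
| "eval_fm M e (Eq t u) \<longleftrightarrow> eval_trm M e t = eval_trm M e u"
| "eval_fm M e (Lt t u) \<longleftrightarrow> less M (eval_trm M e t) (eval_trm M e u)"
| "eval_fm M e (Imp \<phi> \<psi>) \<longleftrightarrow> (eval_fm M e \<phi> \<longrightarrow> eval_fm M e \<psi>)"
| "eval_fm M e (All \<phi>) \<longleftrightarrow> (\<forall>x. eval_fm M (case_nat x e) \<phi>)"

lemma eval_connectives [simp]:
  "eval_fm M e (Neg \<phi>) \<longleftrightarrow> \<not> eval_fm M e \<phi>"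
  "eval_fm M e (Conj \<phi> \<psi>) \<longleftrightarrow> eval_fm M e \<phi> \<and> eval_fm M e \<psi>"
  "eval_fm M e (Iff \<phi> \<psi>) \<longleftrightarrow> (eval_fm M e \<phi> \<longleftrightarrow> eval_fm M e \<psi>)"
  "eval_fm M e (Ex \<phi>) \<longleftrightarrow> (\<exists>x. eval_fm M (case_nat x e) \<phi>)"
  by (auto simp: Neg_def Conj_def Ex_def Iff_def)

lemma eval_trm_ssubst: "eval_trm M e (ssubst_trm s t) = eval_trm M (\<lambda>i. eval_trm M e (s i)) t"
  by (induction t) auto

lemma eval_trm_lift [simp]: "eval_trm M (case_nat x e) (lift_trm 0 t) = eval_trm M e t"
  by (induction t) auto

lemma eval_fm_ssubst: "eval_fm M e (ssubst_fm s \<phi>) = eval_fm M (\<lambda>i. eval_trm M e (s i)) \<phi>"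
proof (induction \<phi> arbitrary: s e)
  case (All \<phi>)
  have "(\<lambda>i. eval_trm M (case_nat x e) (up_subst s i)) = case_nat x (\<lambda>i. eval_trm M e (s i))" for x
    by (rule ext, simp add: up_subst_def split: nat.split)
  then show ?case using All by simp
qed (simp_all add: eval_trm_ssubst)

lemma eval_fm_subst_0: "eval_fm M e (subst_fm 0 t \<phi>) = eval_fm M (case_nat (eval_trm M e t) e) \<phi>"
  unfolding subst_fm_ssubst eval_fm_ssubst
  by (rule arg_cong[of _ _ "\<lambda>e. eval_fm M e \<phi>"], rule ext, simp split: nat.split)

lemma eval_fm_lift_0: "eval_fm M (case_nat x e) (lift_fm 0 \<phi>) = eval_fm M e \<phi>"
  unfolding lift_fm_ssubst eval_fm_ssubst by simp

lemma eval_trm_cong: "(\<And>i. i \<in> fv_trm t \<Longrightarrow> e i = e' i) \<Longrightarrow> eval_trm M e t = eval_trm M e' t"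
  by (induction t) auto

lemma eval_fm_cong: "(\<And>i. i \<in> fv \<phi> \<Longrightarrow> e i = e' i) \<Longrightarrow> eval_fm M e \<phi> = eval_fm M e' \<phi>"
proof (induction \<phi> arbitrary: e e')
  case (All \<phi>)
  have "eval_fm M (case_nat x e) \<phi> = eval_fm M (case_nat x e') \<phi>" for x
  proof (rule All.IH)
    fix i assume "i \<in> fv \<phi>"
    then show "case_nat x e i = case_nat x e' i"
      using All.prems by (cases i) force+
  qed
  then show ?case by simp
next
  case (Eq t u)
  then have "eval_trm M e t = eval_trm M e' t" "eval_trm M e u = eval_trm M e' u"
    by (auto intro!: eval_trm_cong)
  then show ?case by simp
next
  case (Lt t u)
  then have "eval_trm M e t = eval_trm M e' t" "eval_trm M e u = eval_trm M e' u"
    by (auto intro!: eval_trm_cong)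
  then show ?case by simp
next
  case (Imp \<phi> \<psi>)
  have "eval_fm M e \<phi> = eval_fm M e' \<phi>" by (rule Imp.IH) (simp add: Imp.prems)
  moreover have "eval_fm M e \<psi> = eval_fm M e' \<psi>" by (rule Imp.IH) (simp add: Imp.prems)
  ultimately show ?case by simp
qed simp

definition models :: "'a struct \<Rightarrow> fm set \<Rightarrow> bool" where
  "models M Ax \<longleftrightarrow> (\<forall>\<chi>\<in>Ax. \<forall>e. eval_fm M e \<chi>)"

lemma soundness:
  assumes "prv Ax \<phi>" and "models M Ax"
  shows "eval_fm M e \<phi>"
  using assms(1)
proof (induction arbitrary: e)
  case (ax \<phi>)
  then show ?case using assms(2) by (simp add: models_def)
qed (auto simp: eval_fm_subst_0 eval_fm_lift_0)

section \<open>Completeness\<close>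

text \<open>Generalisation is confined to \<open>prv\<close>, so free variables of hypotheses behave
  like constants and the deduction theorem holds without a side condition.\<close>

inductive dv :: "fm set \<Rightarrow> fm set \<Rightarrow> fm \<Rightarrow> bool" for Ax S where
  dv_prv: "prv Ax \<phi> \<Longrightarrow> dv Ax S \<phi>"
| dv_hyp: "\<phi> \<in> S \<Longrightarrow> dv Ax S \<phi>"
| dv_mp: "dv Ax S (Imp \<phi> \<psi>) \<Longrightarrow> dv Ax S \<phi> \<Longrightarrow> dv Ax S \<psi>"

lemma dv_mono: "dv Ax S \<phi> \<Longrightarrow> S \<subseteq> S' \<Longrightarrow> dv Ax S' \<phi>"
  by (induction rule: dv.induct) (auto intro: dv.intros)

lemma dv_K: "dv Ax S \<phi> \<Longrightarrow> dv Ax S (Imp \<psi> \<phi>)"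
  by (meson dv_mp dv_prv prv.ax_K)

lemma dv_S: "dv Ax S (Imp \<phi> (Imp \<psi> \<chi>)) \<Longrightarrow> dv Ax S (Imp \<phi> \<psi>) \<Longrightarrow> dv Ax S (Imp \<phi> \<chi>)"
  by (meson dv_mp dv_prv prv.ax_S)

lemma dv_refl: "dv Ax S (Imp \<phi> \<phi>)"
  by (meson dv_S dv_prv prv.ax_K)

lemma dv_deduction:
  assumes "dv Ax (insert \<chi> S) \<phi>" shows "dv Ax S (Imp \<chi> \<phi>)"
  using assms
proof (induction rule: dv.induct)
  case (dv_mp \<phi> \<psi>)
  then show ?case by (meson dv_S)
qed (auto intro: dv_K dv_refl dv.intros)

lemma dv_compact: "dv Ax S \<phi> \<Longrightarrow> \<exists>F. finite F \<and> F \<subseteq> S \<and> dv Ax F \<phi>"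
proof (induction rule: dv.induct)
  case (dv_mp \<phi> \<psi>)
  then obtain F G where "finite F" "F \<subseteq> S" "dv Ax F (Imp \<phi> \<psi>)" "finite G" "G \<subseteq> S" "dv Ax G \<phi>"
    by blast
  then show ?case
    by (intro exI[of _ "F \<union> G"]) (auto intro: dv.dv_mp dv_mono)
next
  case (dv_hyp \<phi>)
  then show ?case by (intro exI[of _ "{\<phi>}"]) (auto intro: dv.intros)
next
  case (dv_prv \<phi>)
  then show ?case by (intro exI[of _ "{}"]) (auto intro: dv.intros)
qed

lemma dv_empty: "dv Ax {} \<phi> \<Longrightarrow> prv Ax \<phi>"
  by (induction rule: dv.induct) (auto intro: prv.mp)

lemma dv_contra:
  assumes "dv Ax (insert (Neg \<phi>) S) Bot" shows "dv Ax S \<phi>"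
  using dv_deduction[OF assms] by (metis Neg_def dv_mp dv_prv prv.ax_DN)

lemma dv_efq: "dv Ax S Bot \<Longrightarrow> dv Ax S \<phi>"
  by (metis dv_contra dv_mono subset_insertI)

lemma dv_ssubst:
  assumes "\<forall>\<chi>\<in>Ax. sentence \<chi>" "dv Ax S \<phi>"
  shows "dv Ax (ssubst_fm s ` S) (ssubst_fm s \<phi>)"
  using assms(2) by induction (auto intro: dv.intros prv_ssubst[OF assms(1)])

text \<open>Makes \<open>ax_inst\<close> with \<open>Var 0\<close> strip the quantifier off a lifted
  universal formula and return its body literally.\<close>

lemma subst_lift_1: "subst_fm 0 (Var 0) (lift_fm (Suc 0) \<phi>) = \<phi>"
proof -
  have "subst_fm 0 (Var 0) (lift_fm (Suc 0) \<phi>) = ssubst_fm Var \<phi>"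
    unfolding subst_fm_ssubst lift_fm_ssubst ssubst_fm_comp by (rule ssubst_fm_cong) auto
  then show ?thesis by simp
qed

lemma prv_all_mp: "prv Ax (Imp (All (Imp \<phi> \<psi>)) (Imp (All \<phi>) (All \<psi>)))"
proof -
  let ?A = "All (Imp \<phi> \<psi>)" and ?B = "All \<phi>"
  have A: "prv Ax (Imp (lift_fm 0 ?A) (Imp \<phi> \<psi>))"
    using prv.ax_inst[of Ax "lift_fm 1 (Imp \<phi> \<psi>)" "Var 0"] by (simp add: subst_lift_1)
  have B: "prv Ax (Imp (lift_fm 0 ?B) \<phi>)"
    using prv.ax_inst[of Ax "lift_fm 1 \<phi>" "Var 0"] by (simp add: subst_lift_1)
  have "dv Ax {lift_fm 0 ?B, lift_fm 0 ?A} \<psi>"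
    by (meson A B dv_hyp dv_mp dv_prv insertI1 insertI2)
  then have "prv Ax (Imp (lift_fm 0 ?A) (Imp (lift_fm 0 ?B) \<psi>))"
    using dv_deduction dv_empty by blast
  then have "prv Ax (Imp ?A (All (Imp (lift_fm 0 ?B) \<psi>)))"
    by (meson prv.gen prv.ax_allimp prv.mp)
  then have "dv Ax {?A} (Imp ?B (All \<psi>))"
    by (meson dv_hyp dv_mp dv_prv insertI1 prv.ax_allimp)
  then show ?thesis using dv_deduction dv_empty by blast
qed

lemma dv_gen:
  assumes "dv Ax (lift_fm 0 ` S) \<psi>" shows "dv Ax S (All \<psi>)"
  using assms
proof (induction rule: dv.induct)
  case (dv_prv \<phi>)
  then show ?case by (meson dv.dv_prv prv.gen)
next
  case (dv_hyp \<phi>)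
  then obtain \<chi> where "\<chi> \<in> S" "\<phi> = lift_fm 0 \<chi>" by blast
  moreover have "prv Ax (All (Imp (lift_fm 0 \<chi>) (lift_fm 0 \<chi>)))"
    using dv_refl dv_empty prv.gen by metis
  ultimately show ?case
    by (meson dv.dv_hyp dv.dv_prv dv_mp prv.ax_allimp)
next
  case (dv_mp \<phi> \<psi>)
  then show ?case by (meson dv.dv_mp dv_prv prv_all_mp)
qed

lemma finite_fv_trm: "finite (fv_trm t)"
  by (induction t) auto

lemma finite_fv: "finite (fv \<phi>)"
  by (induction \<phi>) (auto simp: finite_fv_trm)

lemma dv_gen_fresh:
  assumes sent: "\<forall>\<chi>\<in>Ax. sentence \<chi>"
    and d: "dv Ax S (subst_fm 0 (Var k) \<psi>)"
    and fresh: "\<forall>\<chi>\<in>S. k \<notin> fv \<chi>" "k \<notin> fv (All \<psi>)"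
  shows "dv Ax S (All \<psi>)"
proof -
  \<comment> \<open>\<open>s\<close> renames the fresh variable \<open>k\<close> to the bound index
    0 and shifts the rest: the instance at \<open>k\<close> becomes the body itself, and hypotheses
    without \<open>k\<close> are merely lifted, as \<open>dv_gen\<close> demands.\<close>
  define s where "s = (\<lambda>i. if i = k then Var 0 else Var (Suc i))"
  have "ssubst_fm s (subst_fm 0 (Var k) \<psi>) = ssubst_fm Var \<psi>"
    unfolding subst_fm_ssubst ssubst_fm_comp
  proof (rule ssubst_fm_cong)
    fix i assume i: "i \<in> fv \<psi>"
    have "i \<noteq> Suc k" using fresh(2) i by force
    then show "ssubst_trm s (if i < 0 then Var i else if i = 0 then Var k else Var (i - 1)) = Var i"
      by (auto simp: s_def)
  qed
  moreover have "ssubst_fm s ` S = lift_fm 0 ` S"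
    by (rule image_cong, simp, unfold lift_fm_ssubst, rule ssubst_fm_cong)
       (use fresh(1) in \<open>auto simp: s_def\<close>)
  ultimately show ?thesis
    using dv_gen dv_ssubst[OF sent d, of s] by simp
qed

lemma inj_code_trm: "code_trm t = code_trm u \<Longrightarrow> t = u"
  by (induction t arbitrary: u; case_tac u) auto

lemma inj_code: "code \<phi> = code \<psi> \<Longrightarrow> \<phi> = \<psi>"
  by (induction \<phi> arbitrary: \<psi>; case_tac \<psi>) (auto dest: inj_code_trm)

lemma code_eq_iff [simp]: "code \<phi> = code \<psi> \<longleftrightarrow> \<phi> = \<psi>"
  using inj_code by blast

lemma code_trm_eq_iff [simp]: "code_trm t = code_trm u \<longleftrightarrow> t = u"
  using inj_code_trm by blast

section \<open>Henkin construction with variables as witnesses\<close>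

definition fresh_var :: "fm set \<Rightarrow> nat" where
  "fresh_var S = (SOME k. \<forall>\<chi>\<in>S. k \<notin> fv \<chi>)"

lemma fresh_var: "finite S \<Longrightarrow> \<chi> \<in> S \<Longrightarrow> fresh_var S \<notin> fv \<chi>"
proof -
  assume "finite S" "\<chi> \<in> S"
  then have "finite (\<Union>\<chi>\<in>S. fv \<chi>)" by (simp add: finite_fv)
  then obtain k where "k \<notin> (\<Union>\<chi>\<in>S. fv \<chi>)" using ex_new_if_finite infinite_UNIV_nat by blast
  then have "\<exists>k. \<forall>\<chi>\<in>S. k \<notin> fv \<chi>" by blast
  from someI_ex[OF this] show ?thesis using \<open>\<chi> \<in> S\<close> by (simp add: fresh_var_def)
qed

definition henkin_witness :: "fm set \<Rightarrow> fm \<Rightarrow> fm set" where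
  "henkin_witness S \<chi> =
     {Neg (subst_fm 0 (Var (fresh_var (insert \<chi> S))) \<psi>) |\<psi>. \<chi> = Neg (All \<psi>)}"

text \<open>\<open>inv code\<close> enumerates all formulas, each at the index given by its code. A
  number that codes nothing yields some formula, whose addition is guarded by the same consistency
  test.\<close>

fun henkin_seq :: "fm set \<Rightarrow> fm \<Rightarrow> nat \<Rightarrow> fm set" where
  "henkin_seq Ax \<phi> 0 = {\<phi>}"
| "henkin_seq Ax \<phi> (Suc n) = (let S = henkin_seq Ax \<phi> n; \<chi> = inv code n in
     if dv Ax (insert \<chi> S) Bot then S else insert \<chi> (S \<union> henkin_witness S \<chi>))"

definition henkin_set :: "fm set \<Rightarrow> fm \<Rightarrow> fm set" where
  "henkin_set Ax \<phi> = (\<Union>n. henkin_seq Ax \<phi> n)"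

lemma finite_henkin_witness: "finite (henkin_witness S \<chi>)"
proof -
  have "henkin_witness S \<chi> \<subseteq> (case \<chi> of Imp (All \<psi>) Bot \<Rightarrow> 
      {Neg (subst_fm 0 (Var (fresh_var (insert \<chi> S))) \<psi>)} | _ \<Rightarrow> {})"
    by (auto simp: henkin_witness_def Neg_def)
  moreover have "finite (case \<chi> of Imp (All \<psi>) Bot \<Rightarrow> 
      {Neg (subst_fm 0 (Var (fresh_var (insert \<chi> S))) \<psi>)} | _ \<Rightarrow> {})"
    by (auto split: fm.split)
  ultimately show ?thesis by (rule finite_subset)
qed

lemma finite_henkin_seq: "finite (henkin_seq Ax \<phi> n)"
  by (induction n) (auto simp: Let_def finite_henkin_witness)

lemma henkin_seq_mono: "m \<le> n \<Longrightarrow> henkin_seq Ax \<phi> m \<subseteq> henkin_seq Ax \<phi> n"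
  by (rule lift_Suc_mono_le[of "henkin_seq Ax \<phi>"]) (auto simp: Let_def)

text \<open>If the witness caused inconsistency, the instance at the fresh variable would be
  derivable, hence also the universal formula, whose negation is in the same set.\<close>

lemma henkin_witness_consistent:
  assumes sent: "\<forall>\<chi>\<in>Ax. sentence \<chi>" and fin: "finite S"
    and con: "\<not> dv Ax (insert \<chi> S) Bot"
  shows "\<not> dv Ax (insert \<chi> (S \<union> henkin_witness S \<chi>)) Bot"
proof (cases "\<exists>\<psi>. \<chi> = Neg (All \<psi>)")
  case True
  then obtain \<psi> where \<chi>: "\<chi> = Neg (All \<psi>)" by blast
  let ?k = "fresh_var (insert \<chi> S)"
  have w: "henkin_witness S \<chi> = {Neg (subst_fm 0 (Var ?k) \<psi>)}"
    by (auto simp: henkin_witness_def \<chi> Neg_def)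
  show ?thesis
  proof
    assume "dv Ax (insert \<chi> (S \<union> henkin_witness S \<chi>)) Bot"
    then have "dv Ax (insert (Neg (subst_fm 0 (Var ?k) \<psi>)) (insert \<chi> S)) Bot"
      by (simp add: w insert_commute)
    then have d: "dv Ax (insert \<chi> S) (subst_fm 0 (Var ?k) \<psi>)"
      by (rule dv_contra)
    have f: "\<forall>\<chi>'\<in>insert \<chi> S. ?k \<notin> fv \<chi>'"
      using fin fresh_var[of "insert \<chi> S"] by auto
    moreover have "?k \<notin> fv (All \<psi>)"
      using f by (auto simp: \<chi> Neg_def)
    ultimately have "dv Ax (insert \<chi> S) (All \<psi>)"
      using dv_gen_fresh[OF sent d] by blast
    moreover have "dv Ax (insert \<chi> S) (Imp (All \<psi>) Bot)"
      using \<chi> by (auto simp: Neg_def intro: dv.intros)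
    ultimately show False using con dv_mp by blast
  qed
next
  case False
  then have "henkin_witness S \<chi> = {}" by (auto simp: henkin_witness_def)
  then show ?thesis using con by simp
qed

lemma henkin_seq_consistent:
  assumes sent: "\<forall>\<chi>\<in>Ax. sentence \<chi>" and "\<not> dv Ax {\<phi>} Bot"
  shows "\<not> dv Ax (henkin_seq Ax \<phi> n) Bot"
proof (induction n)
  case (Suc n)
  then show ?case
    using henkin_witness_consistent[OF sent finite_henkin_seq] by (simp add: Let_def)
qed (use assms in simp)

context
  fixes Ax :: "fm set" and \<phi> :: fm
  assumes sent: "\<forall>\<chi>\<in>Ax. sentence \<chi>" and con: "\<not> dv Ax {\<phi>} Bot"
begin

abbreviation (input) "HS \<equiv> henkin_set Ax \<phi>"

lemma henkin_seq_subset: "henkin_seq Ax \<phi> n \<subseteq> HS"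
  by (auto simp: henkin_set_def)

lemma henkin_start: "\<phi> \<in> HS"
  using henkin_seq_subset[of 0] by simp

lemma henkin_consistent: "\<not> dv Ax HS Bot"
proof
  assume "dv Ax HS Bot"
  from dv_compact[OF this] obtain F where F: "finite F" "F \<subseteq> HS" "dv Ax F Bot" by blast
  have "\<exists>n. F \<subseteq> henkin_seq Ax \<phi> n"
    using F(1,2)
  proof (induction F)
    case (insert x F)
    from insert obtain n where n: "F \<subseteq> henkin_seq Ax \<phi> n" by auto
    from insert obtain m where m: "x \<in> henkin_seq Ax \<phi> m" by (auto simp: henkin_set_def)
    note nm = n m
    have "insert x F \<subseteq> henkin_seq Ax \<phi> (max n m)"
      using nm henkin_seq_mono[of n "max n m" Ax \<phi>] henkin_seq_mono[of m "max n m" Ax \<phi>] by auto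
    then show ?case by blast
  qed simp
  then obtain n where "F \<subseteq> henkin_seq Ax \<phi> n" ..
  from dv_mono[OF F(3) this] show False using henkin_seq_consistent[OF sent con] by simp
qed

lemma henkin_max:
  "\<chi> \<in> HS \<and> henkin_witness (henkin_seq Ax \<phi> (code \<chi>)) \<chi> \<subseteq> HS \<or> dv Ax (insert \<chi> HS) Bot"
proof (cases "dv Ax (insert \<chi> (henkin_seq Ax \<phi> (code \<chi>))) Bot")
  case True
  then have "dv Ax (insert \<chi> HS) Bot"
    by (rule dv_mono) (use henkin_seq_subset in blast)
  then show ?thesis ..
next
  case False
  have inv: "inv code (code \<chi>) = \<chi>" by (simp add: inv_f_f inj_on_def)
  have "insert \<chi> (henkin_witness (henkin_seq Ax \<phi> (code \<chi>)) \<chi>) \<subseteq> henkin_seq Ax \<phi> (Suc (code \<chi>))"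
    using False by (auto simp: Let_def inv)
  then show ?thesis using henkin_seq_subset[of "Suc (code \<chi>)"] by blast
qed

lemma henkin_closed: "dv Ax HS \<chi> \<Longrightarrow> \<chi> \<in> HS"
  using henkin_max[of \<chi>] dv_deduction[of Ax \<chi> HS Bot] dv_mp[of Ax HS \<chi> Bot] henkin_consistent by blast

lemma henkin_Imp: "Imp \<chi> \<psi> \<in> HS \<longleftrightarrow> (\<chi> \<in> HS \<longrightarrow> \<psi> \<in> HS)"
proof
  assume "Imp \<chi> \<psi> \<in> HS"
  then show "\<chi> \<in> HS \<longrightarrow> \<psi> \<in> HS" using henkin_closed dv_mp dv_hyp by meson
next
  assume a: "\<chi> \<in> HS \<longrightarrow> \<psi> \<in> HS"
  show "Imp \<chi> \<psi> \<in> HS"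
  proof (cases "\<chi> \<in> HS")
    case True
    then show ?thesis using a henkin_closed dv_K dv_hyp by meson
  next
    case False
    then have "dv Ax (insert \<chi> HS) Bot" using henkin_max[of \<chi>] by blast
    then show ?thesis using dv_efq dv_deduction henkin_closed by meson
  qed
qed

lemma henkin_Bot: "Bot \<notin> HS"
  using henkin_consistent dv_hyp by blast

lemma henkin_All: "All \<psi> \<in> HS \<longleftrightarrow> (\<forall>t. subst_fm 0 t \<psi> \<in> HS)"
proof
  assume "All \<psi> \<in> HS"
  then show "\<forall>t. subst_fm 0 t \<psi> \<in> HS"
    using henkin_closed[OF dv_mp[OF dv_prv[OF prv.ax_inst] dv_hyp]] by blast
next
  assume all: "\<forall>t. subst_fm 0 t \<psi> \<in> HS"
  show "All \<psi> \<in> HS"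
  proof (rule ccontr)
    assume "All \<psi> \<notin> HS"
    then have "Neg (All \<psi>) \<in> HS" by (simp add: Neg_def henkin_Imp henkin_Bot)
    then have "\<not> dv Ax (insert (Neg (All \<psi>)) HS) Bot"
      using henkin_consistent by (simp add: insert_absorb)
    then have "henkin_witness (henkin_seq Ax \<phi> (code (Neg (All \<psi>)))) (Neg (All \<psi>)) \<subseteq> HS"
      using henkin_max by blast
    then obtain k where "Neg (subst_fm 0 (Var k) \<psi>) \<in> HS"
      unfolding henkin_witness_def by blast
    then show False using all by (simp add: Neg_def henkin_Imp henkin_Bot)
  qed
qed

lemma henkin_prv: "prv Ax \<chi> \<Longrightarrow> \<chi> \<in> HS"
  using henkin_closed dv_prv by blast

lemma henkin_leibniz: "Eq s t \<in> HS \<Longrightarrow> subst_fm 0 s \<chi> \<in> HS \<Longrightarrow> subst_fm 0 t \<chi> \<in> HS"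
  using henkin_prv[OF prv.ax_leibniz[of Ax s t \<chi>]] by (simp add: henkin_Imp)

lemma subst_lift_trm [simp]: "subst_trm 0 u (lift_trm 0 t) = t"
  by (induction t) auto

lemma henkin_refl: "Eq t t \<in> HS"
  by (intro henkin_prv prv.ax_refl)

text \<open>Here and in the next lemmas the laws of equality come from Leibniz's scheme: the context
  marks the replaced occurrence by \<open>Var 0\<close> and lifts the other terms to shield them
  from the substitution.\<close>

lemma henkin_sym: "Eq s t \<in> HS \<Longrightarrow> Eq t s \<in> HS"
  using henkin_leibniz[of s t "Eq (Var 0) (lift_trm 0 s)"] by (simp add: henkin_refl)

lemma henkin_trans: "Eq s t \<in> HS \<Longrightarrow> Eq t u \<in> HS \<Longrightarrow> Eq s u \<in> HS"
  using henkin_leibniz[of t u "Eq (lift_trm 0 s) (Var 0)"] by simp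

lemma henkin_Sc: "Eq s t \<in> HS \<Longrightarrow> Eq (Sc s) (Sc t) \<in> HS"
  using henkin_leibniz[of s t "Eq (Sc (lift_trm 0 s)) (Sc (Var 0))"] by (simp add: henkin_refl)

lemma henkin_Plus: "Eq s t \<in> HS \<Longrightarrow> Eq s' t' \<in> HS \<Longrightarrow> Eq (Plus s s') (Plus t t') \<in> HS"
  using henkin_leibniz[of s t "Eq (lift_trm 0 (Plus s s')) (Plus (Var 0) (lift_trm 0 s'))"]
    henkin_leibniz[of s' t' "Eq (lift_trm 0 (Plus s s')) (Plus (lift_trm 0 t) (Var 0))"]
  by (simp add: henkin_refl)

lemma henkin_Times: "Eq s t \<in> HS \<Longrightarrow> Eq s' t' \<in> HS \<Longrightarrow> Eq (Times s s') (Times t t') \<in> HS"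
  using henkin_leibniz[of s t "Eq (lift_trm 0 (Times s s')) (Times (Var 0) (lift_trm 0 s'))"]
    henkin_leibniz[of s' t' "Eq (lift_trm 0 (Times s s')) (Times (lift_trm 0 t) (Var 0))"]
  by (simp add: henkin_refl)

lemma henkin_Lt: "Eq s t \<in> HS \<Longrightarrow> Eq s' t' \<in> HS \<Longrightarrow> Lt s s' \<in> HS \<Longrightarrow> Lt t t' \<in> HS"
  using henkin_leibniz[of s t "Lt (Var 0) (lift_trm 0 s')"]
    henkin_leibniz[of s' t' "Lt (lift_trm 0 t) (Var 0)"]
  by simp

definition henkin_class :: "trm \<Rightarrow> trm set" where
  "henkin_class t = {s. Eq s t \<in> HS}"

lemma henkin_class_eq: "henkin_class s = henkin_class t \<longleftrightarrow> Eq s t \<in> HS"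
  using henkin_refl henkin_sym henkin_trans unfolding henkin_class_def by blast

text \<open>Terms modulo equality in the Henkin set form a countable structure. The distinct
  numerals keep it infinite, so it can be transported to \<open>nat\<close>; with all models on one
  fixed type, completeness can quantify over them.\<close>

lemma henkin_term_model:
  assumes inf: "\<And>m n. m \<noteq> n \<Longrightarrow> prv Ax (Neg (Eq (num m) (num n)))"
  shows "\<exists>(M :: nat struct) e. models M Ax \<and> eval_fm M e \<phi>"
proof -
  have "inj (\<lambda>n. henkin_class (num n))"
    by (rule injI, rule ccontr)
       (use inf henkin_prv in \<open>force simp: henkin_class_eq Neg_def henkin_Imp henkin_Bot\<close>)
  then have "infinite (range henkin_class)"
    by (metis (no_types, lifting) finite_subset finite_imageD image_subsetI infinite_UNIV_nat rangeI)
  moreover have "countable (UNIV :: trm set)"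
    by (rule countableI[of code_trm]) (simp add: inj_on_def)
  then have "countable (range henkin_class)" by simp
  ultimately obtain c where c: "bij_betw c (range henkin_class) (UNIV :: nat set)"
    using countableE_infinite by blast
  define h where "h t = c (henkin_class t)" for t
  have h_eq: "h s = h t \<longleftrightarrow> Eq s t \<in> HS" for s t
    using c by (auto simp: h_def henkin_class_eq[symmetric] bij_betw_def inj_on_def)
  have "range h = c ` range henkin_class" by (auto simp: h_def)
  then have "surj h" using c by (simp add: bij_betw_def)
  define r where "r = inv h"
  have hr [simp]: "h (r n) = n" for n unfolding r_def using \<open>surj h\<close> by (simp add: surj_f_inv_f)
  have rh: "Eq (r (h t)) t \<in> HS" for t using h_eq[of "r (h t)" t] by simp
  define M where "M = Struct (h Zero) (\<lambda>n. h (Sc (r n))) (\<lambda>m n. h (Plus (r m) (r n)))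
    (\<lambda>m n. h (Times (r m) (r n))) (\<lambda>m n. Lt (r m) (r n) \<in> HS)"
  have tr: "eval_trm M (\<lambda>i. h (s i)) t = h (ssubst_trm s t)" for s t
    by (induction t) (auto simp: M_def h_eq intro: rh henkin_Sc henkin_Plus henkin_Times)
  \<comment> \<open>Since \<open>h\<close> is surjective, valuations of the form \<open>h\<close>
    after \<open>s\<close> are all valuations. Keeping \<open>s\<close> arbitrary lets the
    quantifier case pass to \<open>case_nat t s\<close>.\<close>
  have truth: "eval_fm M (\<lambda>i. h (s i)) \<chi> \<longleftrightarrow> ssubst_fm s \<chi> \<in> HS" for s \<chi>
  proof (induction \<chi> arbitrary: s)
    case Bot
    then show ?case by (simp add: henkin_Bot)
  next
    case (Lt t u)
    have "Lt (r (h t)) (r (h u)) \<in> HS \<longleftrightarrow> Lt t u \<in> HS" for t u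
      using henkin_Lt rh henkin_sym by blast
    then show ?case by (simp add: tr) (simp add: M_def)
  next
    case (All \<chi>)
    have "eval_fm M (\<lambda>i. h (s i)) (All \<chi>) \<longleftrightarrow> (\<forall>t. eval_fm M (case_nat (h t) (\<lambda>i. h (s i))) \<chi>)"
      using hr by (metis eval_fm.simps(5))
    also have "\<dots> \<longleftrightarrow> (\<forall>t. eval_fm M (\<lambda>i. h (case_nat t s i)) \<chi>)"
    proof -
      have "case_nat (h t) (\<lambda>i. h (s i)) = (\<lambda>i. h (case_nat t s i))" for t
        by (rule ext, simp split: nat.split)
      then show ?thesis by simp
    qed
    also have "\<dots> \<longleftrightarrow> (\<forall>t. ssubst_fm (case_nat t s) \<chi> \<in> HS)"
      using All.IH by blast
    also have "\<dots> \<longleftrightarrow> (\<forall>t. subst_fm 0 t (ssubst_fm (up_subst s) \<chi>) \<in> HS)"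
    proof -
      have "subst_fm 0 t (ssubst_fm (up_subst s) \<chi>) = ssubst_fm (case_nat t s) \<chi>" for t
        unfolding subst_fm_ssubst ssubst_fm_comp
        by (rule ssubst_fm_cong)
           (simp add: up_subst_def lift_trm_0 ssubst_trm_comp split: nat.split)
      then show ?thesis by simp
    qed
    also have "\<dots> \<longleftrightarrow> ssubst_fm s (All \<chi>) \<in> HS" by (simp add: henkin_All)
    finally show ?case .
  qed (simp_all add: tr h_eq henkin_Imp)
  have "eval_fm M e \<chi>" if "\<chi> \<in> Ax" for e \<chi>
  proof -
    have "ssubst_fm (\<lambda>i. r (e i)) \<chi> \<in> HS"
      using that sent henkin_prv[OF prv.ax] by (simp add: ssubst_sentence)
    then show ?thesis using truth[of "\<lambda>i. r (e i)" \<chi>] by simp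
  qed
  moreover have "eval_fm M (\<lambda>i. h (Var i)) \<phi>"
    using truth[of Var \<phi>] henkin_start by simp
  ultimately show ?thesis unfolding models_def by blast
qed

end

theorem completeness:
  assumes sent: "\<forall>\<chi>\<in>Ax. sentence \<chi>"
    and inf: "\<And>m n. m \<noteq> n \<Longrightarrow> prv Ax (Neg (Eq (num m) (num n)))"
    and valid: "\<And>(M :: nat struct) e. models M Ax \<Longrightarrow> eval_fm M e \<phi>"
  shows "prv Ax \<phi>"
proof (rule ccontr)
  assume "\<not> prv Ax \<phi>"
  then have "\<not> dv Ax {Neg \<phi>} Bot" using dv_contra dv_empty by blast
  then obtain M :: "nat struct" and e where "models M Ax" "eval_fm M e (Neg \<phi>)"
    using henkin_term_model[OF sent _ inf] by blast
  then show False using valid by simp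
qed

section \<open>Models of PA\<close>

definition std :: "nat struct" where
  "std = Struct 0 Suc (+) (*) (<)"

lemma std_simps [simp]:
  "zer std = 0" "suc std = Suc" "plus std = (+)" "times std = (*)" "less std = (<)"
  by (simp_all add: std_def)

text \<open>Induction enters \<open>PA\<close> only through universal closures; quantifying over all
  valuations absorbs their prefix.\<close>

lemma eval_all_power:
  fixes M :: "'a struct"
  shows "(\<forall>e. eval_fm M e ((All ^^ n) \<chi>)) \<longleftrightarrow> (\<forall>e. eval_fm M e \<chi>)"
proof (induction n)
  case (Suc n)
  have "(\<forall>e x. eval_fm M (case_nat x e) ((All ^^ n) \<chi>)) \<longleftrightarrow> (\<forall>e. eval_fm M e ((All ^^ n) \<chi>))"
    (is "?L \<longleftrightarrow> ?R")
  proof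
    assume ?L
    show ?R
    proof
      fix e :: "nat \<Rightarrow> 'a"
      have "e = case_nat (e 0) (\<lambda>i. e (Suc i))" by (rule ext, simp split: nat.split)
      then show "eval_fm M e ((All ^^ n) \<chi>)" using \<open>?L\<close> by metis
    qed
  qed blast
  then show ?case using Suc by simp
qed simp

lemma eval_fm_lift_1:
  "eval_fm M (case_nat y (case_nat x e)) (lift_fm (Suc 0) \<phi>) = eval_fm M (case_nat y e) \<phi>"
  unfolding lift_fm_ssubst eval_fm_ssubst
  by (rule arg_cong[of _ _ "\<lambda>e. eval_fm M e \<phi>"], rule ext) (auto split: nat.split)

lemma eval_ind_fm:
  "eval_fm M e (ind_fm \<phi>) \<longleftrightarrow> (eval_fm M (case_nat (zer M) e) \<phi> \<longrightarrow>
     (\<forall>x. eval_fm M (case_nat x e) \<phi> \<longrightarrow> eval_fm M (case_nat (suc M x) e) \<phi>) \<longrightarrow>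
     (\<forall>x. eval_fm M (case_nat x e) \<phi>))"
  by (simp add: ind_fm_def eval_fm_lift_1 eval_fm_subst_0)

lemma models_std_PA: "models std PA"
proof -
  have "eval_fm std e (ind_fm \<phi>)" for e \<phi>
    unfolding eval_ind_fm
  proof (intro impI allI)
    fix x
    assume 0: "eval_fm std (case_nat (zer std) e) \<phi>"
      and S: "\<forall>x. eval_fm std (case_nat x e) \<phi> \<longrightarrow> eval_fm std (case_nat (suc std x) e) \<phi>"
    show "eval_fm std (case_nat x e) \<phi>"
      by (induction x) (use 0 S in auto)
  qed
  then have ind: "eval_fm std e ((All ^^ n) (ind_fm \<phi>))" for e n \<phi>
    using eval_all_power by blast
  have "\<exists>z. Suc (z + x) = y" if "x < y" for x y :: nat
    using less_imp_Suc_add[OF that] by (metis add.commute)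
  then show ?thesis
    unfolding models_def PA_def by (auto simp: ind)
qed

lemma sentence_PA: "\<chi> \<in> PA \<Longrightarrow> sentence \<chi>"
  unfolding PA_def by (auto simp: sentence_def Iff_def Conj_def Neg_def Ex_def)

lemma closing_power: "\<exists>n. sentence ((All ^^ n) \<chi>)"
proof -
  have *: "\<forall>i\<in>fv \<chi>. i < n + k \<Longrightarrow> \<forall>i\<in>fv ((All ^^ n) \<chi>). i < k" for n k
  proof (induction n arbitrary: k)
    case (Suc n)
    then have "\<forall>i\<in>fv ((All ^^ n) \<chi>). i < Suc k" by simp
    then show ?case by force
  qed simp
  obtain n where "\<forall>i\<in>fv \<chi>. i < n"
    using finite_fv finite_nat_set_iff_bounded by blast
  then have "\<forall>i\<in>fv ((All ^^ n) \<chi>). i < 0" by (intro *) simp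
  then show ?thesis unfolding sentence_def by blast
qed

lemma prv_eq_sym: "prv Ax (Imp (Eq s t) (Eq t s))"
proof -
  have "dv Ax {Eq s t} (Eq t s)"
    using dv_prv[OF prv.ax_leibniz[of Ax s t "Eq (Var 0) (lift_trm 0 s)"], of "{Eq s t}"]
      dv_mp[of Ax "{Eq s t}"] dv_hyp[of _ "{Eq s t}"] dv_prv[OF prv.ax_refl[of Ax s], of "{Eq s t}"]
    by (simp add: subst_trm_ssubst lift_trm_0 ssubst_trm_comp) blast
  then show ?thesis using dv_deduction dv_empty by blast
qed

lemma prv_Sc_nonzero: "prv PA (Neg (Eq (Sc t) Zero))"
proof -
  have "prv PA (All (Neg (Eq (Sc (Var 0)) Zero)))" by (rule prv.ax) (simp add: PA_def)
  from prv.mp[OF prv.ax_inst this, of t] show ?thesis by (simp add: Neg_def)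
qed

lemma prv_Sc_inj: "prv PA (Imp (Eq (Sc s) (Sc t)) (Eq s t))"
proof -
  have "prv PA (All (All (Imp (Eq (Sc (Var 1)) (Sc (Var 0))) (Eq (Var 1) (Var 0)))))"
    by (rule prv.ax) (simp add: PA_def)
  from prv.mp[OF prv.ax_inst this, of s]
  have "prv PA (All (Imp (Eq (Sc (lift_trm 0 s)) (Sc (Var 0))) (Eq (lift_trm 0 s) (Var 0))))" by simp
  from prv.mp[OF prv.ax_inst this, of t] show ?thesis
    by (simp add: subst_trm_ssubst lift_trm_0 ssubst_trm_comp)
qed

lemma prv_imp_trans: "prv Ax (Imp \<phi> \<psi>) \<Longrightarrow> prv Ax (Imp \<psi> \<chi>) \<Longrightarrow> prv Ax (Imp \<phi> \<chi>)"
  by (meson prv.ax_K prv.ax_S prv.mp)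

text \<open>Derived syntactically because completeness relies on it to make the term models
  infinite.\<close>

lemma prv_num_neq: "m \<noteq> n \<Longrightarrow> prv PA (Neg (Eq (num m) (num n)))"
proof (induction m arbitrary: n)
  case 0
  then obtain k where "n = Suc k" by (cases n) auto
  then show ?case
    using prv_imp_trans[OF prv_eq_sym prv_Sc_nonzero[of "num k", unfolded Neg_def]] by (simp add: Neg_def)
next
  case (Suc m)
  show ?case
  proof (cases n)
    case 0
    then show ?thesis by (simp add: prv_Sc_nonzero)
  next
    case (Suc k)
    then show ?thesis
      using prv_imp_trans[OF prv_Sc_inj Suc.IH[of k, unfolded Neg_def]] Suc.prems by (simp add: Neg_def)
  qed
qed

theorem completeness_PA_ext:
  assumes "\<forall>\<chi>\<in>T. sentence \<chi>" "\<forall>\<chi>. prv PA \<chi> \<longrightarrow> prv T \<chi>"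
  shows "prv T \<phi> \<longleftrightarrow> (\<forall>(M :: nat struct) e. models M T \<longrightarrow> eval_fm M e \<phi>)"
  using completeness[of T \<phi>] assms soundness prv_num_neq by blast

lemma completeness_PA:
  "prv PA \<phi> \<longleftrightarrow> (\<forall>(M :: nat struct) e. models M PA \<longrightarrow> eval_fm M e \<phi>)"
  by (rule completeness_PA_ext) (auto simp: sentence_PA)

definition numeral_in :: "'a struct \<Rightarrow> nat \<Rightarrow> 'a" where
  "numeral_in M n = (suc M ^^ n) (zer M)"

lemma numeral_in_simps [simp]:
  "numeral_in M 0 = zer M" "numeral_in M (Suc n) = suc M (numeral_in M n)"
  by (simp_all add: numeral_in_def)

lemma eval_num [simp]: "eval_trm M e (num n) = numeral_in M n"
  by (induction n) auto

lemma numeral_in_std [simp]: "numeral_in std n = n"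
  by (induction n) auto

section \<open>Standard and nonstandard elements of a model of PA\<close>

locale pa_model =
  fixes M :: "'a struct"
  assumes models_PA: "models M PA"
begin

lemma PA_axioms: "\<chi> \<in> PA \<Longrightarrow> eval_fm M e \<chi>"
  using models_PA by (simp add: models_def)

lemma suc_nonzero: "suc M x \<noteq> zer M"
  using PA_axioms[of "All (Neg (Eq (Sc (Var 0)) Zero))" "\<lambda>_. x"] by (simp add: PA_def)

lemma suc_inj: "suc M x = suc M y \<Longrightarrow> x = y"
  using PA_axioms[of "All (All (Imp (Eq (Sc (Var 1)) (Sc (Var 0))) (Eq (Var 1) (Var 0))))" "\<lambda>_. x"]
  by (simp add: PA_def)

lemma plus_zer: "plus M x (zer M) = x"
  using PA_axioms[of "All (Eq (Plus (Var 0) Zero) (Var 0))" "\<lambda>_. x"] by (simp add: PA_def)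

lemma plus_suc: "plus M x (suc M y) = suc M (plus M x y)"
  using PA_axioms[of "All (All (Eq (Plus (Var 1) (Sc (Var 0))) (Sc (Plus (Var 1) (Var 0)))))" "\<lambda>_. x"]
  by (simp add: PA_def)

lemma times_zer: "times M x (zer M) = zer M"
  using PA_axioms[of "All (Eq (Times (Var 0) Zero) Zero)" "\<lambda>_. x"] by (simp add: PA_def)

lemma times_suc: "times M x (suc M y) = plus M (times M x y) x"
  using PA_axioms[of "All (All (Eq (Times (Var 1) (Sc (Var 0))) (Plus (Times (Var 1) (Var 0)) (Var 1))))" "\<lambda>_. x"]
  by (simp add: PA_def)

lemma less_iff: "less M x y \<longleftrightarrow> (\<exists>z. plus M (suc M z) x = y)"
  using PA_axioms[of "All (All (Iff (Lt (Var 1) (Var 0)) (Ex (Eq (Plus (Sc (Var 0)) (Var 2)) (Var 1)))))" "\<lambda>_. x"]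
  by (simp add: PA_def numeral_2_eq_2)

lemma induction_fm:
  assumes "eval_fm M (case_nat (zer M) e) \<phi>"
    and "\<And>x. eval_fm M (case_nat x e) \<phi> \<Longrightarrow> eval_fm M (case_nat (suc M x) e) \<phi>"
  shows "eval_fm M (case_nat x e) \<phi>"
proof -
  obtain n where "sentence ((All ^^ n) (ind_fm \<phi>))" using closing_power by blast
  then have "(All ^^ n) (ind_fm \<phi>) \<in> PA" by (auto simp: PA_def)
  then have "\<forall>e. eval_fm M e ((All ^^ n) (ind_fm \<phi>))" using PA_axioms by blast
  then have "eval_fm M e (ind_fm \<phi>)" by (simp add: eval_all_power)
  then show ?thesis
    unfolding eval_ind_fm using assms by simp
qed

lemma zer_or_suc: "x = zer M \<or> (\<exists>y. x = suc M y)"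
proof -
  let ?\<phi> = "Imp (Neg (Eq (Var 0) Zero)) (Ex (Eq (Var 1) (Sc (Var 0))))"
  have "eval_fm M (case_nat x (\<lambda>_. x)) ?\<phi>" by (rule induction_fm) auto
  then show ?thesis by auto
qed

abbreviation "nm \<equiv> numeral_in M"

lemma plus_nm: "plus M (nm m) (nm n) = nm (m + n)"
  by (induction n) (auto simp: plus_zer plus_suc)

lemma times_nm: "times M (nm m) (nm n) = nm (m * n)"
  by (induction n) (auto simp: times_zer times_suc plus_nm add.commute)

lemma nm_inj: "nm m = nm n \<longleftrightarrow> m = n"
proof (induction m arbitrary: n)
  case 0
  then show ?case using suc_nonzero by (cases n) (auto, metis)
next
  case (Suc m)
  then show ?case using suc_nonzero suc_inj by (cases n) auto
qed

lemma less_nm_imp: "less M x (nm n) \<Longrightarrow> \<exists>k<n. x = nm k"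
proof (induction n arbitrary: x)
  case 0
  then show ?case using zer_or_suc[of x] suc_nonzero by (auto simp: less_iff plus_zer plus_suc)
next
  case (Suc n)
  then obtain z where z: "plus M (suc M z) x = suc M (nm n)" by (auto simp: less_iff)
  show ?case
  proof (cases "x = zer M")
    case True
    then show ?thesis by (intro exI[of _ 0]) simp
  next
    case False
    then obtain y where y: "x = suc M y" using zer_or_suc by blast
    then have "plus M (suc M z) y = nm n" using z suc_inj by (simp add: plus_suc)
    then obtain k where "k < n" "y = nm k" using Suc.IH by (auto simp: less_iff)
    then show ?thesis using y by (intro exI[of _ "Suc k"]) simp
  qed
qed

lemma less_nm_nm: "less M (nm m) (nm n) \<longleftrightarrow> m < n"
proof
  assume "less M (nm m) (nm n)"
  from less_nm_imp[OF this] show "m < n" by (auto simp: nm_inj)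
next
  assume "m < n"
  then obtain k where "n = Suc (m + k)" using less_imp_Suc_add by blast
  then have "plus M (suc M (nm k)) (nm m) = nm n"
    using plus_nm[of "Suc k" m] by (simp add: add.commute)
  then show "less M (nm m) (nm n)" by (auto simp: less_iff)
qed

text \<open>A nonstandard element is nonzero and therefore the successor of another nonstandard one.
  Through this lemma standard witnesses and standard set codes become available below nonstandard
  bounds.\<close>

lemma nonstandard_greater: "x \<notin> range nm \<Longrightarrow> less M (nm n) x"
proof (induction n arbitrary: x)
  case 0
  then have "x \<noteq> zer M" by (metis numeral_in_simps(1) rangeI)
  then show ?case using zer_or_suc[of x] by (auto simp: less_iff plus_zer)
next
  case (Suc n)
  then have "x \<noteq> zer M" by (metis numeral_in_simps(1) rangeI)
  then obtain y where y: "x = suc M y" using zer_or_suc by blast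
  then have "y \<notin> range nm" using Suc.prems by (metis numeral_in_simps(2) rangeE rangeI)
  then show ?case using Suc.IH y by (auto simp: less_iff plus_suc)
qed

lemma eval_trm_nm: "eval_trm M (\<lambda>i. nm (e i)) t = nm (eval_trm std e t)"
  by (induction t) (auto simp: plus_nm times_nm)

lemma ball_less_nm: "(\<forall>x. less M x (nm n) \<longrightarrow> Q x) \<longleftrightarrow> (\<forall>k<n. Q (nm k))"
proof
  assume "\<forall>x. less M x (nm n) \<longrightarrow> Q x"
  then show "\<forall>k<n. Q (nm k)" by (simp add: less_nm_nm)
next
  assume Q: "\<forall>k<n. Q (nm k)"
  show "\<forall>x. less M x (nm n) \<longrightarrow> Q x"
  proof (intro allI impI)
    fix x assume "less M x (nm n)"
    from less_nm_imp[OF this] show "Q x" using Q by auto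
  qed
qed

text \<open>Everything below a numeral is a numeral, so bounded quantifiers range over the same
  numbers in both structures.\<close>

lemma Delta0_absolute:
  assumes "Delta0 \<phi>" shows "eval_fm M (\<lambda>i. nm (e i)) \<phi> \<longleftrightarrow> eval_fm std e \<phi>"
  using assms
proof (induction arbitrary: e)
  case (5 \<phi> t)
  have "case_nat (nm k) (\<lambda>i. nm (e i)) = (\<lambda>i. nm (case_nat k e i))" for k
    by (rule ext, simp split: nat.split)
  then have *: "eval_fm M (case_nat (nm k) (\<lambda>i. nm (e i))) \<phi> = eval_fm std (case_nat k e) \<phi>" for k
    using "5.IH" by simp
  show ?case
    using * by (simp add: eval_trm_nm ball_less_nm)
qed (auto simp: eval_trm_nm nm_inj less_nm_nm)

lemma Sigma1_upward:
  assumes "Sigma1 \<phi>" "eval_fm std e \<phi>" shows "eval_fm M (\<lambda>i. nm (e i)) \<phi>"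
  using assms
proof (induction arbitrary: e)
  case (1 \<phi>)
  then show ?case by (simp add: Delta0_absolute)
next
  case (2 \<phi>)
  then obtain x where "eval_fm std (case_nat x e) \<phi>" by auto
  then have "eval_fm M (\<lambda>i. nm (case_nat x e i)) \<phi>" by (rule "2.IH")
  moreover have "(\<lambda>i. nm (case_nat x e i)) = case_nat (nm x) (\<lambda>i. nm (e i))"
    by (rule ext, simp split: nat.split)
  ultimately show ?case by auto
qed

end

text \<open>A true instance persists from the standard model to every model of PA, and completeness
  turns this into provability. The converse is soundness in the standard model.\<close>

lemma Sigma1_complete:
  assumes "Sigma1 \<phi>" "sentence \<phi>"
  shows "prv PA \<phi> \<longleftrightarrow> eval_fm std e \<phi>"
proof
  assume "prv PA \<phi>"
  then show "eval_fm std e \<phi>" using soundness models_std_PA by blast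
next
  assume e: "eval_fm std e \<phi>"
  show "prv PA \<phi>"
    unfolding completeness_PA
  proof (intro allI impI)
    fix M :: "nat struct" and e'
    assume "models M PA"
    then interpret pa_model M by unfold_locales
    show "eval_fm M e' \<phi>"
      using Sigma1_upward[OF assms(1) e] eval_fm_cong[of \<phi> e' "\<lambda>i. nm (e i)" M] assms(2) by (simp add: sentence_def)
  qed
qed

lemma Delta0_ssubst:
  assumes "Delta0 \<phi>" shows "Delta0 (ssubst_fm s \<phi>)"
  using assms
proof (induction arbitrary: s)
  case (5 \<phi> t)
  then show ?case by (auto simp: ssubst_trm_up_lift intro: Delta0.intros)
qed (auto intro: Delta0.intros)

lemma Sigma1_ssubst:
  assumes "Sigma1 \<phi>" shows "Sigma1 (ssubst_fm s \<phi>)"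
  using assms by (induction arbitrary: s) (auto intro: Sigma1.intros Delta0_ssubst)

lemma fv_lift_trm: "fv_trm (lift_trm 0 t) = Suc ` fv_trm t"
  by (induction t) auto

lemma fv_ssubst_trm: "fv_trm (ssubst_trm s t) = (\<Union>i\<in>fv_trm t. fv_trm (s i))"
  by (induction t) auto

lemma fv_ssubst_fm: "fv (ssubst_fm s \<phi>) \<subseteq> (\<Union>i\<in>fv \<phi>. fv_trm (s i))"
proof (induction \<phi> arbitrary: s)
  case (All \<phi>)
  show ?case
  proof
    fix j assume "j \<in> fv (ssubst_fm s (All \<phi>))"
    then have "Suc j \<in> fv (ssubst_fm (up_subst s) \<phi>)"
      by (auto simp: image_iff) (metis Suc_pred gr0I One_nat_def)
    then obtain i where i: "i \<in> fv \<phi>" "Suc j \<in> fv_trm (up_subst s i)" using All by blast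
    then obtain k where "i = Suc k" by (cases i) auto
    then show "j \<in> (\<Union>i\<in>fv (All \<phi>). fv_trm (s i))"
      using i by (force simp: fv_lift_trm)
  qed
next
  case (Imp \<phi> \<psi>)
  then show ?case by fastforce
qed (auto simp: fv_ssubst_trm)

section \<open>Definability in the standard model\<close>

abbreviation pair :: "nat \<Rightarrow> nat \<Rightarrow> nat" where "pair x y \<equiv> prod_encode (x, y)"

definition p1 :: "nat \<Rightarrow> nat" where "p1 n = fst (prod_decode n)"
definition p2 :: "nat \<Rightarrow> nat" where "p2 n = snd (prod_decode n)"

lemma p_pair [simp]: "p1 (pair x y) = x" "p2 (pair x y) = y"
  by (simp_all add: p1_def p2_def)

lemma pair_p [simp]: "pair (p1 n) (p2 n) = n"
  by (simp add: p1_def p2_def)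

lemma pair_eq_iff: "n = pair x y \<longleftrightarrow> x = p1 n \<and> y = p2 n"
  by (metis p_pair pair_p)

lemma p_le: "p1 n \<le> n" "p2 n \<le> n"
  by (metis le_prod_encode_1 pair_p) (metis le_prod_encode_2 pair_p)

text \<open>Doubling clears the triangular number in Cantor's pairing function and leaves a
  polynomial identity, so the graph of pairing is an atomic formula.\<close>

lemma pair_poly: "n = pair x y \<longleftrightarrow> n + n = (x + y) * Suc (x + y) + (x + x)"
proof -
  have "2 * triangle k = k * Suc k" for k by (simp add: triangle_def)
  from this[of "x + y"] show ?thesis unfolding prod_encode_def by auto
qed

definition tm :: "((nat \<Rightarrow> nat) \<Rightarrow> nat) \<Rightarrow> bool" where
  "tm f \<longleftrightarrow> (\<exists>t. \<forall>e. eval_trm std e t = f e)"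

definition d0 :: "((nat \<Rightarrow> nat) \<Rightarrow> bool) \<Rightarrow> bool" where
  "d0 R \<longleftrightarrow> (\<exists>\<phi>. Delta0 \<phi> \<and> (\<forall>e. eval_fm std e \<phi> \<longleftrightarrow> R e))"

lemma tm_var: "tm (\<lambda>e. e k)"
  unfolding tm_def by (rule exI[of _ "Var k"]) simp

lemma tm_const: "tm (\<lambda>e. n)"
  unfolding tm_def by (rule exI[of _ "num n"]) simp

lemma tm_Suc: "tm f \<Longrightarrow> tm (\<lambda>e. Suc (f e))"
  unfolding tm_def by (metis eval_trm.simps(3) std_simps(2))

lemma tm_plus: "tm f \<Longrightarrow> tm g \<Longrightarrow> tm (\<lambda>e. f e + g e)"
  unfolding tm_def by (metis eval_trm.simps(4) std_simps(3))

lemma tm_times: "tm f \<Longrightarrow> tm g \<Longrightarrow> tm (\<lambda>e. f e * g e)"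
  unfolding tm_def by (metis eval_trm.simps(5) std_simps(4))

lemma tm_subst: "tm f \<Longrightarrow> (\<And>i. tm (s i)) \<Longrightarrow> tm (\<lambda>e. f (\<lambda>i. s i e))"
proof -
  assume "tm f" "\<And>i. tm (s i)"
  then obtain t u where "\<And>e. eval_trm std e t = f e" "\<And>i e. eval_trm std e (u i) = s i e"
    unfolding tm_def by metis
  then have "eval_trm std e (ssubst_trm u t) = f (\<lambda>i. s i e)" for e
    by (simp add: eval_trm_ssubst)
  then show ?thesis unfolding tm_def by blast
qed

lemma d0_subst: "d0 R \<Longrightarrow> (\<And>i. tm (s i)) \<Longrightarrow> d0 (\<lambda>e. R (\<lambda>i. s i e))"
proof -
  assume "d0 R" "\<And>i. tm (s i)"
  then obtain \<phi> u where "Delta0 \<phi>" "\<And>e. eval_fm std e \<phi> = R e" "\<And>i e. eval_trm std e (u i) = s i e"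
    unfolding d0_def tm_def by metis
  then have "Delta0 (ssubst_fm u \<phi>)" "eval_fm std e (ssubst_fm u \<phi>) = R (\<lambda>i. s i e)" for e
    by (simp_all add: eval_fm_ssubst Delta0_ssubst)
  then show ?thesis unfolding d0_def by blast
qed

lemma d0_rename: "d0 R \<Longrightarrow> d0 (\<lambda>e. R (\<lambda>i. e (r i)))"
  by (rule d0_subst[of R "\<lambda>i e. e (r i)"]) (simp_all add: tm_var)

lemma d0_False: "d0 (\<lambda>e. False)"
  unfolding d0_def by (rule exI[of _ Bot]) (auto intro: Delta0.intros)

lemma d0_imp: "d0 P \<Longrightarrow> d0 Q \<Longrightarrow> d0 (\<lambda>e. P e \<longrightarrow> Q e)"
  unfolding d0_def by (metis Delta0.intros(4) eval_fm.simps(4))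

lemma d0_not: "d0 P \<Longrightarrow> d0 (\<lambda>e. \<not> P e)"
  using d0_imp[OF _ d0_False] by simp

lemma d0_conj: "d0 P \<Longrightarrow> d0 Q \<Longrightarrow> d0 (\<lambda>e. P e \<and> Q e)"
  using d0_not[OF d0_imp[OF _ d0_not[of Q]], of P] by simp

lemma d0_disj: "d0 P \<Longrightarrow> d0 Q \<Longrightarrow> d0 (\<lambda>e. P e \<or> Q e)"
  using d0_imp[OF d0_not[of P], of Q] by (simp add: disj_imp)

lemma d0_eq_tm: "tm f \<Longrightarrow> tm g \<Longrightarrow> d0 (\<lambda>e. f e = g e)"
  unfolding d0_def tm_def by (metis Delta0.intros(2) eval_fm.simps(2))

lemma d0_less_tm: "tm f \<Longrightarrow> tm g \<Longrightarrow> d0 (\<lambda>e. f e < g e)"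
  unfolding d0_def tm_def by (metis Delta0.intros(3) eval_fm.simps(3) std_simps(5))

lemma d0_ball_tm:
  assumes "tm f" "d0 (\<lambda>e. R (e 0) (\<lambda>i. e (Suc i)))"
  shows "d0 (\<lambda>e. \<forall>x<f e. R x e)"
proof -
  obtain t \<phi> where "\<And>e. eval_trm std e t = f e" "Delta0 \<phi>"
      "\<And>e. eval_fm std e \<phi> = R (e 0) (\<lambda>i. e (Suc i))"
    using assms unfolding tm_def d0_def by metis
  then have "eval_fm std e (All (Imp (Lt (Var 0) (lift_trm 0 t)) \<phi>)) = (\<forall>x<f e. R x e)"
    "Delta0 (All (Imp (Lt (Var 0) (lift_trm 0 t)) \<phi>))" for e
    by (auto intro: Delta0.intros)
  then show ?thesis unfolding d0_def by blast
qed

lemma d0_bex_tm: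
  assumes "tm f" "d0 (\<lambda>e. R (e 0) (\<lambda>i. e (Suc i)))"
  shows "d0 (\<lambda>e. \<exists>x<f e. R x e)"
  using d0_not[OF d0_ball_tm[OF assms(1) d0_not[OF assms(2)]]] by simp

text \<open>The bound by a term makes it possible to use \<open>f\<close> inside a bounded formula:
  naming the value of \<open>f\<close> then costs only a bounded quantifier
  (\<open>d0_let\<close>).\<close>

definition d0f :: "((nat \<Rightarrow> nat) \<Rightarrow> nat) \<Rightarrow> bool" where
  "d0f f \<longleftrightarrow> (\<exists>b. tm b \<and> (\<forall>e. f e \<le> b e)) \<and> d0 (\<lambda>e. e 0 = f (\<lambda>i. e (Suc i)))"

lemma d0f_bound: "d0f f \<Longrightarrow> \<exists>b. tm b \<and> (\<forall>e. f e \<le> b e)"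
  unfolding d0f_def by (rule conjunct1)

lemma d0f_graph: "d0f f \<Longrightarrow> d0 (\<lambda>e. e 0 = f (\<lambda>i. e (Suc i)))"
  unfolding d0f_def by (rule conjunct2)

lemma d0fI: "tm b \<Longrightarrow> (\<And>e. f e \<le> b e) \<Longrightarrow> d0 (\<lambda>e. e 0 = f (\<lambda>i. e (Suc i))) \<Longrightarrow> d0f f"
  unfolding d0f_def by (intro conjI exI[of _ b]) simp_all

lemma d0f_tm: "tm f \<Longrightarrow> d0f f"
  by (rule d0fI[of f]) (simp_all add: d0_eq_tm tm_var tm_subst[of f "\<lambda>i e. e (Suc i)"])

lemma d0_let:
  assumes "d0f f" "d0 (\<lambda>e. R (e 0) (\<lambda>i. e (Suc i)))"
  shows "d0 (\<lambda>e. R (f e) e)"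
proof -
  from d0f_bound[OF assms(1)] obtain b where b: "tm b" "\<And>e. f e \<le> b e" by auto
  have "d0 (\<lambda>e. \<exists>y<Suc (b e). y = f e \<and> R y e)"
    by (rule d0_bex_tm[OF tm_Suc[OF b(1)]]) (rule d0_conj[OF d0f_graph[OF assms(1)] assms(2)])
  moreover have "(\<lambda>e. \<exists>y<Suc (b e). y = f e \<and> R y e) = (\<lambda>e. R (f e) e)"
    using b(2) by (auto simp: le_imp_less_Suc)
  ultimately show ?thesis by simp
qed

lemma d0f_shift: "d0f f \<Longrightarrow> d0f (\<lambda>e. f (\<lambda>i. e (Suc i)))"
proof -
  assume f: "d0f f"
  from d0f_bound[OF f] obtain b where b: "tm b" "\<And>e. f e \<le> b e" by auto
  have "tm (\<lambda>e. b (\<lambda>i. e (Suc i)))" by (rule tm_subst[of b "\<lambda>i e. e (Suc i)"]) (rule b(1), rule tm_var)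
  moreover have "d0 (\<lambda>e. e 0 = f (\<lambda>i. e (Suc (Suc i))))"
    using d0_rename[OF d0f_graph[OF f], of "\<lambda>i. if i = 0 then 0 else Suc i"] by simp
  ultimately show ?thesis using b(2) by (intro d0fI[of "\<lambda>e. b (\<lambda>i. e (Suc i))"])
qed

lemma d0f_op2:
  assumes "d0f f" "d0f g"
    and op: "d0 (\<lambda>e. e 0 = h (e 1) (e 2))"
    and bound: "\<And>a b. tm a \<Longrightarrow> tm b \<Longrightarrow> \<exists>c. tm c \<and> (\<forall>e x y. x \<le> a e \<longrightarrow> y \<le> b e \<longrightarrow> h x y \<le> c e)"
  shows "d0f (\<lambda>e. h (f e) (g e))"
proof -
  from d0f_bound[OF assms(1)] obtain a where a: "tm a" "\<And>e. f e \<le> a e" by auto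
  from d0f_bound[OF assms(2)] obtain b where b: "tm b" "\<And>e. g e \<le> b e" by auto
  obtain c where c: "tm c" "\<And>e x y. x \<le> a e \<Longrightarrow> y \<le> b e \<Longrightarrow> h x y \<le> c e"
    using bound[OF a(1) b(1)] by auto
  have "d0 (\<lambda>e. e 0 = h (f (\<lambda>i. e (Suc i))) (g (\<lambda>i. e (Suc i))))"
  proof (rule d0_let[of "\<lambda>e. f (\<lambda>i. e (Suc i))" "\<lambda>y e. e 0 = h y (g (\<lambda>i. e (Suc i)))"])
    show "d0f (\<lambda>e. f (\<lambda>i. e (Suc i)))" by (intro d0f_shift assms)
    show "d0 (\<lambda>e. e (Suc 0) = h (e 0) (g (\<lambda>i. e (Suc (Suc i)))))"
    proof (rule d0_let[of "\<lambda>e. g (\<lambda>i. e (Suc (Suc i)))" "\<lambda>y e. e (Suc 0) = h (e 0) y"])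
      show "d0f (\<lambda>e. g (\<lambda>i. e (Suc (Suc i))))"
        using d0f_shift[OF d0f_shift[OF assms(2)]] by simp
      show "d0 (\<lambda>e. e (Suc (Suc 0)) = h (e (Suc 0)) (e 0))"
        using d0_rename[OF op, of "\<lambda>i. if i = 0 then 2 else if i = 1 then 1 else 0"]
        by (simp add: numeral_2_eq_2)
    qed
  qed
  then show ?thesis by (rule d0fI[OF c(1) c(2)[OF a(2) b(2)]])
qed

lemma d0f_op1:
  assumes "d0f f" and op: "d0 (\<lambda>e. e 0 = h (e 1))" and bound: "\<And>x. h x \<le> x"
  shows "d0f (\<lambda>e. h (f e))"
proof (rule d0f_op2[of f f "\<lambda>x y. h x"])
  show "d0 (\<lambda>e. e 0 = h (e 1))" by (rule op)
  show "\<exists>c. tm c \<and> (\<forall>e x y. x \<le> a e \<longrightarrow> y \<le> b e \<longrightarrow> h x \<le> c e)" if "tm a" "tm b" for a b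
    by (rule exI[of _ a]) (use that(1) order_trans[OF bound] in auto)
qed (rule assms)+

lemma d0_pair_tm: "tm f \<Longrightarrow> tm g \<Longrightarrow> tm h \<Longrightarrow> d0 (\<lambda>e. f e = pair (g e) (h e))"
  unfolding pair_poly by (intro d0_eq_tm tm_plus tm_times tm_Suc)

lemma d0f_pair: "d0f f \<Longrightarrow> d0f g \<Longrightarrow> d0f (\<lambda>e. pair (f e) (g e))"
proof (rule d0f_op2[of f g pair])
  show "d0 (\<lambda>e. e 0 = pair (e 1) (e 2))" by (intro d0_pair_tm tm_var)
  fix a b :: "(nat \<Rightarrow> nat) \<Rightarrow> nat"
  assume ab: "tm a" "tm b"
  have "pair x y \<le> (a e + b e) * Suc (a e + b e) + (a e + a e)" if "x \<le> a e" "y \<le> b e" for x y e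
  proof -
    have "pair x y \<le> (x + y) * Suc (x + y) + (x + x)"
      using pair_poly[of "pair x y" x y] by linarith
    also have "\<dots> \<le> (a e + b e) * Suc (a e + b e) + (a e + a e)"
      using that by (intro add_mono mult_le_mono) auto
    finally show ?thesis .
  qed
  then show "\<exists>c. tm c \<and> (\<forall>e x y. x \<le> a e \<longrightarrow> y \<le> b e \<longrightarrow> pair x y \<le> c e)"
    using ab by (intro exI[of _ "\<lambda>e. (a e + b e) * Suc (a e + b e) + (a e + a e)"])
      (auto intro!: tm_plus tm_times tm_Suc)
qed

lemma d0f_p1: "d0f f \<Longrightarrow> d0f (\<lambda>e. p1 (f e))"
proof (rule d0f_op1[of f p1])
  have "d0 (\<lambda>e. \<exists>b<Suc (e 1). e 1 = pair (e 0) b)"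
    by (intro d0_bex_tm d0_pair_tm tm_var tm_Suc)
  moreover have "(\<exists>b<Suc (e 1). e 1 = pair (e 0) b) \<longleftrightarrow> e 0 = p1 (e 1)" for e :: "nat \<Rightarrow> nat"
    by (auto simp: pair_eq_iff le_imp_less_Suc p_le)
  ultimately show "d0 (\<lambda>e. e 0 = p1 (e 1))" by (simp only:)
qed (auto simp: p_le)

lemma d0f_p2: "d0f f \<Longrightarrow> d0f (\<lambda>e. p2 (f e))"
proof (rule d0f_op1[of f p2])
  have "d0 (\<lambda>e. \<exists>b<Suc (e 1). e 1 = pair b (e 0))"
    by (intro d0_bex_tm d0_pair_tm tm_var tm_Suc)
  moreover have "(\<exists>b<Suc (e 1). e 1 = pair b (e 0)) \<longleftrightarrow> e 0 = p2 (e 1)" for e :: "nat \<Rightarrow> nat"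
    by (auto simp: pair_eq_iff le_imp_less_Suc p_le)
  ultimately show "d0 (\<lambda>e. e 0 = p2 (e 1))" by (simp only:)
qed (auto simp: p_le)

lemma d0f_var: "d0f (\<lambda>e. e k)" and d0f_const: "d0f (\<lambda>e. n)"
  by (auto intro: d0f_tm tm_var tm_const)

lemma d0f_plus: "d0f f \<Longrightarrow> d0f g \<Longrightarrow> d0f (\<lambda>e. f e + g e)"
proof (rule d0f_op2[of f g "(+)"])
  fix a b :: "(nat \<Rightarrow> nat) \<Rightarrow> nat"
  assume "tm a" "tm b"
  then show "\<exists>c. tm c \<and> (\<forall>e x y. x \<le> a e \<longrightarrow> y \<le> b e \<longrightarrow> x + y \<le> c e)"
    by (intro exI[of _ "\<lambda>e. a e + b e"]) (auto intro: tm_plus add_mono)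
qed (auto intro!: d0_eq_tm tm_var tm_plus)

lemma d0f_times: "d0f f \<Longrightarrow> d0f g \<Longrightarrow> d0f (\<lambda>e. f e * g e)"
proof (rule d0f_op2[of f g "(*)"])
  fix a b :: "(nat \<Rightarrow> nat) \<Rightarrow> nat"
  assume "tm a" "tm b"
  then show "\<exists>c. tm c \<and> (\<forall>e x y. x \<le> a e \<longrightarrow> y \<le> b e \<longrightarrow> x * y \<le> c e)"
    by (intro exI[of _ "\<lambda>e. a e * b e"]) (auto intro: tm_times mult_le_mono)
qed (auto intro!: d0_eq_tm tm_var tm_times)

lemma d0f_Suc: "d0f f \<Longrightarrow> d0f (\<lambda>e. Suc (f e))"
  using d0f_plus[OF _ d0f_const[of 1], of f] by simp

lemma d0_eq: "d0f f \<Longrightarrow> d0f g \<Longrightarrow> d0 (\<lambda>e. f e = g e)"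
proof (rule d0_let[of f "\<lambda>y e. y = g e"])
  assume "d0f g"
  then show "d0 (\<lambda>e. e 0 = g (\<lambda>i. e (Suc i)))" by (rule d0f_graph)
qed

lemma d0_less: "d0f f \<Longrightarrow> d0f g \<Longrightarrow> d0 (\<lambda>e. f e < g e)"
proof (rule d0_let[of f "\<lambda>y e. y < g e"])
  assume "d0f g"
  then have "d0f (\<lambda>e. g (\<lambda>i. e (Suc i)))" by (rule d0f_shift)
  then show "d0 (\<lambda>e. e 0 < g (\<lambda>i. e (Suc i)))"
    by (rule d0_let[of _ "\<lambda>y e. e 0 < y"]) (intro d0_less_tm tm_var)
qed

lemma d0_ball:
  assumes "d0f f" "d0 (\<lambda>e. R (e 0) (\<lambda>i. e (Suc i)))"
  shows "d0 (\<lambda>e. \<forall>x<f e. R x e)"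
proof (rule d0_let[of f "\<lambda>y e. \<forall>x<y. R x e"])
  show "d0 (\<lambda>e. \<forall>x<e 0. R x (\<lambda>i. e (Suc i)))"
    using d0_rename[OF assms(2), of "\<lambda>i. if i = 0 then 0 else Suc i"]
    by (intro d0_ball_tm tm_var) simp
qed (rule assms)

lemma d0_bex:
  assumes "d0f f" "d0 (\<lambda>e. R (e 0) (\<lambda>i. e (Suc i)))"
  shows "d0 (\<lambda>e. \<exists>x<f e. R x e)"
  using d0_not[OF d0_ball[OF assms(1) d0_not[OF assms(2)]]] by simp

lemma d0_rel2:
  assumes "d0 (\<lambda>e. D (e 0) (e 1))" "d0f f" "d0f g"
  shows "d0 (\<lambda>e. D (f e) (g e))"
proof (rule d0_let[of f "\<lambda>y e. D y (g e)"])
  show "d0 (\<lambda>e. D (e 0) (g (\<lambda>i. e (Suc i))))"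
  proof (rule d0_let[of "\<lambda>e. g (\<lambda>i. e (Suc i))" "\<lambda>y e. D (e 0) y"])
    show "d0 (\<lambda>e. D (e (Suc 0)) (e 0))"
      using d0_rename[OF assms(1), of "\<lambda>i. if i = 0 then 1 else 0"] by simp
  qed (intro d0f_shift assms)
qed (rule assms)

lemmas d0_intros = d0_eq d0_less d0_ball d0_bex d0_conj d0_disj d0_imp d0_not d0_False
  d0f_var d0f_const d0f_Suc d0f_plus d0f_times d0f_pair d0f_p1 d0f_p2

section \<open>Recursively enumerable predicates\<close>

text \<open>One unbounded quantifier before a bounded matrix. Conjunctions and further quantifiers
  are brought back to this form by a number above all witnesses involved.\<close>

definition re :: "(nat \<Rightarrow> bool) \<Rightarrow> bool" where
  "re P \<longleftrightarrow> (\<exists>D. d0 (\<lambda>e. D (e 0) (e 1)) \<and> (\<forall>x. P x \<longleftrightarrow> (\<exists>w. D w x)))"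

definition cf :: "(nat \<Rightarrow> nat) \<Rightarrow> bool" where
  "cf f \<longleftrightarrow> re (\<lambda>n. p2 n = f (p1 n))"

lemma reI: "d0 (\<lambda>e. D (e 0) (e 1)) \<Longrightarrow> (\<And>x. P x \<longleftrightarrow> (\<exists>w. D w x)) \<Longrightarrow> re P"
  unfolding re_def by blast

lemma re_d0:
  assumes "d0 (\<lambda>e. P (e 0))" shows "re P"
proof (rule reI[of "\<lambda>w x. P x"])
  show "d0 (\<lambda>e. P (e 1))"
    using d0_rename[OF assms, of "\<lambda>i. 1"] by simp
qed simp

lemma re_conj:
  assumes "re P" "re Q" shows "re (\<lambda>x. P x \<and> Q x)"
proof -
  obtain D where D: "d0 (\<lambda>e. D (e 0) (e 1))" "\<And>x. P x \<longleftrightarrow> (\<exists>w. D w x)"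
    using assms(1) unfolding re_def by (elim exE conjE) simp
  obtain E where E: "d0 (\<lambda>e. E (e 0) (e 1))" "\<And>x. Q x \<longleftrightarrow> (\<exists>w. E w x)"
    using assms(2) unfolding re_def by (elim exE conjE) simp
  show ?thesis
  proof (rule reI[of "\<lambda>w x. (\<exists>a<w. D a x) \<and> (\<exists>a<w. E a x)"])
    show "d0 (\<lambda>e. (\<exists>a<e 0. D a (e 1)) \<and> (\<exists>a<e 0. E a (e 1)))"
      by (intro d0_intros d0_rel2[OF D(1)] d0_rel2[OF E(1)])
    show "(P x \<and> Q x) \<longleftrightarrow> (\<exists>w. (\<exists>a<w. D a x) \<and> (\<exists>a<w. E a x))" for x
    proof
      assume "P x \<and> Q x"
      then obtain a b where "D a x" "E b x" by (auto simp: D(2) E(2))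
      then show "\<exists>w. (\<exists>a<w. D a x) \<and> (\<exists>a<w. E a x)"
        by - (rule exI[of _ "Suc (max a b)"], meson le_imp_less_Suc max.cobounded1 max.cobounded2)
    qed (auto simp: D(2) E(2))
  qed
qed

lemma re_disj:
  assumes "re P" "re Q" shows "re (\<lambda>x. P x \<or> Q x)"
proof -
  obtain D where D: "d0 (\<lambda>e. D (e 0) (e 1))" "\<And>x. P x \<longleftrightarrow> (\<exists>w. D w x)"
    using assms(1) unfolding re_def by (elim exE conjE) simp
  obtain E where E: "d0 (\<lambda>e. E (e 0) (e 1))" "\<And>x. Q x \<longleftrightarrow> (\<exists>w. E w x)"
    using assms(2) unfolding re_def by (elim exE conjE) simp
  show ?thesis
    by (rule reI[OF d0_disj[OF D(1) E(1)]]) (auto simp: D(2) E(2))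
qed

lemma re_ex:
  assumes "re (\<lambda>n. Q (p1 n) (p2 n))" shows "re (\<lambda>x. \<exists>y. Q x y)"
proof -
  obtain D where D: "d0 (\<lambda>e. D (e 0) (e 1))" "\<And>n. Q (p1 n) (p2 n) \<longleftrightarrow> (\<exists>w. D w n)"
    using assms unfolding re_def by (elim exE conjE) simp
  have Q: "Q x y \<longleftrightarrow> (\<exists>w. D w (pair x y))" for x y using D(2)[of "pair x y"] by simp
  show ?thesis
  proof (rule reI[of "\<lambda>w x. \<exists>a<w. \<exists>y<w. D a (pair x y)"])
    show "d0 (\<lambda>e. \<exists>a<e 0. \<exists>y<e 0. D a (pair (e 1) y))"
      by (intro d0_intros d0_rel2[OF D(1)])
    show "(\<exists>y. Q x y) \<longleftrightarrow> (\<exists>w. \<exists>a<w. \<exists>y<w. D a (pair x y))" for x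
    proof
      assume "\<exists>y. Q x y"
      then obtain a y where "D a (pair x y)" by (auto simp: Q)
      then show "\<exists>w. \<exists>a<w. \<exists>y<w. D a (pair x y)"
        by - (rule exI[of _ "Suc (max a y)"], meson le_imp_less_Suc max.cobounded1 max.cobounded2)
    qed (auto simp: Q)
  qed
qed

lemma re_comp_d0:
  assumes "re P" "d0f (\<lambda>e. f (e 0))" shows "re (\<lambda>x. P (f x))"
proof -
  obtain D where D: "d0 (\<lambda>e. D (e 0) (e 1))" "\<And>n. P n \<longleftrightarrow> (\<exists>w. D w n)"
    using assms(1) unfolding re_def by (elim exE conjE) simp
  have "d0f (\<lambda>e. f (e (Suc 0)))" using d0f_shift[OF assms(2)] by simp
  then show ?thesis
    by (intro reI[of "\<lambda>w x. D w (f x)"]) (auto intro!: d0_rel2[OF D(1)] d0f_var simp: D(2))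
qed

lemma re_comp:
  assumes "re P" "cf f" shows "re (\<lambda>x. P (f x))"
proof -
  have "re (\<lambda>n. p2 n = f (p1 n) \<and> P (p2 n))"
    using assms by (intro re_conj re_comp_d0[of P p2] d0_intros) (auto simp: cf_def)
  from re_ex[OF this] show ?thesis by simp
qed

lemma cf_d0: "d0f (\<lambda>e. f (e 0)) \<Longrightarrow> cf f"
proof -
  assume f: "d0f (\<lambda>e. f (e 0))"
  have "d0 (\<lambda>e. f (e 0) = e 1)" by (intro d0_eq f d0f_var)
  from d0_rel2[OF this, of "\<lambda>e. p1 (e 0)" "\<lambda>e. p2 (e 0)"]
  have "d0 (\<lambda>e. p2 (e 0) = f (p1 (e 0)))" by (simp add: d0_intros eq_commute)
  then show ?thesis unfolding cf_def by (rule re_d0)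
qed

lemma cf_id: "cf (\<lambda>x. x)" and cf_const: "cf (\<lambda>x. n)"
  by (auto intro: cf_d0 d0_intros)

lemma cf_pair:
  assumes "cf f" "cf g" shows "cf (\<lambda>x. pair (f x) (g x))"
proof -
  have "re (\<lambda>n. p2 (pair (p1 n) (p1 (p2 n))) = f (p1 (pair (p1 n) (p1 (p2 n)))))"
    by (rule re_comp_d0[of "\<lambda>n. p2 n = f (p1 n)" "\<lambda>n. pair (p1 n) (p1 (p2 n))"])
       (use assms in \<open>auto simp: cf_def intro!: d0_intros\<close>)
  moreover have "re (\<lambda>n. p2 (pair (p1 n) (p2 (p2 n))) = g (p1 (pair (p1 n) (p2 (p2 n)))))"
    by (rule re_comp_d0[of "\<lambda>n. p2 n = g (p1 n)" "\<lambda>n. pair (p1 n) (p2 (p2 n))"])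
       (use assms in \<open>auto simp: cf_def intro!: d0_intros\<close>)
  ultimately have "re (\<lambda>n. p1 (p2 n) = f (p1 n) \<and> p2 (p2 n) = g (p1 n))"
    by (intro re_conj) simp_all
  moreover have "(p1 (p2 n) = f (p1 n) \<and> p2 (p2 n) = g (p1 n)) \<longleftrightarrow> p2 n = pair (f (p1 n)) (g (p1 n))" for n
    by (metis p_pair pair_p)
  ultimately show ?thesis by (simp add: cf_def)
qed

lemma cf_comp:
  assumes "cf f" "cf g" shows "cf (\<lambda>x. f (g x))"
proof -
  have "re (\<lambda>n. p1 (p2 n) = f (p2 (p2 n)) \<and> p2 (p2 n) = g (p1 n))"
  proof (rule re_conj)
    show "re (\<lambda>n. p1 (p2 n) = f (p2 (p2 n)))"
      using re_comp_d0[of "\<lambda>n. p2 n = f (p1 n)" "\<lambda>n. pair (p2 (p2 n)) (p1 (p2 n))"] assms(1)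
      by (simp add: cf_def d0_intros)
    show "re (\<lambda>n. p2 (p2 n) = g (p1 n))"
      using re_comp_d0[of "\<lambda>n. p2 n = g (p1 n)" "\<lambda>n. pair (p1 n) (p2 (p2 n))"] assms(2)
      by (simp add: cf_def d0_intros)
  qed
  then have "re (\<lambda>m. p1 (p2 (pair (p1 (p1 m)) (pair (p2 (p1 m)) (p2 m)))) =
      f (p2 (p2 (pair (p1 (p1 m)) (pair (p2 (p1 m)) (p2 m))))) \<and>
      p2 (p2 (pair (p1 (p1 m)) (pair (p2 (p1 m)) (p2 m)))) =
      g (p1 (pair (p1 (p1 m)) (pair (p2 (p1 m)) (p2 m)))))"
    by (rule re_comp_d0) (intro d0_intros)
  then have "re (\<lambda>m. p2 (p1 m) = f (p2 m) \<and> p2 m = g (p1 (p1 m)))" by simp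
  from re_ex[OF this] show ?thesis by (simp add: cf_def)
qed

lemma cf_p1: "cf f \<Longrightarrow> cf (\<lambda>x. p1 (f x))" and cf_p2: "cf f \<Longrightarrow> cf (\<lambda>x. p2 (f x))"
  and cf_Suc: "cf f \<Longrightarrow> cf (\<lambda>x. Suc (f x))"
proof -
  have "cf p1" "cf p2" "cf Suc" by (rule cf_d0, intro d0_intros)+
  then show "cf f \<Longrightarrow> cf (\<lambda>x. p1 (f x))" "cf f \<Longrightarrow> cf (\<lambda>x. p2 (f x))" "cf f \<Longrightarrow> cf (\<lambda>x. Suc (f x))"
    by (simp_all add: cf_comp)
qed

lemma cf_op2: "cf (\<lambda>n. h (p1 n) (p2 n)) \<Longrightarrow> cf f \<Longrightarrow> cf g \<Longrightarrow> cf (\<lambda>x. h (f x) (g x))"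
  using cf_comp[OF _ cf_pair[of f g], of "\<lambda>n. h (p1 n) (p2 n)"] by simp

lemma cf_plus: "cf f \<Longrightarrow> cf g \<Longrightarrow> cf (\<lambda>x. f x + g x)"
  by (rule cf_op2[of "(+)", OF cf_d0]) (intro d0_intros)

lemma cf_times: "cf f \<Longrightarrow> cf g \<Longrightarrow> cf (\<lambda>x. f x * g x)"
  by (rule cf_op2[of "(*)", OF cf_d0]) (intro d0_intros)

lemma re_rel2: "re (\<lambda>n. R (p1 n) (p2 n)) \<Longrightarrow> cf f \<Longrightarrow> cf g \<Longrightarrow> re (\<lambda>x. R (f x) (g x))"
  using re_comp[OF _ cf_pair[of f g], of "\<lambda>n. R (p1 n) (p2 n)"] by simp

lemma re_eq: "cf f \<Longrightarrow> cf g \<Longrightarrow> re (\<lambda>x. f x = g x)"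
  by (rule re_rel2[of "(=)", OF re_d0]) (intro d0_intros)

lemma re_neq: "cf f \<Longrightarrow> cf g \<Longrightarrow> re (\<lambda>x. f x \<noteq> g x)"
  by (rule re_rel2[of "(\<noteq>)", OF re_d0]) (intro d0_intros)

lemma re_less: "cf f \<Longrightarrow> cf g \<Longrightarrow> re (\<lambda>x. f x < g x)"
  by (rule re_rel2[of "(<)", OF re_d0]) (intro d0_intros)

lemma re_const: "re (\<lambda>x. b)"
  using re_d0[of "\<lambda>_. False"] re_d0[of "\<lambda>_. True"] d0_False d0_not[OF d0_False] by (cases b) simp_all

lemma re_ball:
  assumes "re (\<lambda>n. Q (p1 n) (p2 n))" "cf f" shows "re (\<lambda>x. \<forall>y<f x. Q x y)"
proof -
  obtain D where D: "d0 (\<lambda>e. D (e 0) (e 1))" "\<And>n. Q (p1 n) (p2 n) \<longleftrightarrow> (\<exists>w. D w n)"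
    using assms(1) unfolding re_def by (elim exE conjE) simp
  have Q: "Q x y \<longleftrightarrow> (\<exists>w. D w (pair x y))" for x y using D(2)[of "pair x y"] by simp
  have "re (\<lambda>n. \<forall>y<p2 n. Q (p1 n) y)"
  proof (rule reI[of "\<lambda>w n. \<forall>y<p2 n. \<exists>a<w. D a (pair (p1 n) y)"])
    show "d0 (\<lambda>e. \<forall>y<p2 (e 1). \<exists>a<e 0. D a (pair (p1 (e 1)) y))"
      by (intro d0_intros d0_rel2[OF D(1)])
    fix n
    \<comment> \<open>Collection: finitely many witnesses have a common strict bound, found by
      induction on the length of the range.\<close>
    have "\<exists>w. \<forall>y<b. \<exists>a<w. D a (pair (p1 n) y)" if "\<forall>y<b. \<exists>a. D a (pair (p1 n) y)" for b
      using that
    proof (induction b)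
      case (Suc b)
      then obtain w a where "\<forall>y<b. \<exists>a<w. D a (pair (p1 n) y)" "D a (pair (p1 n) b)" by auto
      then have "\<forall>y<Suc b. \<exists>c<w + Suc a. D c (pair (p1 n) y)"
        by (metis add_Suc_right less_Suc_eq less_add_Suc2 trans_less_add1)
      then show ?case by blast
    qed simp
    then show "(\<forall>y<p2 n. Q (p1 n) y) \<longleftrightarrow> (\<exists>w. \<forall>y<p2 n. \<exists>a<w. D a (pair (p1 n) y))"
      unfolding Q by blast
  qed
  from re_rel2[OF this cf_id assms(2)] show ?thesis by simp
qed

lemmas re_intros = re_ex re_ball re_conj re_disj re_eq re_neq re_less re_const
  cf_id cf_const cf_pair cf_p1 cf_p2 cf_Suc cf_plus cf_times

section \<open>Coding of finite sets and inductive definitions\<close>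

lemma re_cong: "re Q \<Longrightarrow> (\<And>x. P x \<longleftrightarrow> Q x) \<Longrightarrow> re P"
  by (simp add: re_def)

text \<open>A set version of Goedel's beta function: \<open>q\<close> holds a bound, a number
  \<open>c\<close> and a parameter \<open>d\<close>, and \<open>y\<close> belongs iff the modulus
  \<open>1 + (y + 1) d\<close> divides \<open>c\<close>. The bound keeps elements below the code and
  makes \<open>0\<close> a code of the empty set.\<close>

definition mem :: "nat \<Rightarrow> nat \<Rightarrow> bool" where
  "mem y q \<longleftrightarrow> y < p1 q \<and> Suc (Suc y * p2 (p2 q)) dvd p1 (p2 q)"

lemma pair_0_0: "pair 0 0 = 0"
  by (simp add: prod_encode_def)

lemma mem_less: "mem y q \<Longrightarrow> y < q"
  unfolding mem_def using p_le(1)[of q] by simp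

lemma mem_0 [simp]: "\<not> mem y 0"
  using mem_less by blast

text \<open>A common divisor is prime to \<open>d\<close> and divides \<open>(j - i) * d\<close>,
  hence divides \<open>j - i\<close>, hence \<open>d\<close>.\<close>

lemma coprime_moduli:
  fixes d :: nat
  assumes "i < j" "(j - i) dvd d"
  shows "coprime (Suc (Suc i * d)) (Suc (Suc j * d))"
proof (rule coprimeI)
  fix g assume g: "g dvd Suc (Suc i * d)" "g dvd Suc (Suc j * d)"
  have "Suc (Suc j * d) - Suc (Suc i * d) = (j - i) * d"
    using assms(1) by (simp add: diff_mult_distrib)
  then have *: "g dvd (j - i) * d" using g dvd_diff_nat by metis
  have cop: "coprime g d"
  proof (rule coprimeI)
    fix c assume c: "c dvd g" "c dvd d"
    then have "c dvd Suc (Suc i * d)" using g(1) dvd_trans by blast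
    moreover have "c dvd Suc i * d" using c(2) by simp
    ultimately have "c dvd Suc (Suc i * d) - Suc i * d" by (rule dvd_diff_nat)
    then show "is_unit c" by simp
  qed
  then have "g dvd j - i" using * coprime_dvd_mult_left_iff by blast
  then have "g dvd d" using assms(2) dvd_trans by blast
  then show "is_unit g" using cop by (simp add: coprime_absorb_left)
qed

lemma ex_mem_code:
  assumes "finite S" shows "\<exists>q. \<forall>y. mem y q \<longleftrightarrow> y \<in> S"
proof -
  obtain n where n: "\<forall>y\<in>S. y < n" using assms finite_nat_set_iff_bounded by blast
  \<comment> \<open>A factorial is divisible by every difference of two indices below
    \<open>n\<close>, as pairwise coprimality of the moduli requires.\<close>
  define d :: nat where "d = fact n"
  define m where "m i = Suc (Suc i * d)" for i
  have cop: "coprime (m i) (m j)" if "i < n" "j < n" "i \<noteq> j" for i j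
  proof -
    have *: "coprime (m i) (m j)" if "i < j" "j < n" for i j
      unfolding m_def using that by (intro coprime_moduli) (auto simp: d_def intro: dvd_fact)
    show ?thesis
      using that *[of i j] *[of j i] by (metis coprime_commute nat_neq_iff)
  qed
  define c where "c = (\<Prod>i\<in>S. m i)"
  have "m y dvd c \<longleftrightarrow> y \<in> S" if y: "y < n" for y
  proof
    assume "m y dvd c"
    show "y \<in> S"
    proof (rule ccontr)
      assume "y \<notin> S"
      then have "coprime (m y) c" unfolding c_def
        using n y cop by (intro prod_coprime_right) blast
      then have "m y = 1" using \<open>m y dvd c\<close> by (simp add: coprime_absorb_left)
      then show False by (simp add: m_def d_def)
    qed
  next
    assume "y \<in> S"
    then show "m y dvd c" unfolding c_def using assms by (simp add: dvd_prodI)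
  qed
  then have "mem y (pair n (pair c d)) \<longleftrightarrow> y \<in> S" for y
    using n by (auto simp: mem_def m_def)
  then show ?thesis by blast
qed

lemma d0_mem: "d0 (\<lambda>e. mem (e 0) (e 1))"
proof -
  have "d0 (\<lambda>e. e 0 < p1 (e 1) \<and>
      (\<exists>k<Suc (p1 (p2 (e 1))). p1 (p2 (e 1)) = Suc (Suc (e 0) * p2 (p2 (e 1))) * k))"
    by (intro d0_intros)
  moreover have "(\<exists>k<Suc c. c = Suc a * k) \<longleftrightarrow> Suc a dvd c" for a c
    by (auto simp: dvd_def less_Suc_eq_le) (metis le_add1)
  ultimately show ?thesis by (simp only: mem_def)
qed

lemma re_mem: "cf f \<Longrightarrow> cf g \<Longrightarrow> re (\<lambda>x. mem (f x) (g x))"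
  by (rule re_rel2[of mem, OF re_d0]) (intro d0_rel2[OF d0_mem] d0_intros)

lemma re_not_mem: "cf f \<Longrightarrow> cf g \<Longrightarrow> re (\<lambda>x. \<not> mem (f x) (g x))"
  by (rule re_rel2[of "\<lambda>y q. \<not> mem y q", OF re_d0]) (intro d0_not d0_rel2[OF d0_mem] d0_intros)

text \<open>A common two-premise format for the tables below; a rule with one premise ignores the
  second and is applied with the first one repeated.\<close>

inductive clo :: "(nat \<Rightarrow> bool) \<Rightarrow> (nat \<Rightarrow> nat \<Rightarrow> nat \<Rightarrow> bool) \<Rightarrow> nat \<Rightarrow> bool" for B R where
  clo_base: "B x \<Longrightarrow> clo B R x"
| clo_rule: "clo B R a \<Longrightarrow> clo B R b \<Longrightarrow> R a b x \<Longrightarrow> clo B R x"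

lemma re_rel3:
  assumes "re (\<lambda>n. R (p1 n) (p1 (p2 n)) (p2 (p2 n)))" "cf f" "cf g" "cf h"
  shows "re (\<lambda>x. R (f x) (g x) (h x))"
  using re_comp[OF assms(1) cf_pair[OF assms(2) cf_pair[OF assms(3,4)]]] by simp

text \<open>A derivation is coded as a finite set of pairs of a rank and a number, each member
  justified by members of smaller rank. The ranks carry the order of the steps, which a set code
  alone would lose.\<close>

lemma re_clo:
  assumes B: "re B" and R: "re (\<lambda>n. R (p1 n) (p1 (p2 n)) (p2 (p2 n)))"
  shows "re (clo B R)"
proof -
  define ok where "ok X z \<longleftrightarrow> B (p2 z) \<or>
    (\<exists>a b. a \<in> X \<and> b \<in> X \<and> p1 a < p1 z \<and> p1 b < p1 z \<and> R (p2 a) (p2 b) (p2 z))" for X z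
  have ok_mono: "ok X z \<Longrightarrow> X \<subseteq> Y \<Longrightarrow> ok Y z" for X Y z unfolding ok_def by blast
  have ex: "\<exists>X r. finite X \<and> pair r x \<in> X \<and> (\<forall>z\<in>X. ok X z)" if "clo B R x" for x
    using that
  proof induction
    case (clo_base x)
    then show ?case by (intro exI[of _ "{pair 0 x}"] exI[of _ 0]) (auto simp: ok_def)
  next
    case (clo_rule a b x)
    then obtain X r Y s where X: "finite X" "pair r a \<in> X" "\<forall>z\<in>X. ok X z"
      and Y: "finite Y" "pair s b \<in> Y" "\<forall>z\<in>Y. ok Y z" by blast
    let ?z = "pair (Suc (r + s)) x" and ?Z = "insert (pair (Suc (r + s)) x) (X \<union> Y)"
    have "ok ?Z ?z" unfolding ok_def
      using X(2) Y(2) clo_rule.hyps by (intro disjI2 exI[of _ "pair r a"] exI[of _ "pair s b"]) auto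
    moreover have "\<forall>z\<in>X \<union> Y. ok ?Z z" using X(3) Y(3) ok_mono[of X _ ?Z] ok_mono[of Y _ ?Z] by blast
    ultimately show ?case using X(1) Y(1) by (intro exI[of _ ?Z] exI[of _ "Suc (r + s)"]) auto
  qed
  have sound: "clo B R (p2 z)" if "\<forall>z\<in>X. ok X z" "z \<in> X" for X z
    using that(2)
  proof (induction "p1 z" arbitrary: z rule: less_induct)
    case less
    then have "ok X z" using that(1) by blast
    then show ?case unfolding ok_def using less.hyps clo.intros by metis
  qed
  have iff: "clo B R x \<longleftrightarrow> (\<exists>q r. mem (pair r x) q \<and> (\<forall>z<q. \<not> mem z q \<or> B (p2 z) \<or>
    (\<exists>a b. mem a q \<and> mem b q \<and> p1 a < p1 z \<and> p1 b < p1 z \<and> R (p2 a) (p2 b) (p2 z))))" (is "_ \<longleftrightarrow> ?rhs x") for x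
  proof
    assume "clo B R x"
    then obtain X r where X: "finite X" "pair r x \<in> X" "\<forall>z\<in>X. ok X z" using ex by blast
    obtain q where q: "\<And>y. mem y q \<longleftrightarrow> y \<in> X" using ex_mem_code[OF X(1)] by blast
    show "?rhs x"
      by (rule exI[of _ q], rule exI[of _ r]) (use X(2,3) in \<open>auto simp: q ok_def\<close>)
  next
    assume "?rhs x"
    then obtain q r where q: "mem (pair r x) q" and z: "\<forall>z<q. \<not> mem z q \<or> B (p2 z) \<or>
      (\<exists>a b. mem a q \<and> mem b q \<and> p1 a < p1 z \<and> p1 b < p1 z \<and> R (p2 a) (p2 b) (p2 z))" by blast
    have "\<forall>z\<in>{y. mem y q}. ok {y. mem y q} z"
      using z mem_less unfolding ok_def by blast
    from sound[OF this, of "pair r x"] q show "clo B R x" by simp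
  qed
  have "re ?rhs"
    by (intro re_intros re_mem re_not_mem re_comp[OF B] re_rel3[OF R])
  then show ?thesis by (simp only: iff[symmetric, abs_def])
qed

text \<open>The graph of the recursion is generated as triples of parameter, step and value. The
  table holds one value for each parameter and step, so membership determines the result.\<close>

lemma cf_rec:
  assumes a: "cf a" and b: "cf (\<lambda>n. b (p1 n) (p1 (p2 n)) (p2 (p2 n)))" and h: "cf h"
  shows "cf (\<lambda>x. rec_nat (a x) (\<lambda>m r. b x m r) (h x))"
proof -
  define B where "B n \<longleftrightarrow> p1 (p2 n) = 0 \<and> p2 (p2 n) = a (p1 n)" for n
  define R where "R u v n \<longleftrightarrow> n = pair (p1 u) (pair (Suc (p1 (p2 u))) (b (p1 u) (p1 (p2 u)) (p2 (p2 u))))"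
    for u v n :: nat
  have "re B" unfolding B_def by (intro re_intros cf_comp[OF a])
  moreover have "re (\<lambda>n. R (p1 n) (p1 (p2 n)) (p2 (p2 n)))"
    unfolding R_def by (intro re_intros cf_comp[OF b])
  ultimately have clo: "re (clo B R)" by (rule re_clo)
  have 1: "clo B R n \<Longrightarrow> p2 (p2 n) = rec_nat (a (p1 n)) (b (p1 n)) (p1 (p2 n))" for n
    by (induction rule: clo.induct) (auto simp: B_def R_def)
  have 2: "clo B R (pair x (pair m (rec_nat (a x) (b x) m)))" for x m
  proof (induction m)
    case 0
    show ?case by (rule clo_base) (simp add: B_def)
  next
    case (Suc m)
    show ?case by (rule clo_rule[OF Suc Suc]) (simp add: R_def)
  qed
  have "p2 n = rec_nat (a (p1 n)) (b (p1 n)) (h (p1 n)) \<longleftrightarrow> clo B R (pair (p1 n) (pair (h (p1 n)) (p2 n)))" for n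
    using 1[of "pair (p1 n) (pair (h (p1 n)) (p2 n))"] 2[of "p1 n" "h (p1 n)"] by auto
  moreover have "re (\<lambda>n. clo B R (pair (p1 n) (pair (h (p1 n)) (p2 n))))"
    by (intro re_comp[OF clo] re_intros cf_comp[OF h])
  ultimately show ?thesis unfolding cf_def by simp
qed

text \<open>Arguments are computable functions instead of numbers, so that composition is handled by
  the induction hypothesis itself.\<close>

lemma cf_peval: "(\<forall>h\<in>set hs. cf h) \<Longrightarrow> cf (\<lambda>x. peval f (map (\<lambda>h. h x) hs))"
proof (induction f arbitrary: hs)
  case PZ
  then show ?case by (simp add: cf_const)
next
  case PS
  then show ?case by (cases hs) (auto intro: cf_const cf_Suc)
next
  case (PProj i)
  then show ?case by (cases "i < length hs") (auto intro: cf_const)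
next
  case (PComp f gs)
  let ?hs = "map (\<lambda>g x. peval g (map (\<lambda>h. h x) hs)) gs"
  have "cf (\<lambda>x. peval f (map (\<lambda>h. h x) ?hs))"
    using PComp.IH(2) PComp.prems by (intro PComp.IH(1)) auto
  then show ?case by (simp add: comp_def)
next
  case (PRec f g)
  show ?case
  proof (cases hs)
    case Nil
    then show ?thesis by (simp add: cf_const)
  next
    case (Cons h hs')
    have "cf (\<lambda>n. peval g (map (\<lambda>h. h n) ((\<lambda>n. p2 (p2 n)) # (\<lambda>n. p1 (p2 n)) # map (\<lambda>h n. h (p1 n)) hs')))"
    proof (rule PRec.IH(2))
      have "cf (\<lambda>n. p2 (p2 n))" "cf (\<lambda>n. p1 (p2 n))" by (intro re_intros)+
      moreover have "cf (\<lambda>n. k (p1 n))" if "cf k" for k using cf_comp[OF that cf_p1[OF cf_id]] .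
      ultimately show "\<forall>h\<in>set ((\<lambda>n. p2 (p2 n)) # (\<lambda>n. p1 (p2 n)) # map (\<lambda>h n. h (p1 n)) hs'). cf h"
        using PRec.prems Cons by simp
    qed
    then have g: "cf (\<lambda>n. peval g (p2 (p2 n) # p1 (p2 n) # map (\<lambda>h. h (p1 n)) hs'))"
      by (simp add: comp_def)
    have f: "cf (\<lambda>x. peval f (map (\<lambda>h. h x) hs'))"
      using PRec.prems Cons by (intro PRec.IH(1)) auto
    have h: "cf h" using PRec.prems Cons by simp
    show ?thesis
      using cf_rec[OF f, of "\<lambda>x m r. peval g (r # m # map (\<lambda>h. h x) hs')", OF g h] Cons by simp
  qed
qed

lemma re_prim_rec_set: "prim_rec_set S \<Longrightarrow> re (\<lambda>n. n \<in> S)"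
proof -
  assume "prim_rec_set S"
  then obtain f where f: "\<And>n. peval f [n] = (if n \<in> S then 1 else 0)" unfolding prim_rec_set_def by blast
  have "cf (\<lambda>n. peval f [n])" using cf_peval[of "[\<lambda>x. x]" f] by (simp add: cf_id)
  then have "re (\<lambda>n. peval f [n] = 1)" by (intro re_eq cf_const)
  moreover have "(peval f [n] = 1) \<longleftrightarrow> n \<in> S" for n by (simp add: f)
  ultimately show ?thesis by simp
qed

section \<open>Provability is recursively enumerable\<close>

lemma cf_code_num: "cf (\<lambda>n. code_trm (num n))"
proof -
  have "rec_nat (code_trm Zero) (\<lambda>m r. pair 2 r) n = code_trm (num n)" for n
    by (induction n) auto
  then show ?thesis
    using cf_rec[OF cf_const[of "code_trm Zero"], of "\<lambda>x m r. pair 2 r" "\<lambda>x. x"]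
    by (simp add: re_intros)
qed

abbreviation c_imp :: "nat \<Rightarrow> nat \<Rightarrow> nat" where "c_imp a b \<equiv> pair 3 (pair a b)"

definition c_istrm :: "nat \<Rightarrow> bool" where "c_istrm n \<longleftrightarrow> (\<exists>t. n = code_trm t)"
definition c_isfm :: "nat \<Rightarrow> bool" where "c_isfm n \<longleftrightarrow> (\<exists>\<phi>. n = code \<phi>)"

lemma re_istrm: "re c_istrm"
proof -
  define B where "B n \<longleftrightarrow> p1 n = 0 \<or> n = pair 1 0" for n
  define R where "R a b n \<longleftrightarrow> n = pair 2 a \<or> n = pair 3 (pair a b) \<or> n = pair 4 (pair a b)" for a b n
  have re: "re (clo B R)" unfolding B_def R_def by (intro re_clo re_intros)
  have sound: "clo B R n \<Longrightarrow> c_istrm n" for n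
  proof (induction rule: clo.induct)
    case (clo_base x)
    then have "x = code_trm (Var (p2 x)) \<or> x = code_trm Zero" by (auto simp: B_def pair_eq_iff)
    then show ?case unfolding c_istrm_def by blast
  next
    case (clo_rule a b x)
    then obtain t u where "a = code_trm t" "b = code_trm u" unfolding c_istrm_def by blast
    then have "x = code_trm (Sc t) \<or> x = code_trm (Plus t u) \<or> x = code_trm (Times t u)"
      using clo_rule.hyps by (auto simp: R_def)
    then show ?case unfolding c_istrm_def by blast
  qed
  have "clo B R (code_trm t)" for t
  proof (induction t)
    case (Var i)
    then show ?case by (intro clo_base) (simp add: B_def)
  next
    case Zero
    then show ?case by (intro clo_base) (simp add: B_def)
  qed (auto simp: R_def intro: clo_rule)
  then have "clo B R = c_istrm"
    by (intro ext iffI) (erule sound, unfold c_istrm_def, elim exE, simp)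
  then show ?thesis using re by simp
qed

text \<open>Lifting is tabulated as tuples \<open>(j, k, x, y)\<close>, substitution as \<open>(j, k, u, x, y)\<close>, with \<open>j = 0\<close>
  for terms and \<open>j = 1\<close> for formulas.\<close>

definition lift_tab :: "nat \<Rightarrow> bool" where
  "lift_tab n \<longleftrightarrow> (\<exists>k t. n = pair 0 (pair k (pair (code_trm t) (code_trm (lift_trm k t))))) \<or>
     (\<exists>k \<phi>. n = pair 1 (pair k (pair (code \<phi>) (code (lift_fm k \<phi>)))))"

definition subst_tab :: "nat \<Rightarrow> bool" where
  "subst_tab n \<longleftrightarrow>
     (\<exists>k u t. n = pair 0 (pair k (pair (code_trm u) (pair (code_trm t) (code_trm (subst_trm k u t)))))) \<or>
     (\<exists>k u \<phi>. n = pair 1 (pair k (pair (code_trm u) (pair (code \<phi>) (code (subst_fm k u \<phi>))))))"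

lemma re_lift_tab: "re lift_tab"
proof -
  define B where "B n \<longleftrightarrow>
      (\<exists>k i. n = pair 0 (pair k (pair (pair 0 i) (pair 0 i))) \<and> i < k) \<or>
      (\<exists>k i. n = pair 0 (pair k (pair (pair 0 i) (pair 0 (Suc i)))) \<and> k < Suc i) \<or>
      (\<exists>k. n = pair 0 (pair k (pair (pair 1 0) (pair 1 0)))) \<or>
      (\<exists>k. n = pair 1 (pair k (pair 0 0)))" for n
  \<comment> \<open>Both premises share kind and cut-off. The last clause leaves a quantifier: the
    body is lifted above \<open>i + 1\<close>, the quantified formula above
    \<open>i\<close>.\<close>
  define R where "R a b n \<longleftrightarrow> (\<exists>j k x y x' y'. a = pair j (pair k (pair x y)) \<and> b = pair j (pair k (pair x' y')) \<and>
      (j = 0 \<and> n = pair 0 (pair k (pair (pair 2 x) (pair 2 y))) \<or>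
       j = 0 \<and> n = pair 0 (pair k (pair (pair 3 (pair x x')) (pair 3 (pair y y')))) \<or>
       j = 0 \<and> n = pair 0 (pair k (pair (pair 4 (pair x x')) (pair 4 (pair y y')))) \<or>
       j = 0 \<and> n = pair 1 (pair k (pair (pair 1 (pair x x')) (pair 1 (pair y y')))) \<or>
       j = 0 \<and> n = pair 1 (pair k (pair (pair 2 (pair x x')) (pair 2 (pair y y')))) \<or>
       j = 1 \<and> n = pair 1 (pair k (pair (pair 3 (pair x x')) (pair 3 (pair y y')))) \<or>
       j = 1 \<and> (\<exists>i. k = Suc i \<and> n = pair 1 (pair i (pair (pair 4 x) (pair 4 y))))))" for a b n
  have re: "re (clo B R)" unfolding B_def R_def by (intro re_clo re_intros)
  have sound: "clo B R n \<Longrightarrow> lift_tab n" for n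
  proof (induction rule: clo.induct)
    case (clo_base x)
    then show ?case unfolding B_def
    proof (elim disjE exE conjE)
      fix k i assume "x = pair 0 (pair k (pair (pair 0 i) (pair 0 i)))" "i < k"
      then show ?thesis unfolding lift_tab_def by (intro disjI1 exI[of _ k] exI[of _ "Var i"]) simp
    next
      fix k i assume "x = pair 0 (pair k (pair (pair 0 i) (pair 0 (Suc i))))" "k < Suc i"
      then show ?thesis unfolding lift_tab_def by (intro disjI1 exI[of _ k] exI[of _ "Var i"]) simp
    next
      fix k assume "x = pair 0 (pair k (pair (pair 1 0) (pair 1 0)))"
      then show ?thesis unfolding lift_tab_def by (intro disjI1 exI[of _ k] exI[of _ Zero]) simp
    next
      fix k assume "x = pair 1 (pair k (pair 0 0))"
      then show ?thesis unfolding lift_tab_def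
        by (intro disjI2 exI[of _ k] exI[of _ Bot]) (simp add: pair_0_0)
    qed
  next
    case (clo_rule a b n)
    from \<open>R a b n\<close> obtain j k x y x' y' where ab: "a = pair j (pair k (pair x y))" "b = pair j (pair k (pair x' y'))"
      and n: "j = 0 \<and> n = pair 0 (pair k (pair (pair 2 x) (pair 2 y))) \<or>
       j = 0 \<and> n = pair 0 (pair k (pair (pair 3 (pair x x')) (pair 3 (pair y y')))) \<or>
       j = 0 \<and> n = pair 0 (pair k (pair (pair 4 (pair x x')) (pair 4 (pair y y')))) \<or>
       j = 0 \<and> n = pair 1 (pair k (pair (pair 1 (pair x x')) (pair 1 (pair y y')))) \<or>
       j = 0 \<and> n = pair 1 (pair k (pair (pair 2 (pair x x')) (pair 2 (pair y y')))) \<or>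
       j = 1 \<and> n = pair 1 (pair k (pair (pair 3 (pair x x')) (pair 3 (pair y y')))) \<or>
       j = 1 \<and> (\<exists>i. k = Suc i \<and> n = pair 1 (pair i (pair (pair 4 x) (pair 4 y))))"
      unfolding R_def by (elim exE conjE) (rule that)
    show ?case
    proof (cases "j = 0")
      case True
      then obtain t t' where t: "x = code_trm t" "y = code_trm (lift_trm k t)"
        "x' = code_trm t'" "y' = code_trm (lift_trm k t')"
        using clo_rule.IH ab unfolding lift_tab_def by auto
      from n True t consider
          "n = pair 0 (pair k (pair (code_trm (Sc t)) (code_trm (lift_trm k (Sc t)))))"
        | "n = pair 0 (pair k (pair (code_trm (Plus t t')) (code_trm (lift_trm k (Plus t t')))))"
        | "n = pair 0 (pair k (pair (code_trm (Times t t')) (code_trm (lift_trm k (Times t t')))))"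
        | "n = pair 1 (pair k (pair (code (Eq t t')) (code (lift_fm k (Eq t t')))))"
        | "n = pair 1 (pair k (pair (code (Lt t t')) (code (lift_fm k (Lt t t')))))"
        by auto
      then show ?thesis unfolding lift_tab_def by cases blast+
    next
      case False
      then have j: "j = 1" using n by auto
      then obtain \<phi> \<psi> where t: "x = code \<phi>" "y = code (lift_fm k \<phi>)" "x' = code \<psi>" "y' = code (lift_fm k \<psi>)"
        using clo_rule.IH ab unfolding lift_tab_def by auto
      from n j t consider
          "n = pair 1 (pair k (pair (code (Imp \<phi> \<psi>)) (code (lift_fm k (Imp \<phi> \<psi>)))))"
        | i where "k = Suc i" "n = pair 1 (pair i (pair (code (All \<phi>)) (code (lift_fm i (All \<phi>)))))"
        by auto
      then show ?thesis unfolding lift_tab_def by cases blast+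
    qed
  qed
  have tab_t: "clo B R (pair 0 (pair k (pair (code_trm t) (code_trm (lift_trm k t)))))" for k t
  proof (induction t)
    case (Var i)
    then show ?case by (intro clo_base) (auto simp: B_def)
  next
    case Zero
    then show ?case by (intro clo_base) (auto simp: B_def)
  next
    case (Sc t)
    show ?case by (rule clo_rule[OF Sc Sc]) (simp add: R_def)
  next
    case (Plus t u)
    show ?case by (rule clo_rule[OF Plus]) (simp add: R_def)
  next
    case (Times t u)
    show ?case by (rule clo_rule[OF Times]) (simp add: R_def)
  qed
  have tab_f: "clo B R (pair 1 (pair k (pair (code \<phi>) (code (lift_fm k \<phi>)))))" for k \<phi>
  proof (induction \<phi> arbitrary: k)
    case Bot
    show ?case by (intro clo_base) (auto simp: B_def pair_0_0)
  next
    case (Eq t u)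
    show ?case by (rule clo_rule[OF tab_t[of k t] tab_t[of k u]]) (simp add: R_def)
  next
    case (Lt t u)
    show ?case by (rule clo_rule[OF tab_t[of k t] tab_t[of k u]]) (simp add: R_def)
  next
    case (Imp \<phi> \<psi>)
    show ?case by (rule clo_rule[OF Imp.IH(1)[of k] Imp.IH(2)[of k]]) (simp add: R_def)
  next
    case (All \<phi>)
    show ?case by (rule clo_rule[OF All.IH[of "Suc k"] All.IH[of "Suc k"]]) (simp add: R_def)
  qed
  have "clo B R = lift_tab"
    by (intro ext iffI) (erule sound, unfold lift_tab_def, elim disjE exE, simp_all add: tab_t tab_f[unfolded One_nat_def])
  then show ?thesis using re by simp
qed

lemma lift_tab_trm: "lift_tab (pair 0 (pair k (pair x y))) \<longleftrightarrow> (\<exists>t. x = code_trm t \<and> y = code_trm (lift_trm k t))"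
  by (auto simp: lift_tab_def)

lemma lift_tab_fm: "lift_tab (pair 1 (pair k (pair x y))) \<longleftrightarrow> (\<exists>\<phi>. x = code \<phi> \<and> y = code (lift_fm k \<phi>))"
  by (auto simp: lift_tab_def)

lemma re_subst_tab: "re subst_tab"
proof -
  \<comment> \<open>The variable case is split at the cut-off, and its shifted branch is written
    with \<open>Suc i\<close> so that no truncated subtraction occurs. The guard
    \<open>c_istrm u\<close> ensures that every entry substitutes a genuine term.\<close>
  define B where "B n \<longleftrightarrow> (\<exists>k u. c_istrm u \<and>
      ((\<exists>i. n = pair 0 (pair k (pair u (pair (pair 0 i) (pair 0 i)))) \<and> i < k) \<or>
       n = pair 0 (pair k (pair u (pair (pair 0 k) u))) \<or>
       (\<exists>i. n = pair 0 (pair k (pair u (pair (pair 0 (Suc i)) (pair 0 i)))) \<and> k < Suc i) \<or>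
       n = pair 0 (pair k (pair u (pair (pair 1 0) (pair 1 0)))) \<or>
       n = pair 1 (pair k (pair u (pair 0 0)))))" for n
  \<comment> \<open>Under a quantifier the substituted term is lifted: the premise uses
    \<open>u\<close>, the conclusion the term \<open>v\<close> whose lift is
    \<open>u\<close>.\<close>
  define R where "R a b n \<longleftrightarrow> (\<exists>j k u x y x' y'. a = pair j (pair k (pair u (pair x y))) \<and>
      b = pair j (pair k (pair u (pair x' y'))) \<and>
      (j = 0 \<and> n = pair 0 (pair k (pair u (pair (pair 2 x) (pair 2 y)))) \<or>
       j = 0 \<and> n = pair 0 (pair k (pair u (pair (pair 3 (pair x x')) (pair 3 (pair y y'))))) \<or>
       j = 0 \<and> n = pair 0 (pair k (pair u (pair (pair 4 (pair x x')) (pair 4 (pair y y'))))) \<or>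
       j = 0 \<and> n = pair 1 (pair k (pair u (pair (pair 1 (pair x x')) (pair 1 (pair y y'))))) \<or>
       j = 0 \<and> n = pair 1 (pair k (pair u (pair (pair 2 (pair x x')) (pair 2 (pair y y'))))) \<or>
       j = 1 \<and> n = pair 1 (pair k (pair u (pair (pair 3 (pair x x')) (pair 3 (pair y y'))))) \<or>
       j = 1 \<and> (\<exists>i v. k = Suc i \<and> lift_tab (pair 0 (pair 0 (pair v u))) \<and>
         n = pair 1 (pair i (pair v (pair (pair 4 x) (pair 4 y)))))))" for a b n
  have "re B" unfolding B_def by (intro re_intros re_comp[OF re_istrm])
  moreover have "re (\<lambda>n. R (p1 n) (p1 (p2 n)) (p2 (p2 n)))"
    unfolding R_def by (intro re_intros re_comp[OF re_lift_tab])
  ultimately have re: "re (clo B R)" by (rule re_clo)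
  have tabI0: "subst_tab (pair 0 (pair k (pair (code_trm u) (pair (code_trm t) (code_trm (subst_trm k u t))))))" for k u t
    unfolding subst_tab_def by blast
  have tabI1: "subst_tab (pair 1 (pair k (pair (code_trm u) (pair (code \<phi>) (code (subst_fm k u \<phi>))))))" for k u \<phi>
    unfolding subst_tab_def by blast
  have sound: "clo B R n \<Longrightarrow> subst_tab n" for n
  proof (induction rule: clo.induct)
    case (clo_base n)
    then show ?case unfolding B_def c_istrm_def
    proof (elim exE conjE disjE)
      fix k c t i assume "c = code_trm t" "n = pair 0 (pair k (pair c (pair (pair 0 i) (pair 0 i))))" "i < k"
      then show ?thesis using tabI0[of k t "Var i"] by simp
    next
      fix k c t assume "c = code_trm t" "n = pair 0 (pair k (pair c (pair (pair 0 k) c)))"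
      then show ?thesis using tabI0[of k t "Var k"] by simp
    next
      fix k c t i assume "c = code_trm t" "n = pair 0 (pair k (pair c (pair (pair 0 (Suc i)) (pair 0 i))))" "k < Suc i"
      then show ?thesis using tabI0[of k t "Var (Suc i)"] by simp
    next
      fix k c t assume "c = code_trm t" "n = pair 0 (pair k (pair c (pair (pair 1 0) (pair 1 0))))"
      then show ?thesis using tabI0[of k t Zero] by simp
    next
      fix k c t assume "c = code_trm t" "n = pair 1 (pair k (pair c (pair 0 0)))"
      then show ?thesis using tabI1[of k t Bot] by (simp add: pair_0_0)
    qed
  next
    case (clo_rule a b n)
    from \<open>R a b n\<close> obtain j k u x y x' y' where ab: "a = pair j (pair k (pair u (pair x y)))"
        "b = pair j (pair k (pair u (pair x' y')))"
      and n: "(j = 0 \<and> n = pair 0 (pair k (pair u (pair (pair 2 x) (pair 2 y)))) \<or>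
       j = 0 \<and> n = pair 0 (pair k (pair u (pair (pair 3 (pair x x')) (pair 3 (pair y y'))))) \<or>
       j = 0 \<and> n = pair 0 (pair k (pair u (pair (pair 4 (pair x x')) (pair 4 (pair y y'))))) \<or>
       j = 0 \<and> n = pair 1 (pair k (pair u (pair (pair 1 (pair x x')) (pair 1 (pair y y'))))) \<or>
       j = 0 \<and> n = pair 1 (pair k (pair u (pair (pair 2 (pair x x')) (pair 2 (pair y y'))))) \<or>
       j = 1 \<and> n = pair 1 (pair k (pair u (pair (pair 3 (pair x x')) (pair 3 (pair y y'))))) \<or>
       j = 1 \<and> (\<exists>i v. k = Suc i \<and> lift_tab (pair 0 (pair 0 (pair v u))) \<and>
         n = pair 1 (pair i (pair v (pair (pair 4 x) (pair 4 y))))))"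
      unfolding R_def by (elim exE conjE) (rule that)
    show ?case
    proof (cases "j = 0")
      case True
      then obtain w t t' where t: "u = code_trm w" "x = code_trm t" "y = code_trm (subst_trm k w t)"
        "x' = code_trm t'" "y' = code_trm (subst_trm k w t')"
        using clo_rule.IH ab unfolding subst_tab_def by auto
      from n True t consider
          "n = pair 0 (pair k (pair u (pair (code_trm (Sc t)) (code_trm (subst_trm k w (Sc t))))))"
        | "n = pair 0 (pair k (pair u (pair (code_trm (Plus t t')) (code_trm (subst_trm k w (Plus t t'))))))"
        | "n = pair 0 (pair k (pair u (pair (code_trm (Times t t')) (code_trm (subst_trm k w (Times t t'))))))"
        | "n = pair 1 (pair k (pair u (pair (code (Eq t t')) (code (subst_fm k w (Eq t t'))))))"
        | "n = pair 1 (pair k (pair u (pair (code (Lt t t')) (code (subst_fm k w (Lt t t'))))))"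
        by auto
      then show ?thesis unfolding t(1)
        by cases (simp_all only: tabI0 tabI1)
    next
      case False
      then have j: "j = 1" using n by auto
      then obtain w \<phi> \<psi> where t: "u = code_trm w" "x = code \<phi>" "y = code (subst_fm k w \<phi>)"
          "x' = code \<psi>" "y' = code (subst_fm k w \<psi>)"
        using clo_rule.IH ab unfolding subst_tab_def by auto
      from n j t consider
          "n = pair 1 (pair k (pair u (pair (code (Imp \<phi> \<psi>)) (code (subst_fm k w (Imp \<phi> \<psi>))))))"
        | i v where "k = Suc i" "w = lift_trm 0 v"
            "n = pair 1 (pair i (pair (code_trm v) (pair (code (All \<phi>)) (code (subst_fm i v (All \<phi>))))))"
        by (auto simp: lift_tab_trm)
      then show ?thesis unfolding t(1)
        by cases (simp_all only: tabI1)
    qed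
  qed
  have istrm: "c_istrm (code_trm u)" for u unfolding c_istrm_def by blast
  have tab_t: "clo B R (pair 0 (pair k (pair (code_trm u) (pair (code_trm t) (code_trm (subst_trm k u t))))))" for k u t
  proof (induction t)
    case (Var i)
    show ?case
    proof (rule clo_base, unfold B_def, rule exI[of _ k], rule exI[of _ "code_trm u"])
      consider "i < k" | "i = k" | j where "i = Suc j" "k < Suc j"
        by (cases i) (auto, metis not_less_iff_gr_or_eq Suc_leI)
      then show "c_istrm (code_trm u) \<and>
         ((\<exists>ia. pair 0 (pair k (pair (code_trm u) (pair (code_trm (Var i)) (code_trm (subst_trm k u (Var i)))))) =
                pair 0 (pair k (pair (code_trm u) (pair (pair 0 ia) (pair 0 ia)))) \<and> ia < k) \<or>
          pair 0 (pair k (pair (code_trm u) (pair (code_trm (Var i)) (code_trm (subst_trm k u (Var i)))))) =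
          pair 0 (pair k (pair (code_trm u) (pair (pair 0 k) (code_trm u)))) \<or>
          (\<exists>ia. pair 0 (pair k (pair (code_trm u) (pair (code_trm (Var i)) (code_trm (subst_trm k u (Var i)))))) =
                pair 0 (pair k (pair (code_trm u) (pair (pair 0 (Suc ia)) (pair 0 ia)))) \<and> k < Suc ia) \<or>
          pair 0 (pair k (pair (code_trm u) (pair (code_trm (Var i)) (code_trm (subst_trm k u (Var i)))))) =
          pair 0 (pair k (pair (code_trm u) (pair (pair 1 0) (pair 1 0)))) \<or>
          pair 0 (pair k (pair (code_trm u) (pair (code_trm (Var i)) (code_trm (subst_trm k u (Var i)))))) =
          pair 1 (pair k (pair (code_trm u) (pair 0 0))))"
        by cases (auto simp: istrm)
    qed
  next
    case Zero
    show ?case using istrm by (intro clo_base) (auto simp: B_def)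
  next
    case (Sc t)
    show ?case by (rule clo_rule[OF Sc Sc]) (simp add: R_def)
  next
    case (Plus t t')
    show ?case by (rule clo_rule[OF Plus]) (simp add: R_def)
  next
    case (Times t t')
    show ?case by (rule clo_rule[OF Times]) (simp add: R_def)
  qed
  have tab_f: "clo B R (pair 1 (pair k (pair (code_trm u) (pair (code \<phi>) (code (subst_fm k u \<phi>))))))" for k u \<phi>
  proof (induction \<phi> arbitrary: k u)
    case Bot
    show ?case using istrm by (intro clo_base) (auto simp: B_def pair_0_0)
  next
    case (Eq t t')
    show ?case by (rule clo_rule[OF tab_t[of k u t] tab_t[of k u t']]) (simp add: R_def)
  next
    case (Lt t t')
    show ?case by (rule clo_rule[OF tab_t[of k u t] tab_t[of k u t']]) (simp add: R_def)
  next
    case (Imp \<phi> \<psi>)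
    show ?case by (rule clo_rule[OF Imp.IH(1)[of k u] Imp.IH(2)[of k u]]) (simp add: R_def)
  next
    case (All \<phi>)
    show ?case
      by (rule clo_rule[OF All.IH[of "Suc k" "lift_trm 0 u"] All.IH[of "Suc k" "lift_trm 0 u"]])
        (auto simp: R_def lift_tab_trm)
  qed
  have "clo B R = subst_tab"
    by (intro ext iffI) (erule sound, unfold subst_tab_def, elim disjE exE,
        simp_all add: tab_t tab_f[unfolded One_nat_def])
  then show ?thesis using re by simp
qed

lemma subst_tab_fm: "subst_tab (pair 1 (pair k (pair u (pair x y)))) \<longleftrightarrow>
    (\<exists>t \<phi>. u = code_trm t \<and> x = code \<phi> \<and> y = code (subst_fm k t \<phi>))"
  by (auto simp: subst_tab_def)

text \<open>Every formula has a lift, and the lifting table contains formulas only, so having an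
  entry there characterises formula codes.\<close>

lemma re_isfm: "re c_isfm"
proof -
  have "c_isfm x \<longleftrightarrow> (\<exists>y. lift_tab (pair 1 (pair 0 (pair x y))))" for x
    unfolding c_isfm_def lift_tab_fm by blast
  moreover have "re (\<lambda>x. \<exists>y. lift_tab (pair 1 (pair 0 (pair x y))))"
    by (intro re_intros re_comp[OF re_lift_tab])
  ultimately show ?thesis using re_cong by blast
qed

definition thm_code :: "fm set \<Rightarrow> nat \<Rightarrow> bool" where
  "thm_code T n \<longleftrightarrow> (\<exists>\<phi>. n = code \<phi> \<and> prv T \<phi>)"

lemma re_thm_code:
  assumes "prim_rec_set (code ` T)" shows "re (thm_code T)"
proof -
  \<comment> \<open>The members of \<open>T\<close>, followed by the seven logical schemes;
    \<open>0\<close> is the code of \<open>Bot\<close>. In the Leibniz scheme the shared code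
    \<open>a\<close> forces both substitutions to act on the same formula.\<close>
  define B where "B y \<longleftrightarrow> y \<in> code ` T \<or>
     (\<exists>a b. c_isfm a \<and> c_isfm b \<and> y = c_imp a (c_imp b a)) \<or>
     (\<exists>a b c. c_isfm a \<and> c_isfm b \<and> c_isfm c \<and>
        y = c_imp (c_imp a (c_imp b c)) (c_imp (c_imp a b) (c_imp a c))) \<or>
     (\<exists>a. c_isfm a \<and> y = c_imp (c_imp (c_imp a 0) 0) a) \<or>
     (\<exists>t a c. subst_tab (pair 1 (pair 0 (pair t (pair a c)))) \<and> y = c_imp (pair 4 a) c) \<or>
     (\<exists>a a' b. lift_tab (pair 1 (pair 0 (pair a a'))) \<and> c_isfm b \<and>
        y = c_imp (pair 4 (c_imp a' b)) (c_imp a (pair 4 b))) \<or>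
     (\<exists>t. c_istrm t \<and> y = pair 1 (pair t t)) \<or>
     (\<exists>s t a c c'. subst_tab (pair 1 (pair 0 (pair s (pair a c)))) \<and>
        subst_tab (pair 1 (pair 0 (pair t (pair a c')))) \<and> y = c_imp (pair 1 (pair s t)) (c_imp c c'))" for y
  define R where "R a b y \<longleftrightarrow> a = c_imp b y \<or> y = pair 4 a" for a b y
  have "re B" unfolding B_def
    by (intro re_intros re_prim_rec_set[OF assms] re_comp[OF re_isfm] re_comp[OF re_istrm]
        re_comp[OF re_subst_tab] re_comp[OF re_lift_tab])
  moreover have "re (\<lambda>n. R (p1 n) (p1 (p2 n)) (p2 (p2 n)))" unfolding R_def by (intro re_intros)
  ultimately have re: "re (clo B R)" by (rule re_clo)
  have code_Bot: "code Bot = 0" by (simp add: pair_0_0)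
  have thmI: "prv T \<phi> \<Longrightarrow> thm_code T (code \<phi>)" for \<phi> unfolding thm_code_def by blast
  have sound: "clo B R y \<Longrightarrow> thm_code T y" for y
  proof (induction rule: clo.induct)
    case (clo_base y)
    then show ?case unfolding B_def c_isfm_def c_istrm_def subst_tab_fm lift_tab_fm
    proof (elim disjE exE conjE imageE)
      fix \<chi> assume "y = code \<chi>" "\<chi> \<in> T"
      then show ?thesis using thmI[OF prv.ax[of \<chi> T]] by simp
    next
      fix a b \<phi> \<psi> assume "y = c_imp a (c_imp b a)" "a = code \<phi>" "b = code \<psi>"
      then show ?thesis using thmI[OF prv.ax_K[of T \<phi> \<psi>]] by simp
    next
      fix a b c \<phi> \<psi> \<chi>
      assume "y = c_imp (c_imp a (c_imp b c)) (c_imp (c_imp a b) (c_imp a c))" "a = code \<phi>" "b = code \<psi>" "c = code \<chi>"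
      then show ?thesis using thmI[OF prv.ax_S[of T \<phi> \<psi> \<chi>]] by simp
    next
      fix a \<phi> assume "y = c_imp (c_imp (c_imp a 0) 0) a" "a = code \<phi>"
      then show ?thesis using thmI[OF prv.ax_DN[of T \<phi>]] by (simp add: Neg_def pair_0_0)
    next
      fix t a c u \<phi> assume "y = c_imp (pair 4 a) c" "t = code_trm u" "a = code \<phi>" "c = code (subst_fm 0 u \<phi>)"
      then show ?thesis using thmI[OF prv.ax_inst[of T \<phi> u]] by simp
    next
      fix a a' b \<phi> \<psi> assume "y = c_imp (pair 4 (c_imp a' b)) (c_imp a (pair 4 b))"
        "b = code \<psi>" "a = code \<phi>" "a' = code (lift_fm 0 \<phi>)"
      then show ?thesis using thmI[OF prv.ax_allimp[of T \<phi> \<psi>]] by simp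
    next
      fix t u assume "y = pair 1 (pair t t)" "t = code_trm u"
      then show ?thesis using thmI[OF prv.ax_refl[of T u]] by simp
    next
      fix s t a c c' s' t' \<phi> \<phi>' assume "y = c_imp (pair 1 (pair s t)) (c_imp c c')"
        "s = code_trm s'" "a = code \<phi>" "c = code (subst_fm 0 s' \<phi>)"
        "t = code_trm t'" "a = code \<phi>'" "c' = code (subst_fm 0 t' \<phi>')"
      then show ?thesis using thmI[OF prv.ax_leibniz[of T s' t' \<phi>]] by simp
    qed
  next
    case (clo_rule a b y)
    then obtain \<phi> \<psi> where ab: "a = code \<phi>" "prv T \<phi>" "b = code \<psi>" "prv T \<psi>" unfolding thm_code_def by blast
    show ?case
    proof (cases "y = pair 4 a")
      case True
      then show ?thesis using ab thmI[OF prv.gen[of T \<phi>]] by simp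
    next
      case False
      then have "code \<phi> = c_imp (code \<psi>) y" using clo_rule.hyps ab by (simp add: R_def)
      then obtain \<chi> where "\<phi> = Imp \<psi> \<chi>" "y = code \<chi>" by (cases \<phi>) auto
      then show ?thesis using ab thmI[OF prv.mp[of T \<psi> \<chi>]] by simp
    qed
  qed
  have "clo B R (code \<phi>)" if "prv T \<phi>" for \<phi>
    using that
  proof induction
    case (mp \<phi> \<psi>)
    show ?case by (rule clo_rule[OF mp.IH]) (simp add: R_def)
  next
    case (gen \<phi>)
    show ?case by (rule clo_rule[OF gen.IH gen.IH]) (simp add: R_def)
  next
    case (ax_inst \<phi> t)
    have "subst_tab (pair 1 (pair 0 (pair (code_trm t) (pair (code \<phi>) (code (subst_fm 0 t \<phi>))))))"
      unfolding subst_tab_fm by blast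
    then show ?case unfolding code.simps by (intro clo_base) (unfold B_def, blast)
  next
    case (ax_allimp \<phi> \<psi>)
    have "lift_tab (pair 1 (pair 0 (pair (code \<phi>) (code (lift_fm 0 \<phi>)))))" "c_isfm (code \<psi>)"
      unfolding lift_tab_fm c_isfm_def by blast+
    then show ?case unfolding code.simps by (intro clo_base) (unfold B_def, blast)
  next
    case (ax_leibniz s t \<phi>)
    have "subst_tab (pair 1 (pair 0 (pair (code_trm s) (pair (code \<phi>) (code (subst_fm 0 s \<phi>))))))"
      "subst_tab (pair 1 (pair 0 (pair (code_trm t) (pair (code \<phi>) (code (subst_fm 0 t \<phi>))))))"
      unfolding subst_tab_fm by blast+
    then show ?case unfolding code.simps by (intro clo_base) (unfold B_def, blast)
  next
    case (ax \<phi>)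
    then show ?case by (intro clo_base) (unfold B_def, blast)
  next
    case (ax_K \<phi> \<psi>)
    have "c_isfm (code \<phi>)" "c_isfm (code \<psi>)" unfolding c_isfm_def by blast+
    then show ?case unfolding code.simps by (intro clo_base) (unfold B_def, blast)
  next
    case (ax_S \<phi> \<psi> \<chi>)
    have "c_isfm (code \<phi>)" "c_isfm (code \<psi>)" "c_isfm (code \<chi>)" unfolding c_isfm_def by blast+
    then show ?case unfolding code.simps by (intro clo_base) (unfold B_def, blast)
  next
    case (ax_DN \<phi>)
    have "c_isfm (code \<phi>)" unfolding c_isfm_def by blast
    then show ?case unfolding Neg_def code.simps(4) code_Bot by (intro clo_base) (unfold B_def, blast)
  next
    case (ax_refl t)
    have "c_istrm (code_trm t)" unfolding c_istrm_def by blast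
    then show ?case unfolding code.simps by (intro clo_base) (unfold B_def, blast)
  qed
  then have "clo B R = thm_code T"
    by (intro ext iffI) (erule sound, unfold thm_code_def, elim exE conjE, simp)
  then show ?thesis using re by simp
qed

section \<open>The provability predicate\<close>

text \<open>Missing arguments are filled with \<open>Zero\<close>, so the free variables of an
  application come only from its arguments, whatever \<open>F\<close> is.\<close>

definition app :: "fm \<Rightarrow> trm list \<Rightarrow> fm" where
  "app F ts = ssubst_fm (\<lambda>i. if i < length ts then ts ! i else Zero) F"

definition rel :: "'a struct \<Rightarrow> fm \<Rightarrow> 'a list \<Rightarrow> bool" where
  "rel M F xs \<longleftrightarrow> eval_fm M (\<lambda>i. if i < length xs then xs ! i else zer M) F"

definition BAll :: "trm \<Rightarrow> fm \<Rightarrow> fm" where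
  "BAll t \<phi> = All (Imp (Lt (Var 0) (lift_trm 0 t)) \<phi>)"

definition BEx :: "trm \<Rightarrow> fm \<Rightarrow> fm" where
  "BEx t \<phi> = Neg (BAll t (Neg \<phi>))"

definition Or :: "fm \<Rightarrow> fm \<Rightarrow> fm" where
  "Or \<phi> \<psi> = Imp (Neg \<phi>) \<psi>"

lemma eval_app [simp]: "eval_fm M e (app F ts) \<longleftrightarrow> rel M F (map (eval_trm M e) ts)"
  unfolding app_def rel_def eval_fm_ssubst
  by (rule arg_cong[of _ _ "\<lambda>e. eval_fm M e F"]) auto

lemma eval_bounded [simp]:
  "eval_fm M e (BAll t \<phi>) \<longleftrightarrow> (\<forall>x. less M x (eval_trm M e t) \<longrightarrow> eval_fm M (case_nat x e) \<phi>)"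
  "eval_fm M e (BEx t \<phi>) \<longleftrightarrow> (\<exists>x. less M x (eval_trm M e t) \<and> eval_fm M (case_nat x e) \<phi>)"
  "eval_fm M e (Or \<phi> \<psi>) \<longleftrightarrow> eval_fm M e \<phi> \<or> eval_fm M e \<psi>"
  by (auto simp: BAll_def BEx_def Or_def)

lemma fv_app: "fv (app F ts) \<subseteq> (\<Union>t\<in>set ts. fv_trm t)"
proof
  fix j assume "j \<in> fv (app F ts)"
  then obtain i where "j \<in> fv_trm (if i < length ts then ts ! i else Zero)"
    unfolding app_def using fv_ssubst_fm by blast
  then show "j \<in> (\<Union>t\<in>set ts. fv_trm t)" by (auto split: if_splits)
qed

lemma Delta0_connectives:
  "Delta0 \<phi> \<Longrightarrow> Delta0 (Neg \<phi>)" "Delta0 \<phi> \<Longrightarrow> Delta0 \<psi> \<Longrightarrow> Delta0 (Conj \<phi> \<psi>)"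
  "Delta0 \<phi> \<Longrightarrow> Delta0 \<psi> \<Longrightarrow> Delta0 (Or \<phi> \<psi>)" "Delta0 \<phi> \<Longrightarrow> Delta0 \<psi> \<Longrightarrow> Delta0 (Iff \<phi> \<psi>)"
  "Delta0 \<phi> \<Longrightarrow> Delta0 (BAll t \<phi>)" "Delta0 \<phi> \<Longrightarrow> Delta0 (BEx t \<phi>)"
  "Delta0 \<phi> \<Longrightarrow> Delta0 (app \<phi> ts)" "Delta0 (Eq t u)" "Delta0 (Lt t u)"
  by (auto simp: Neg_def Conj_def Or_def Iff_def BAll_def BEx_def app_def intro!: Delta0.intros Delta0_ssubst)

lemma (in pa_model) rel_absolute:
  assumes "Delta0 F" shows "rel M F (map nm ns) \<longleftrightarrow> rel std F ns"
proof -
  have "(\<lambda>i. if i < length (map nm ns) then map nm ns ! i else zer M) =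
      (\<lambda>i. nm (if i < length ns then ns ! i else zer std))" by auto
  then show ?thesis unfolding rel_def using Delta0_absolute[OF assms] by simp
qed

lemma eval_subst_num2:
  assumes "fv F \<subseteq> {0, 1}"
  shows "eval_fm M e (subst_fm 0 (num n) (subst_fm 1 (num k) F)) \<longleftrightarrow> rel M F [numeral_in M n, numeral_in M k]"
  unfolding subst_fm_ssubst ssubst_fm_comp eval_fm_ssubst rel_def
proof (rule eval_fm_cong)
  fix i assume "i \<in> fv F"
  then have "i = 0 \<or> i = 1" using assms by auto
  moreover have "ssubst_trm s (num k) = num k" for s k by (induction k) auto
  ultimately show "eval_trm M e (ssubst_trm (\<lambda>i. if i < 0 then Var i else if i = 0 then num n else Var (i - 1))
      (if i < 1 then Var i else if i = 1 then num k else Var (i - 1))) =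
      (if i < length [numeral_in M n, numeral_in M k] then [numeral_in M n, numeral_in M k] ! i else zer M)"
    by auto
qed

lemma d0_formula:
  assumes "d0 R" shows "\<exists>F. Delta0 F \<and> (\<forall>xs. rel std F xs \<longleftrightarrow> R (\<lambda>i. if i < length xs then xs ! i else 0))"
proof -
  from assms obtain F where "Delta0 F" "\<forall>e. eval_fm std e F = R e" unfolding d0_def by (elim exE conjE)
  then show ?thesis by (intro exI[of _ F]) (simp add: rel_def cong: if_cong)
qed

abbreviation three :: "trm \<Rightarrow> trm" where "three t \<equiv> Plus (Plus t t) t"

text \<open>This carries the diagonalisation: applied to \<open>f = p1 g\<close> or
  \<open>f = p2 g\<close>, it computes the codes of sentences in which \<open>g\<close> itself has
  been inserted as parameter.\<close>

definition prcode :: "nat \<Rightarrow> nat \<Rightarrow> nat \<Rightarrow> nat \<Rightarrow> bool" where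
  "prcode f g x y \<longleftrightarrow> (\<exists>m. subst_tab (pair 1 (pair 1 (pair (code_trm (num g)) (pair f m)))) \<and>
     subst_tab (pair 1 (pair 0 (pair (code_trm (num x)) (pair m y)))))"

lemma prcode: "prcode (code F) g x y \<longleftrightarrow> y = code (subst_fm 0 (num x) (subst_fm 1 (num g) F))"
  unfolding prcode_def subst_tab_fm by auto

text \<open>\<open>consR\<close> is the closure rule imposed on the predicate. \<open>truth_tab\<close> evaluates Boolean
  combinations of sentences \<open>Pr(x)\<close> and \<open>\<sigma>\<^sub>j\<close> from a finite set \<open>e\<close>: \<open>3x\<close> and \<open>3x+1\<close> in \<open>e\<close> declare
  \<open>Pr(x)\<close> true and false respectively, and \<open>\<sigma>\<^sub>j\<close> is true iff \<open>3j+2\<close> is in \<open>e\<close>. The parameter \<open>g\<close> is the pair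
  of the codes of the formulas from which \<open>Pr\<close> and \<open>\<sigma>\<close> arise by substituting \<open>g\<close> itself.\<close>

definition consR :: "fm set \<Rightarrow> logic \<Rightarrow> nat \<Rightarrow> nat \<Rightarrow> nat \<Rightarrow> bool" where
  "consR T L g x y \<longleftrightarrow> thm_code T (c_imp x y) \<or> L = MNF \<and> prcode (p1 g) g x y"

definition truth_base :: "nat \<Rightarrow> bool" where
  "truth_base n \<longleftrightarrow> (\<exists>g e. n = pair g (pair e (pair 0 (code (Eq Zero (Sc Zero)))))) \<or>
     (\<exists>g e x y. prcode (p1 g) g x y \<and> mem (x + x + x) e \<and> n = pair g (pair e (pair 1 y))) \<or>
     (\<exists>g e x y. prcode (p1 g) g x y \<and> mem (Suc (x + x + x)) e \<and> n = pair g (pair e (pair 0 y))) \<or>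
     (\<exists>g e x y. prcode (p2 g) g x y \<and> mem (Suc (Suc (x + x + x))) e \<and> n = pair g (pair e (pair 1 y))) \<or>
     (\<exists>g e x y. prcode (p2 g) g x y \<and> \<not> mem (Suc (Suc (x + x + x))) e \<and> n = pair g (pair e (pair 0 y)))"

definition truth_rule :: "nat \<Rightarrow> nat \<Rightarrow> nat \<Rightarrow> bool" where
  "truth_rule a b n \<longleftrightarrow> (\<exists>g e i x j y. a = pair g (pair e (pair i x)) \<and> b = pair g (pair e (pair j y)) \<and>
     (i = 1 \<and> j = 0 \<and> n = pair g (pair e (pair 0 (c_imp x y))) \<or>
      (i = 0 \<or> j = 1) \<and> n = pair g (pair e (pair 1 (c_imp x y)))))"

definition truth_tab :: "nat \<Rightarrow> bool" where
  "truth_tab = clo truth_base truth_rule"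

definition refuted :: "fm set \<Rightarrow> nat \<Rightarrow> nat \<Rightarrow> bool" where
  "refuted T g e \<longleftrightarrow> (\<exists>y. thm_code T y \<and> truth_tab (pair g (pair e (pair 0 y))))"

lemma re_prcode: "cf f \<Longrightarrow> cf g \<Longrightarrow> cf h \<Longrightarrow> cf k \<Longrightarrow> re (\<lambda>n. prcode (f n) (g n) (h n) (k n))"
proof -
  assume c: "cf f" "cf g" "cf h" "cf k"
  have "re (\<lambda>n. prcode (p1 (p1 n)) (p2 (p1 n)) (p1 (p2 n)) (p2 (p2 n)))"
    unfolding prcode_def by (intro re_intros re_comp[OF re_subst_tab] cf_comp[OF cf_code_num])
  from re_comp[OF this cf_pair[OF cf_pair[OF c(1,2)] cf_pair[OF c(3,4)]]] show ?thesis by simp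
qed

lemma re_consR:
  assumes "re (thm_code T)" shows "re (\<lambda>n. consR T L (p1 n) (p1 (p2 n)) (p2 (p2 n)))"
  unfolding consR_def by (intro re_intros re_prcode re_comp[OF assms])

lemma re_refuted:
  assumes "re (thm_code T)" shows "re (\<lambda>n. refuted T (p1 n) (p2 n))"
proof -
  have "re truth_base" unfolding truth_base_def
    by (intro re_intros re_prcode re_mem re_not_mem)
  moreover have "re (\<lambda>n. truth_rule (p1 n) (p1 (p2 n)) (p2 (p2 n)))"
    unfolding truth_rule_def by (intro re_intros)
  ultimately have tt: "re truth_tab" unfolding truth_tab_def by (rule re_clo)
  show ?thesis unfolding refuted_def by (intro re_intros re_comp[OF assms] re_comp[OF tt])
qed

lemma ex_matrix1:
  assumes "re P" shows "\<exists>F. Delta0 F \<and> (\<forall>x. P x \<longleftrightarrow> (\<exists>w. rel std F [w, x]))"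
proof -
  obtain D where D: "d0 (\<lambda>e. D (e 0) (e 1))" "\<And>x. P x \<longleftrightarrow> (\<exists>w. D w x)"
    using assms unfolding re_def by (elim exE conjE) simp
  from d0_formula[OF D(1)] obtain F where "Delta0 F"
    "\<And>xs. rel std F xs \<longleftrightarrow> D (if 0 < length xs then xs ! 0 else 0) (if 1 < length xs then xs ! 1 else 0)" by blast
  then show ?thesis by (intro exI[of _ F]) (simp add: D(2))
qed

lemma ex_matrix2:
  assumes "re (\<lambda>n. P (p1 n) (p2 n))" shows "\<exists>F. Delta0 F \<and> (\<forall>x y. P x y \<longleftrightarrow> (\<exists>w. rel std F [w, x, y]))"
proof -
  obtain D where D: "d0 (\<lambda>e. D (e 0) (e 1))" "\<And>n. P (p1 n) (p2 n) \<longleftrightarrow> (\<exists>w. D w n)"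
    using assms unfolding re_def by (elim exE conjE) simp
  have "d0 (\<lambda>e. D (e 0) (pair (e 1) (e 2)))" by (intro d0_rel2[OF D(1)] d0_intros)
  from d0_formula[OF this] obtain F where "Delta0 F"
    "\<And>xs. rel std F xs \<longleftrightarrow> D (if 0 < length xs then xs ! 0 else 0)
      (pair (if 1 < length xs then xs ! 1 else 0) (if 2 < length xs then xs ! 2 else 0))" by blast
  then show ?thesis using D(2)[of "pair _ _"] by (intro exI[of _ F]) simp
qed

lemma ex_matrix3:
  assumes "re (\<lambda>n. P (p1 n) (p1 (p2 n)) (p2 (p2 n)))"
  shows "\<exists>F. Delta0 F \<and> (\<forall>x y z. P x y z \<longleftrightarrow> (\<exists>w. rel std F [w, x, y, z]))"
proof -
  obtain D where D: "d0 (\<lambda>e. D (e 0) (e 1))" "\<And>n. P (p1 n) (p1 (p2 n)) (p2 (p2 n)) \<longleftrightarrow> (\<exists>w. D w n)"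
    using assms unfolding re_def by (elim exE conjE) simp
  have "d0 (\<lambda>e. D (e 0) (pair (e 1) (pair (e 2) (e 3))))" by (intro d0_rel2[OF D(1)] d0_intros)
  from d0_formula[OF this] obtain F where "Delta0 F"
    "\<And>xs. rel std F xs \<longleftrightarrow> D (if 0 < length xs then xs ! 0 else 0)
      (pair (if 1 < length xs then xs ! 1 else 0) (pair (if 2 < length xs then xs ! 2 else 0)
        (if 3 < length xs then xs ! 3 else 0)))" by blast
  then show ?thesis using D(2)[of "pair _ (pair _ _)"] by (intro exI[of _ F]) simp
qed

lemma ex_mem_formula: "\<exists>F. Delta0 F \<and> (\<forall>y q. rel std F [y, q] \<longleftrightarrow> mem y q)"
  using d0_formula[OF d0_mem] by force

text \<open>The four matrices are specified in the standard model only. In other models of PA they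
  are controlled at numerals, through absoluteness of bounded formulas.\<close>

locale construction =
  fixes T :: "fm set" and L :: logic and thF rF eF mF :: fm
  assumes sentT: "\<forall>\<chi>\<in>T. sentence \<chi>"
    and extT: "\<forall>\<chi>. prv PA \<chi> \<longrightarrow> prv T \<chi>"
    and conT: "\<not> prv T Bot"
    and D0: "Delta0 thF" "Delta0 rF" "Delta0 eF" "Delta0 mF"
    and thF: "thm_code T x \<longleftrightarrow> (\<exists>w. rel std thF [w, x])"
    and rF: "consR T L g x y \<longleftrightarrow> (\<exists>w. rel std rF [w, g, x, y])"
    and eF: "refuted T g e \<longleftrightarrow> (\<exists>w. rel std eF [w, g, e])"
    and mF [simp]: "rel std mF [y, q] \<longleftrightarrow> mem y q"
begin

text \<open>Free variables, in order: \<open>uF(p, e, q, g)\<close> says that the set coded by \<open>q\<close> is closed at stage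
  \<open>p\<close> for the assignment \<open>e\<close>; \<open>clF(p, B, e, x, g)\<close> that \<open>x\<close> is in every closed set with code below \<open>B\<close>;
  \<open>evF(p, B, e, g)\<close> that \<open>(p, e)\<close> is an event; \<open>bdF(p, B)\<close> that every subset of \<open>{..<p}\<close> has a code below
  \<open>B\<close>, expressed inductively by adjunction of single elements; \<open>lbF\<close> that \<open>B\<close> is least with this
  property. In \<open>stF(p, B, e, g)\<close> no event precedes stage \<open>p\<close> and \<open>e\<close> is the least event at \<open>p\<close>, or \<open>0\<close>
  (the code of the empty set) if there is none. All of these are bounded formulas; the witness \<open>B\<close>
  replaces the unbounded quantifier over codes of sets.\<close>

definition uF :: fm where "uF =
  Conj (BAll (Var 0) (Imp (BEx (Var 1) (app thF [Var 0, Var 1])) (app mF [Var 0, Var 3])))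
  (Conj (BAll (Var 0) (Imp (app mF [three (Var 0), Var 2]) (app mF [Var 0, Var 3])))
    (BAll (Var 0) (BAll (Var 1) (Imp (Conj (app mF [Var 1, Var 4])
       (BEx (Var 2) (app rF [Var 0, Var 6, Var 2, Var 1]))) (app mF [Var 0, Var 4])))))"

definition clF :: fm where "clF =
  Conj (Lt (Var 3) (Var 0)) (BAll (Var 1) (Imp (app uF [Var 1, Var 3, Var 0, Var 5]) (app mF [Var 4, Var 0])))"

definition evF :: fm where "evF =
  Conj (BEx (Var 0) (app eF [Var 0, Var 4, Var 3]))
    (BAll (Var 2) (Imp (app mF [Sc (three (Var 0)), Var 3]) (Neg (app clF [Var 1, Var 2, Var 3, Var 0, Var 4]))))"

definition bdF :: fm where "bdF =
  Conj (Lt (Var 0) (Sc (Var 1)))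
  (Conj (BEx (Var 1) (BAll (Var 1) (Neg (app mF [Var 0, Var 1]))))
    (BAll (Var 1) (BAll (Var 1) (BEx (Var 3) (BAll (Var 3)
      (Iff (app mF [Var 0, Var 1]) (Or (app mF [Var 0, Var 3]) (Eq (Var 0) (Var 2)))))))))"

definition lbF :: fm where "lbF =
  Conj (app bdF [Var 0, Var 1]) (BAll (Var 1) (Neg (app bdF [Var 1, Var 0])))"

definition stF :: fm where "stF =
  Conj (app lbF [Var 0, Var 1])
  (Conj (BAll (Var 0) (BAll (Var 0) (Neg (app evF [Var 1, Var 3, Var 0, Var 5]))))
    (Or (Conj (Lt (Var 2) (Var 0)) (Conj (app evF [Var 0, Var 1, Var 2, Var 3])
           (BAll (Var 2) (Neg (app evF [Var 1, Var 2, Var 0, Var 4])))))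
        (Conj (Eq (Var 2) Zero) (BAll (Var 0) (Neg (app evF [Var 1, Var 2, Var 0, Var 4]))))))"

definition prF :: fm where "prF =
  Ex (Ex (Ex (Conj (app stF [Var 2, Var 1, Var 0, Var 4]) (app clF [Var 2, Var 1, Var 0, Var 3, Var 4]))))"

text \<open>False unless an event makes it true: at a stage without event the assignment is
  \<open>0\<close>, the code of the empty set.\<close>

definition sgF :: fm where "sgF =
  Ex (Ex (Ex (Conj (app stF [Var 2, Var 1, Var 0, Var 4]) (app mF [Sc (Sc (three (Var 3))), Var 0]))))"

text \<open>A joint parameter for both formulas, so that \<open>Pr\<close> and the
  \<open>sg j\<close> can refer to each other's codes.\<close>

definition g :: nat where "g = pair (code prF) (code sgF)"
definition Pr :: fm where "Pr = subst_fm 1 (num g) prF"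
definition sg :: "nat \<Rightarrow> fm" where "sg j = subst_fm 0 (num j) (subst_fm 1 (num g) sgF)"

lemma D0_defs: "Delta0 uF" "Delta0 clF" "Delta0 evF" "Delta0 bdF" "Delta0 lbF" "Delta0 stF"
proof -
  show u: "Delta0 uF" unfolding uF_def by (intro Delta0_connectives Delta0.intros D0)
  show c: "Delta0 clF" unfolding clF_def by (intro Delta0_connectives Delta0.intros D0 u)
  show e: "Delta0 evF" unfolding evF_def by (intro Delta0_connectives Delta0.intros D0 c)
  show b: "Delta0 bdF" unfolding bdF_def by (intro Delta0_connectives Delta0.intros D0)
  show l: "Delta0 lbF" unfolding lbF_def by (intro Delta0_connectives b)
  show "Delta0 stF" unfolding stF_def by (intro Delta0_connectives l e)
qed

lemma rel_uF: "rel M uF [p, e, q, h] \<longleftrightarrow>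
    (\<forall>y. less M y p \<longrightarrow> (\<exists>w. less M w p \<and> rel M thF [w, y]) \<longrightarrow> rel M mF [y, q]) \<and>
    (\<forall>y. less M y p \<longrightarrow> rel M mF [plus M (plus M y y) y, e] \<longrightarrow> rel M mF [y, q]) \<and>
    (\<forall>x. less M x p \<longrightarrow> (\<forall>y. less M y p \<longrightarrow>
       rel M mF [x, q] \<and> (\<exists>w. less M w p \<and> rel M rF [w, h, x, y]) \<longrightarrow> rel M mF [y, q]))"
  unfolding rel_def[of M uF] unfolding uF_def by simp

lemma rel_clF: "rel M clF [p, B, e, x, h] \<longleftrightarrow>
    less M x p \<and> (\<forall>q. less M q B \<longrightarrow> rel M uF [p, e, q, h] \<longrightarrow> rel M mF [x, q])"
  unfolding rel_def[of M clF] unfolding clF_def by simp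

lemma rel_evF: "rel M evF [p, B, e, h] \<longleftrightarrow>
    (\<exists>w. less M w p \<and> rel M eF [w, h, e]) \<and>
    (\<forall>y. less M y e \<longrightarrow> rel M mF [suc M (plus M (plus M y y) y), e] \<longrightarrow> \<not> rel M clF [p, B, e, y, h])"
  unfolding rel_def[of M evF] unfolding evF_def by simp

lemma rel_bdF: "rel M bdF [p, B] \<longleftrightarrow> less M p (suc M B) \<and>
    (\<exists>X. less M X B \<and> (\<forall>y. less M y p \<longrightarrow> \<not> rel M mF [y, X])) \<and>
    (\<forall>X. less M X B \<longrightarrow> (\<forall>a. less M a p \<longrightarrow> (\<exists>Y. less M Y B \<and>
      (\<forall>y. less M y p \<longrightarrow> (rel M mF [y, Y] \<longleftrightarrow> rel M mF [y, X] \<or> y = a)))))"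
  unfolding rel_def[of M bdF] unfolding bdF_def by simp

lemma rel_lbF: "rel M lbF [p, B] \<longleftrightarrow> rel M bdF [p, B] \<and> (\<forall>B'. less M B' B \<longrightarrow> \<not> rel M bdF [p, B'])"
  unfolding rel_def[of M lbF] unfolding lbF_def by simp

lemma rel_stF: "rel M stF [p, B, e, h] \<longleftrightarrow> rel M lbF [p, B] \<and>
    (\<forall>p'. less M p' p \<longrightarrow> (\<forall>e'. less M e' p' \<longrightarrow> \<not> rel M evF [p', B, e', h])) \<and>
    (less M e p \<and> rel M evF [p, B, e, h] \<and> (\<forall>e'. less M e' e \<longrightarrow> \<not> rel M evF [p, B, e', h]) \<or>
     e = zer M \<and> (\<forall>e'. less M e' p \<longrightarrow> \<not> rel M evF [p, B, e', h]))"
  unfolding rel_def[of M stF] unfolding stF_def by simp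

lemma rel_prF: "rel M prF [x, h] \<longleftrightarrow> (\<exists>p B e. rel M stF [p, B, e, h] \<and> rel M clF [p, B, e, x, h])"
  unfolding rel_def[of M prF] unfolding prF_def by simp

lemma rel_sgF: "rel M sgF [j, h] \<longleftrightarrow> (\<exists>p B e. rel M stF [p, B, e, h] \<and>
    rel M mF [suc M (suc M (plus M (plus M j j) j)), e])"
  unfolding rel_def[of M sgF] unfolding sgF_def by simp

lemma fv_prF: "fv prF \<subseteq> {0, 1}" and fv_sgF: "fv sgF \<subseteq> {0, 1}"
  unfolding prF_def sgF_def Ex_def Neg_def Conj_def
  using fv_app[of stF "[Var 2, Var 1, Var 0, Var 4]"] fv_app[of clF "[Var 2, Var 1, Var 0, Var 3, Var 4]"]
    fv_app[of mF "[Sc (Sc (three (Var 3))), Var 0]"]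
  by (auto simp: image_iff dest!: subsetD) 

lemma eval_Pr: "eval_fm M e (subst_fm 0 (num n) Pr) \<longleftrightarrow> rel M prF [numeral_in M n, numeral_in M g]"
  unfolding Pr_def by (rule eval_subst_num2[OF fv_prF])

lemma eval_sg: "eval_fm M e (sg n) \<longleftrightarrow> rel M sgF [numeral_in M n, numeral_in M g]"
  unfolding sg_def by (rule eval_subst_num2[OF fv_sgF])

end

context pa_model
begin

lemma abs2: "Delta0 F \<Longrightarrow> rel M F [nm a, nm b] \<longleftrightarrow> rel std F [a, b]"
  using rel_absolute[of F "[a, b]"] by simp

lemma abs3: "Delta0 F \<Longrightarrow> rel M F [nm a, nm b, nm c] \<longleftrightarrow> rel std F [a, b, c]"
  using rel_absolute[of F "[a, b, c]"] by simp

lemma abs4: "Delta0 F \<Longrightarrow> rel M F [nm a, nm b, nm c, nm d] \<longleftrightarrow> rel std F [a, b, c, d]"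
  using rel_absolute[of F "[a, b, c, d]"] by simp

lemma abs5: "Delta0 F \<Longrightarrow> rel M F [nm a, nm b, nm c, nm d, nm e] \<longleftrightarrow> rel std F [a, b, c, d, e]"
  using rel_absolute[of F "[a, b, c, d, e]"] by simp

lemma three_nm: "plus M (plus M (nm x) (nm x)) (nm x) = nm (x + x + x)"
  by (simp add: plus_nm)

end

context construction
begin

section \<open>Meaning of the bounded formulas in the standard model\<close>

definition th :: "nat \<Rightarrow> nat \<Rightarrow> bool" where "th p x \<longleftrightarrow> (\<exists>w<p. rel std thF [w, x])"
definition rr :: "nat \<Rightarrow> nat \<Rightarrow> nat \<Rightarrow> bool" where "rr p x y \<longleftrightarrow> (\<exists>w<p. rel std rF [w, g, x, y])"
definition ev0 :: "nat \<Rightarrow> nat \<Rightarrow> bool" where "ev0 p e \<longleftrightarrow> (\<exists>w<p. rel std eF [w, g, e])"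

text \<open>The closure that \<open>clF\<close> expresses in the standard model once
  \<open>B\<close> is large enough. Restriction to numbers below \<open>p\<close> makes it finite
  and hence codable.\<close>

inductive cl :: "nat \<Rightarrow> nat \<Rightarrow> nat \<Rightarrow> bool" for p e where
  cl_th: "x < p \<Longrightarrow> th p x \<Longrightarrow> cl p e x"
| cl_pos: "x < p \<Longrightarrow> mem (x + x + x) e \<Longrightarrow> cl p e x"
| cl_rr: "cl p e x \<Longrightarrow> y < p \<Longrightarrow> rr p x y \<Longrightarrow> cl p e y"

definition sev :: "nat \<Rightarrow> nat \<Rightarrow> bool" where
  "sev p e \<longleftrightarrow> ev0 p e \<and> (\<forall>y<e. mem (Suc (y + y + y)) e \<longrightarrow> \<not> cl p e y)"

text \<open>Codes are compared below \<open>p\<close> only: a code may have larger members, which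
  \<open>uF\<close> at stage \<open>p\<close> does not inspect.\<close>

definition full :: "nat \<Rightarrow> nat \<Rightarrow> bool" where
  "full B p \<longleftrightarrow> (\<forall>S\<subseteq>{..<p}. \<exists>q<B. \<forall>y<p. mem y q \<longleftrightarrow> y \<in> S)"

lemma cl_less: "cl p e x \<Longrightarrow> x < p"
  by (induction rule: cl.induct) auto

lemma th_mono: "th p x \<Longrightarrow> p \<le> p' \<Longrightarrow> th p' x"
  unfolding th_def using less_le_trans by blast

lemma rr_mono: "rr p x y \<Longrightarrow> p \<le> p' \<Longrightarrow> rr p' x y"
  unfolding rr_def using less_le_trans by blast

text \<open>For the assignment \<open>0\<close> the clause \<open>cl_pos\<close> never fires, so
  what was derived survives a later stage and any new assignment.\<close>

lemma cl_mono: "cl p 0 x \<Longrightarrow> p \<le> p' \<Longrightarrow> cl p' e x"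
proof (induction rule: cl.induct)
  case (cl_rr x y)
  then show ?case using cl.cl_rr[of p' e x y] rr_mono by simp
qed (auto intro: cl_th th_mono)

lemma full_mono: "full B p \<Longrightarrow> p' \<le> p \<Longrightarrow> full B p'"
  unfolding full_def
proof (intro allI impI)
  fix S assume a: "\<forall>S\<subseteq>{..<p}. \<exists>q<B. \<forall>y<p. mem y q \<longleftrightarrow> y \<in> S" "p' \<le> p" "S \<subseteq> {..<p'}"
  then have "S \<subseteq> {..<p}" by (auto intro: less_le_trans)
  from a(1)[THEN spec, THEN HOL.mp, OF this] obtain q where q: "q < B" "\<forall>y<p. mem y q \<longleftrightarrow> y \<in> S"
    by (elim exE conjE)
  show "\<exists>q<B. \<forall>y<p'. mem y q \<longleftrightarrow> y \<in> S" by (rule exI[of _ q]) (use q a(2) in auto)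
qed

lemma bdF_full: "rel std bdF [p, B] \<Longrightarrow> full B p"
  unfolding full_def
proof (intro allI impI)
  fix S assume bd: "rel std bdF [p, B]" and S: "S \<subseteq> {..<p}"
  then have "finite S" by (meson finite_lessThan finite_subset)
  then show "\<exists>q<B. \<forall>y<p. mem y q \<longleftrightarrow> y \<in> S"
    using S
  proof (induction S)
    case empty
    then show ?case using bd by (auto simp: rel_bdF)
  next
    case (insert a S)
    then obtain q where q: "q < B" "\<forall>y<p. mem y q \<longleftrightarrow> y \<in> S" "a < p" by auto
    from bd have "\<forall>X<B. \<forall>a<p. \<exists>Y<B. \<forall>y<p. mem y Y \<longleftrightarrow> mem y X \<or> y = a" by (simp add: rel_bdF)
    then obtain Y where "Y < B" "\<forall>y<p. mem y Y \<longleftrightarrow> mem y q \<or> y = a" using q(1,3) by blast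
    then show ?case using q(2) by (intro exI[of _ Y]) auto
  qed
qed

lemma ex_bdF: "\<exists>B. rel std bdF [p, B]"
proof -
  have "\<forall>S\<in>Pow {..<p}. \<exists>q. \<forall>y. mem y q \<longleftrightarrow> y \<in> S"
    using ex_mem_code finite_subset by blast
  then obtain c where c: "\<And>S y. S \<subseteq> {..<p} \<Longrightarrow> mem y (c S) \<longleftrightarrow> y \<in> S" by (metis PowI)
  obtain n where n: "\<forall>q\<in>c ` Pow {..<p}. q < n"
    using finite_nat_set_iff_bounded[of "c ` Pow {..<p}"] by auto
  have cn: "c S < n + p" if "S \<subseteq> {..<p}" for S
    using bspec[OF n, of "c S"] that by auto
  have "\<exists>Y<n + p. \<forall>y<p. mem y Y \<longleftrightarrow> mem y X \<or> y = a" for X a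
    using cn[of "{y. y < p \<and> (mem y X \<or> y = a)}"] c[of "{y. y < p \<and> (mem y X \<or> y = a)}"]
    by (intro exI[of _ "c {y. y < p \<and> (mem y X \<or> y = a)}"]) auto
  moreover have "\<exists>X<n + p. \<forall>y<p. \<not> mem y X"
    using cn[of "{}"] c[of "{}"] by (intro exI[of _ "c {}"]) auto
  ultimately show ?thesis by (intro exI[of _ "n + p"]) (simp add: rel_bdF)
qed

lemma ex_lbF: "\<exists>B. rel std lbF [p, B]"
proof -
  define B where "B = (LEAST B. rel std bdF [p, B])"
  have "rel std bdF [p, B]" unfolding B_def using ex_bdF by (rule LeastI_ex)
  moreover have "\<not> rel std bdF [p, B']" if "B' < B" for B'
    using not_less_Least that unfolding B_def by blast
  ultimately show ?thesis by (auto simp: rel_lbF)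
qed

lemma lbF_full: "rel std lbF [p, B] \<Longrightarrow> full B p"
  using bdF_full by (simp add: rel_lbF)

lemma std_uF: "rel std uF [p, e, q, g] \<longleftrightarrow>
    (\<forall>y<p. th p y \<longrightarrow> mem y q) \<and> (\<forall>y<p. mem (y + y + y) e \<longrightarrow> mem y q) \<and>
    (\<forall>x<p. \<forall>y<p. mem x q \<and> rr p x y \<longrightarrow> mem y q)"
  by (simp add: rel_uF th_def rr_def)

lemma uF_cl:
  assumes u: "rel std uF [p, e, q, g]" and "cl p e x"
  shows "mem x q"
  using assms(2)
proof induction
  case (cl_th x)
  then show ?case using u by (simp add: std_uF)
next
  case (cl_pos x)
  then show ?case using u by (simp add: std_uF)
next
  case (cl_rr x y)
  then show ?case using u cl_less[of p e x] unfolding std_uF by blast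
qed

lemma cl_uF:
  assumes "\<forall>y<p. mem y q \<longleftrightarrow> cl p e y" shows "rel std uF [p, e, q, g]"
  unfolding std_uF
proof (intro conjI allI impI)
  fix y assume "y < p" "th p y"
  then show "mem y q" using assms cl_th by blast
next
  fix y assume "y < p" "mem (y + y + y) e"
  then show "mem y q" using assms cl_pos by blast
next
  fix x y assume "x < p" "y < p" "mem x q \<and> rr p x y"
  then show "mem y q" using assms cl_rr by blast
qed

text \<open>With \<open>B\<close> large enough the closure itself is among the closed sets being
  intersected, so the intersection is no larger; conversely every closed set contains the
  closure.\<close>

lemma std_clF:
  assumes "full B p" shows "rel std clF [p, B, e, x, g] \<longleftrightarrow> cl p e x"
proof
  assume a: "rel std clF [p, B, e, x, g]"
  have "{y. cl p e y} \<subseteq> {..<p}" using cl_less by auto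
  from assms[unfolded full_def, THEN spec, THEN HOL.mp, OF this]
  obtain q where q: "q < B" "\<forall>y<p. mem y q \<longleftrightarrow> cl p e y" unfolding mem_Collect_eq by (elim exE conjE)
  from a have "x < p" "\<forall>q<B. rel std uF [p, e, q, g] \<longrightarrow> mem x q" by (simp_all add: rel_clF)
  then show "cl p e x" using cl_uF[OF q(2)] q by blast
next
  assume "cl p e x"
  then show "rel std clF [p, B, e, x, g]" using cl_less uF_cl[of p e _ x] by (simp add: rel_clF)
qed

lemma std_evF: "full B p \<Longrightarrow> rel std evF [p, B, e, g] \<longleftrightarrow> sev p e"
  by (simp add: rel_evF std_clF sev_def ev0_def)

text \<open>Leastness of \<open>B\<close> acts here: a suitable standard bound exists, so a
  nonstandard one would not be least. For \<open>e\<close> only values below the stage, or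
  \<open>0\<close>, are possible.\<close>

lemma stF_standard:
  assumes "pa_model M" and st: "rel M stF [numeral_in M p, B, e, numeral_in M g]"
  shows "\<exists>B' e'. B = numeral_in M B' \<and> e = numeral_in M e' \<and> rel std stF [p, B', e', g]"
proof -
  interpret pa_model M by (rule assms(1))
  obtain B0 where B0: "rel std lbF [p, B0]" using ex_lbF by blast
  have "B \<in> range nm"
  proof (rule ccontr)
    assume "B \<notin> range nm"
    then have "less M (nm B0) B" by (rule nonstandard_greater)
    moreover have "rel M bdF [nm p, nm B0]" using B0 by (simp add: abs2 D0_defs rel_lbF)
    ultimately show False using st by (simp add: rel_stF rel_lbF)
  qed
  moreover have "e \<in> range nm"
  proof -
    from st have "less M e (nm p) \<or> e = zer M" by (auto simp: rel_stF)
    then show ?thesis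
    proof
      assume "less M e (nm p)"
      from less_nm_imp[OF this] show ?thesis by auto
    next
      assume "e = zer M"
      then have "e = nm 0" by simp
      then show ?thesis by (rule range_eqI)
    qed
  qed
  ultimately obtain B' e' where "B = nm B'" "e = nm e'" by blast
  then show ?thesis using st abs4[OF D0_defs(6)] by auto
qed

lemma std_stF_full: "rel std stF [p, B, e, g] \<Longrightarrow> full B p"
  by (simp add: rel_stF lbF_full)

lemma std_stF: "full B p \<Longrightarrow> rel std stF [p, B, e, g] \<longleftrightarrow> rel std lbF [p, B] \<and>
    (\<forall>p'<p. \<forall>e'<p'. \<not> sev p' e') \<and>
    (e < p \<and> sev p e \<and> (\<forall>e'<e. \<not> sev p e') \<or> e = 0 \<and> (\<forall>e'<p. \<not> sev p e'))"
proof -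
  assume f: "full B p"
  have "rel std evF [p', B, e', g] \<longleftrightarrow> sev p' e'" if "p' < p" for p' e'
    using std_evF[OF full_mono[OF f]] that by simp
  then show ?thesis by (simp add: rel_stF std_evF[OF f])
qed

lemma std_prF_D: "rel std prF [x, g] \<Longrightarrow> \<exists>p B e. full B p \<and> rel std stF [p, B, e, g] \<and> cl p e x"
proof -
  assume "rel std prF [x, g]"
  then obtain p B e where st: "rel std stF [p, B, e, g]" "rel std clF [p, B, e, x, g]"
    unfolding rel_prF by (elim exE conjE)
  then show ?thesis using std_stF_full[OF st(1)] std_clF by metis
qed

lemma std_prF_I: "rel std stF [p, B, e, g] \<Longrightarrow> cl p e x \<Longrightarrow> rel std prF [x, g]"
  unfolding rel_prF using std_clF[OF std_stF_full] by metis

lemma Sigma1_Pr: "Sigma1 Pr" "Sigma1 (subst_fm 0 (num n) Pr)" "Sigma1 (sg n)"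
proof -
  have "Sigma1 prF" "Sigma1 sgF" unfolding prF_def sgF_def
    by (intro Sigma1.intros Delta0_connectives D0_defs D0)+
  then show "Sigma1 Pr" "Sigma1 (subst_fm 0 (num n) Pr)" "Sigma1 (sg n)"
    unfolding Pr_def sg_def subst_fm_ssubst by (simp_all add: Sigma1_ssubst)
qed

lemma fv_num [simp]: "fv_trm (num n) = {}"
  by (induction n) auto

lemma fv_Pr: "fv Pr \<subseteq> {0}"
proof
  fix j assume "j \<in> fv Pr"
  then obtain i where "i \<in> fv prF" "j \<in> fv_trm (if i < 1 then Var i else if i = 1 then num g else Var (i - 1))"
    unfolding Pr_def subst_fm_ssubst using fv_ssubst_fm by blast
  then show "j \<in> {0}" using fv_prF by (auto split: if_splits)
qed

lemma sentence_subst_0: "fv \<phi> \<subseteq> {0} \<Longrightarrow> sentence (subst_fm 0 (num n) \<phi>)"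
  unfolding sentence_def subst_fm_ssubst using fv_ssubst_fm[of _ \<phi>] by fastforce

lemma sentence_Pr: "sentence (subst_fm 0 (num n) Pr)"
  using fv_Pr by (rule sentence_subst_0)

lemma sentence_sg: "sentence (sg n)"
proof -
  have "fv (subst_fm 1 (num g) sgF) \<subseteq> {0}"
  proof
    fix j assume "j \<in> fv (subst_fm 1 (num g) sgF)"
    then obtain i where "i \<in> fv sgF" "j \<in> fv_trm (if i < 1 then Var i else if i = 1 then num g else Var (i - 1))"
      unfolding subst_fm_ssubst using fv_ssubst_fm by blast
    then show "j \<in> {0}" using fv_sgF by (auto split: if_splits)
  qed
  then show ?thesis unfolding sg_def by (rule sentence_subst_0)
qed

lemma prv_Pr_iff: "prv PA (subst_fm 0 (num n) Pr) \<longleftrightarrow> rel std prF [n, g]"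
  using Sigma1_complete[OF Sigma1_Pr(2) sentence_Pr, of n "\<lambda>_. 0"] by (simp add: eval_Pr)

lemma rel_prF_up: "pa_model M \<Longrightarrow> rel std prF [n, g] \<Longrightarrow> rel M prF [numeral_in M n, numeral_in M g]"
  using prv_Pr_iff soundness eval_Pr pa_model.models_PA by metis

lemma prcode_Pr: "prcode (p1 g) g x y \<longleftrightarrow> y = code (subst_fm 0 (num x) Pr)"
  unfolding Pr_def by (simp add: g_def prcode)

lemma prcode_sg: "prcode (p2 g) g x y \<longleftrightarrow> y = code (sg x)"
  unfolding sg_def by (simp add: g_def prcode)

lemma T_model_PA: "models M T \<Longrightarrow> pa_model M"
proof (unfold_locales, unfold models_def, intro ballI allI)
  fix \<chi> e assume "\<forall>\<chi>\<in>T. \<forall>e. eval_fm M e \<chi>" "\<chi> \<in> PA"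
  then show "eval_fm M e \<chi>" using soundness[of T \<chi> M] extT prv.ax[of \<chi> PA] unfolding models_def by blast
qed

lemma ex_T_model: "\<exists>M :: nat struct. models M T"
  using completeness_PA_ext[OF sentT extT, of Bot] conT by auto

end

section \<open>Absence of events\<close>

context construction
begin

text \<open>The least event must be true in a model \<open>M\<close> of \<open>T\<close>. The work
  lies in showing that \<open>Pr\<close> and the \<open>sg j\<close> have the same truth values at
  numerals in \<open>M\<close> as in the standard model, which amounts to excluding nonstandard
  stages.\<close>

lemma no_event: "e < p \<Longrightarrow> \<not> sev p e"
proof
  assume "e < p" "sev p e"
  then have ex: "\<exists>p. \<exists>e<p. sev p e" by blast
  define p0 where "p0 = (LEAST p. \<exists>e<p. sev p e)"
  have "\<exists>e<p0. sev p0 e" unfolding p0_def using ex by (rule LeastI_ex)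
  then have ex0: "\<exists>e. e < p0 \<and> sev p0 e" by blast
  define e0 where "e0 = (LEAST e. e < p0 \<and> sev p0 e)"
  have e0: "e0 < p0" "sev p0 e0" using LeastI_ex[OF ex0] by (simp_all add: e0_def)
  have min_p: "\<not> sev p e" if "p < p0" "e < p" for p e
    using not_less_Least[OF that(1)[unfolded p0_def]] that(2) by blast
  have min_e: "\<not> sev p0 e" if "e < e0" for e
    using not_less_Least[OF that[unfolded e0_def]] that e0(1) by auto
  obtain B0 where B0: "rel std lbF [p0, B0]" using ex_lbF by blast
  have st0: "rel std stF [p0, B0, e0, g]"
    unfolding std_stF[OF lbF_full[OF B0]] using B0 e0 min_p min_e by blast
  have st_cases: "p < p0 \<and> e = 0 \<or> p = p0 \<and> e = e0" if "rel std stF [p, B, e, g]" for p B e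
  proof -
    from that have *: "\<forall>p'<p. \<forall>e'<p'. \<not> sev p' e'"
      "e < p \<and> sev p e \<and> (\<forall>e'<e. \<not> sev p e') \<or> e = 0 \<and> (\<forall>e'<p. \<not> sev p e')"
      unfolding std_stF[OF std_stF_full[OF that]] by blast+
    have "\<not> p0 < p" using *(1) e0 by blast
    then consider "p < p0" | "p = p0" by linarith
    then show ?thesis
    proof cases
      case 1
      then show ?thesis using *(2) min_p by blast
    next
      case 2
      have "e = e0" using *(2) e0 min_e 2 by (metis linorder_neqE_nat)
      then show ?thesis using 2 by simp
    qed
  qed
  obtain M :: "nat struct" where M: "models M T" using ex_T_model by blast
  then have paM: "pa_model M" by (rule T_model_PA)
  interpret pa_model M by (rule paM)
  \<comment> \<open>The standard event is still an event in \<open>M\<close> when computed with any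
    nonstandard bound, so it blocks all nonstandard stages, the only ones at which \<open>M\<close>
    could add something new.\<close>
  have st_std: "p \<in> range nm" if st: "rel M stF [p, B, e, nm g]" for p B e
  proof (rule ccontr)
    assume p: "p \<notin> range nm"
    from st have lb: "less M p (suc M B)" and
      nev: "\<forall>p'. less M p' p \<longrightarrow> (\<forall>e'. less M e' p' \<longrightarrow> \<not> rel M evF [p', B, e', nm g])"
      by (simp_all add: rel_stF rel_lbF rel_bdF)
    \<comment> \<open>The conjunct of \<open>bdF\<close> saying that \<open>p\<close> is at most
      \<open>B\<close> makes the bound of a nonstandard stage nonstandard.\<close>
    have B: "B \<notin> range nm"
    proof
      assume "B \<in> range nm"
      then obtain b where "B = nm b" by blast
      then have "less M p (nm (Suc b))" using lb by simp
      from less_nm_imp[OF this] show False using p by blast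
    qed
    \<comment> \<open>The true closure has a standard code, hence one below \<open>B\<close>. Being
      closed and free of the negative part of \<open>e0\<close>, it keeps that part out of
      \<open>clF\<close> in \<open>M\<close>.\<close>
    have "finite {y. cl p0 e0 y}"
      by (rule finite_subset[OF _ finite_lessThan[of p0]]) (auto dest: cl_less)
    from ex_mem_code[OF this] obtain q where q: "\<forall>y. mem y q \<longleftrightarrow> y \<in> {y. cl p0 e0 y}" ..
    have u: "rel M uF [nm p0, nm e0, nm q, nm g]"
      using cl_uF[of p0 q e0] q by (simp add: abs4 D0_defs)
    have "rel M evF [nm p0, B, nm e0, nm g]"
      unfolding rel_evF
    proof (intro conjI allI impI)
      obtain w where "w < p0" "rel std eF [w, g, e0]" using e0(2) unfolding sev_def ev0_def by blast
      then show "\<exists>w. less M w (nm p0) \<and> rel M eF [w, nm g, nm e0]"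
        by (intro exI[of _ "nm w"]) (simp add: less_nm_nm abs3 D0)
    next
      fix y assume y: "less M y (nm e0)" "rel M mF [suc M (plus M (plus M y y) y), nm e0]"
      from less_nm_imp[OF y(1)] obtain k where k: "k < e0" "y = nm k" by blast
      have "rel M mF [nm (Suc (k + k + k)), nm e0]" using y(2) k(2) by (simp add: three_nm)
      then have "mem (Suc (k + k + k)) e0" by (simp only: abs2 D0 mF)
      then have "\<not> cl p0 e0 k" using e0(2) k(1) by (simp add: sev_def)
      then have "\<not> rel M mF [nm k, nm q]" using q by (simp add: abs2 D0)
      moreover have "less M (nm q) B" using B by (rule nonstandard_greater)
      ultimately show "\<not> rel M clF [nm p0, B, nm e0, y, nm g]"
        unfolding rel_clF k(2) using u by blast
    qed
    moreover have "less M (nm p0) p" "less M (nm e0) (nm p0)"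
      using nonstandard_greater[OF p] e0(1) by (simp_all add: less_nm_nm)
    ultimately show False using nev by blast
  qed
  have prM: "rel M prF [nm x, nm g] \<longleftrightarrow> rel std prF [x, g]" for x
  proof
    assume "rel M prF [nm x, nm g]"
    then obtain p B e where st: "rel M stF [p, B, e, nm g]" "rel M clF [p, B, e, nm x, nm g]"
      unfolding rel_prF by (elim exE conjE)
    from st_std[OF st(1)] obtain p' where p': "p = nm p'" by blast
    from stF_standard[OF paM st(1)[unfolded p']] obtain B' e' where
      be: "B = nm B'" "e = nm e'" "rel std stF [p', B', e', g]" by blast
    have "rel std clF [p', B', e', x, g]" using st(2) unfolding p' be by (simp add: abs5 D0_defs)
    then show "rel std prF [x, g]" using be(3) unfolding rel_prF by blast
  qed (rule rel_prF_up[OF paM])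
  have sgM: "rel M sgF [nm j, nm g] \<longleftrightarrow> mem (Suc (Suc (j + j + j))) e0" for j
  proof
    assume "rel M sgF [nm j, nm g]"
    then obtain p B e where st: "rel M stF [p, B, e, nm g]"
        and m: "rel M mF [suc M (suc M (plus M (plus M (nm j) (nm j)) (nm j))), e]"
      unfolding rel_sgF by (elim exE conjE)
    from st_std[OF st] obtain p' where p': "p = nm p'" by blast
    from stF_standard[OF paM st[unfolded p']] obtain B' e' where
      be: "B = nm B'" "e = nm e'" "rel std stF [p', B', e', g]" by blast
    have "rel M mF [nm (Suc (Suc (j + j + j))), nm e']" using m be(2) by (simp add: three_nm)
    then have "mem (Suc (Suc (j + j + j))) e'" by (simp only: abs2 D0 mF)
    then show "mem (Suc (Suc (j + j + j))) e0" using st_cases[OF be(3)] by auto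
  next
    assume "mem (Suc (Suc (j + j + j))) e0"
    then have "rel M mF [nm (Suc (Suc (j + j + j))), nm e0]" by (simp only: abs2 D0 mF)
    then have "rel M mF [suc M (suc M (plus M (plus M (nm j) (nm j)) (nm j))), nm e0]"
      by (simp add: three_nm)
    moreover have "rel M stF [nm p0, nm B0, nm e0, nm g]" using st0 by (simp add: abs4 D0_defs)
    ultimately show "rel M sgF [nm j, nm g]" unfolding rel_sgF by blast
  qed
  have pos: "rel std prF [x, g]" if "mem (x + x + x) e0" for x
  proof (rule std_prF_I[OF st0])
    \<comment> \<open>Elements lie below their code, so \<open>x + x + x < e0 < p0\<close>.\<close>
    have "x < p0" using mem_less[OF that] e0(1) by simp
    then show "cl p0 e0 x" using that by (rule cl_pos)
  qed
  \<comment> \<open>Stages before the event carry the assignment \<open>0\<close>, and their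
    closures are contained in the closure at the event, which avoids \<open>x\<close>.\<close>
  have neg: "\<not> rel std prF [x, g]" if m: "mem (Suc (x + x + x)) e0" for x
  proof
    assume "rel std prF [x, g]"
    from std_prF_D[OF this] obtain p B e where st: "rel std stF [p, B, e, g]" "cl p e x" by blast
    have "cl p0 e0 x" using st_cases[OF st(1)] st(2) cl_mono[of p x p0 e0] by auto
    moreover have "x < e0" using mem_less[OF m] by simp
    ultimately show False using e0(2) m unfolding sev_def by blast
  qed
  \<comment> \<open>The truth value \<open>b\<close> computed from \<open>e0\<close> is correct in
    \<open>M\<close> for the formula with code \<open>y\<close>. It is asserted for all valuations,
    the formulas in question being combinations of sentences.\<close>
  define Q where "Q b y \<longleftrightarrow> (\<exists>\<chi>. y = code \<chi> \<and>
    (b = 1 \<and> (\<forall>e. eval_fm M e \<chi>) \<or> b = 0 \<and> (\<forall>e. \<not> eval_fm M e \<chi>)))" for b y :: nat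
  have truth: "clo truth_base truth_rule n \<Longrightarrow> \<forall>b y. n = pair g (pair e0 (pair b y)) \<longrightarrow> Q b y" for n
  proof (induction rule: clo.induct)
    case (clo_base n)
    show ?case
    proof (intro allI impI)
      fix b y assume n: "n = pair g (pair e0 (pair b y))"
      from clo_base consider
          "b = 0" "y = code (Eq Zero (Sc Zero))"
        | x where "prcode (p1 g) g x y" "mem (x + x + x) e0" "b = 1"
        | x where "prcode (p1 g) g x y" "mem (Suc (x + x + x)) e0" "b = 0"
        | x where "prcode (p2 g) g x y" "mem (Suc (Suc (x + x + x))) e0" "b = 1"
        | x where "prcode (p2 g) g x y" "\<not> mem (Suc (Suc (x + x + x))) e0" "b = 0"
        unfolding truth_base_def n by auto
      then show "Q b y"
      proof cases
        case 1
        have "\<not> eval_fm M e (Eq Zero (Sc Zero))" for e using suc_nonzero[of "zer M"] by simp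
        then show ?thesis unfolding Q_def 1 by blast
      next
        case (2 x)
        then have "\<forall>e. eval_fm M e (subst_fm 0 (num x) Pr)" using pos by (simp add: eval_Pr prM)
        then show ?thesis unfolding Q_def using 2 prcode_Pr by blast
      next
        case (3 x)
        then have "\<forall>e. \<not> eval_fm M e (subst_fm 0 (num x) Pr)" using neg by (simp add: eval_Pr prM)
        then show ?thesis unfolding Q_def using 3 prcode_Pr by blast
      next
        case (4 x)
        then have "\<forall>e. eval_fm M e (sg x)" by (simp add: eval_sg sgM)
        then show ?thesis unfolding Q_def using 4 prcode_sg by blast
      next
        case (5 x)
        then have "\<forall>e. \<not> eval_fm M e (sg x)" by (simp add: eval_sg sgM)
        then show ?thesis unfolding Q_def using 5 prcode_sg by blast
      qed
    qed
  next
    case (clo_rule a b n)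
    show ?case
    proof (intro allI impI)
      fix c y assume n: "n = pair g (pair e0 (pair c y))"
      from clo_rule.hyps n obtain i x j x' where ab: "a = pair g (pair e0 (pair i x))" "b = pair g (pair e0 (pair j x'))"
        and y: "y = c_imp x x'" "i = 1 \<and> j = 0 \<and> c = 0 \<or> (i = 0 \<or> j = 1) \<and> c = 1"
        unfolding truth_rule_def by auto
      have "Q i x" "Q j x'" using clo_rule.IH ab by simp_all
      then obtain \<phi> \<psi> where \<phi>: "x = code \<phi>" "i = 1 \<and> (\<forall>e. eval_fm M e \<phi>) \<or> i = 0 \<and> (\<forall>e. \<not> eval_fm M e \<phi>)"
        and \<psi>: "x' = code \<psi>" "j = 1 \<and> (\<forall>e. eval_fm M e \<psi>) \<or> j = 0 \<and> (\<forall>e. \<not> eval_fm M e \<psi>)"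
        unfolding Q_def by blast
      have "y = code (Imp \<phi> \<psi>)" using y(1) \<phi>(1) \<psi>(1) by simp
      moreover have "c = 1 \<and> (\<forall>e. eval_fm M e (Imp \<phi> \<psi>)) \<or> c = 0 \<and> (\<forall>e. \<not> eval_fm M e (Imp \<phi> \<psi>))"
        using y(2) \<phi>(2) \<psi>(2) by auto
      ultimately show "Q c y" unfolding Q_def by blast
    qed
  qed
  have "refuted T g e0" using e0(2) eF unfolding sev_def ev0_def by blast
  then obtain y where y: "thm_code T y" "clo truth_base truth_rule (pair g (pair e0 (pair 0 y)))"
    unfolding refuted_def truth_tab_def by blast
  have "Q 0 y" using truth[OF y(2)] by simp
  then obtain \<chi> where "y = code \<chi>" "\<forall>e. \<not> eval_fm M e \<chi>" unfolding Q_def by auto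
  moreover have "prv T \<chi>" using y(1) \<open>y = code \<chi>\<close> by (auto simp: thm_code_def)
  ultimately show False using soundness[OF _ M] by blast
qed

text \<open>Without events every \<open>p\<close> is a stage, and its assignment is
  \<open>0\<close>.\<close>

lemma std_prF: "rel std prF [x, g] \<longleftrightarrow> (\<exists>p. cl p 0 x)"
proof
  assume "rel std prF [x, g]"
  from std_prF_D[OF this] obtain p B e where *: "full B p" "rel std stF [p, B, e, g]" "cl p e x" by blast
  then have "e = 0" using no_event unfolding std_stF[OF *(1)] by blast
  then show "\<exists>p. cl p 0 x" using *(3) by blast
next
  assume "\<exists>p. cl p 0 x"
  then obtain p where p: "cl p 0 x" by blast
  obtain B where B: "rel std lbF [p, B]" using ex_lbF by blast
  have "rel std stF [p, B, 0, g]" unfolding std_stF[OF lbF_full[OF B]] using B no_event by auto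
  then show "rel std prF [x, g]" using p by (rule std_prF_I)
qed

lemma thm_prF: "thm_code T x \<Longrightarrow> rel std prF [x, g]"
proof -
  assume "thm_code T x"
  then obtain w where "rel std thF [w, x]" using thF by blast
  then have "th (Suc (w + x)) x" unfolding th_def by (intro exI[of _ w]) simp
  then have "cl (Suc (w + x)) 0 x" by (intro cl_th) simp_all
  then show ?thesis unfolding std_prF by blast
qed

lemma prF_consR:
  assumes paM: "pa_model M" and R: "consR T L g x y"
    and x: "rel M prF [numeral_in M x, numeral_in M g]"
  shows "rel M prF [numeral_in M y, numeral_in M g]"
proof -
  interpret pa_model M by (rule paM)
  obtain w where w: "rel std rF [w, g, x, y]" using R rF by blast
  obtain p B e where st: "rel M stF [p, B, e, nm g]" and cl: "rel M clF [p, B, e, nm x, nm g]"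
    using x unfolding rel_prF by (elim exE conjE)
  show ?thesis
  proof (cases "p \<in> range nm")
    case True
    then obtain p' where p': "p = nm p'" by blast
    from stF_standard[OF paM st[unfolded p']] obtain B' e' where
      be: "B = nm B'" "e = nm e'" "rel std stF [p', B', e', g]" by blast
    have "rel std clF [p', B', e', x, g]" using cl unfolding p' be by (simp add: abs5 D0_defs)
    then have "rel std prF [x, g]" using be(3) unfolding rel_prF by blast
    then obtain p1 where "cl p1 0 x" unfolding std_prF by blast
    \<comment> \<open>The given stage may be too small for \<open>y\<close> or for the witness
      \<open>w\<close> of the rule. A larger stage is taken in the standard model, and the resulting
      true \<Sigma>1 sentence is carried back to \<open>M\<close>.\<close>
    then have "cl (p1 + Suc (w + y)) 0 x" by (rule cl_mono) simp
    moreover have "rr (p1 + Suc (w + y)) x y" unfolding rr_def using w by (intro exI[of _ w]) simp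
    ultimately have "cl (p1 + Suc (w + y)) 0 y" by (intro cl_rr[of _ 0 x y]) simp_all
    then have "rel std prF [y, g]" unfolding std_prF by blast
    then show ?thesis by (rule rel_prF_up[OF paM])
  next
    case False
    note gt = nonstandard_greater[OF False]
    have "rel M rF [nm w, nm g, nm x, nm y]" using w by (simp add: abs4 D0)
    then have rw: "\<exists>w. less M w p \<and> rel M rF [w, nm g, nm x, nm y]" using gt by blast
    \<comment> \<open>Each closed set below \<open>B\<close> that contains \<open>x\<close> also
      contains \<open>y\<close>, because the rule instance and its witness are standard and so below
      \<open>p\<close>. Membership in the intersection thus passes from \<open>x\<close> to
      \<open>y\<close>.\<close>
    have "rel M clF [p, B, e, nm y, nm g]"
      unfolding rel_clF
    proof (intro conjI allI impI gt)
      fix q assume q: "less M q B" "rel M uF [p, e, q, nm g]"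
      then have "rel M mF [nm x, q]" using cl unfolding rel_clF by blast
      then show "rel M mF [nm y, q]" using q(2) rw gt unfolding rel_uF by blast
    qed
    then show ?thesis using st unfolding rel_prF by blast
  qed
qed

lemma thm_code_Imp: "thm_code T (c_imp (code \<phi>) (code \<psi>)) \<longleftrightarrow> prv T (Imp \<phi> \<psi>)"
  unfolding thm_code_def by (metis code.simps(4) code_eq_iff)

lemma thm_code_code: "thm_code T (code \<phi>) \<longleftrightarrow> prv T \<phi>"
  unfolding thm_code_def by (metis code_eq_iff)

lemma thm_code_c_imp: "thm_code T (c_imp x y) \<Longrightarrow> \<exists>\<phi> \<psi>. x = code \<phi> \<and> y = code \<psi> \<and> prv T (Imp \<phi> \<psi>)"
proof -
  assume "thm_code T (c_imp x y)"
  then obtain \<chi> where \<chi>: "code \<chi> = c_imp x y" "prv T \<chi>" unfolding thm_code_def by metis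
  then show ?thesis by (cases \<chi>) auto
qed

lemma prv_Pr_T: "rel std prF [x, g] \<Longrightarrow> prv T (subst_fm 0 (num x) Pr)"
  using prv_Pr_iff extT by blast

text \<open>Under the extra MNF rule the new element is the sentence \<open>Pr(x)\<close>, which is
  a true \<Sigma>1 sentence and hence a theorem of \<open>T\<close>.\<close>

lemma cl_thm: "cl p 0 x \<Longrightarrow> thm_code T x"
proof (induction rule: cl.induct)
  case (cl_th x)
  then show ?case using thF unfolding th_def by blast
next
  case (cl_pos x)
  then show ?case by simp
next
  case (cl_rr x y)
  then have "consR T L g x y" using rF unfolding rr_def by blast
  then consider "thm_code T (c_imp x y)" | "y = code (subst_fm 0 (num x) Pr)"
    unfolding consR_def prcode_Pr by blast
  then show ?case
  proof cases
    case 1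
    from thm_code_c_imp[OF this] obtain \<phi> \<psi> where "x = code \<phi>" "y = code \<psi>" "prv T (Imp \<phi> \<psi>)" by blast
    then show ?thesis using cl_rr.IH thm_code_code prv.mp by metis
  next
    case 2
    have "rel std prF [x, g]" using cl_rr.hyps(1) std_prF by blast
    then show ?thesis using prv_Pr_T 2 thm_code_code by blast
  qed
qed

lemma prov_pred_Pr: "prov_pred T Pr"
  unfolding prov_pred_def prv_Pr_iff std_prF
proof (intro conjI allI iffI fv_Pr)
  fix n assume "\<exists>p. cl p 0 n"
  then show "\<exists>\<phi>. code \<phi> = n \<and> prv T \<phi>" using cl_thm unfolding thm_code_def by metis
next
  fix n assume "\<exists>\<phi>. code \<phi> = n \<and> prv T \<phi>"
  then have "thm_code T n" unfolding thm_code_def by metis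
  then show "\<exists>p. cl p 0 n" using thm_prF std_prF by blast
qed

section \<open>The modal principles as theorems of PA\<close>

lemma eval_PrAt: "eval_fm M e (PrAt Pr \<phi>) \<longleftrightarrow> rel M prF [numeral_in M (code \<phi>), numeral_in M g]"
  unfolding PrAt_def by (rule eval_Pr)

lemma PA_consR: "consR T L g (code \<phi>) (code \<psi>) \<Longrightarrow> prv PA (Imp (PrAt Pr \<phi>) (PrAt Pr \<psi>))"
  unfolding completeness_PA eval_fm.simps eval_PrAt using prF_consR pa_model.intro by blast

lemma PA_M: "prv T (Imp \<phi> \<psi>) \<Longrightarrow> prv PA (Imp (PrAt Pr \<phi>) (PrAt Pr \<psi>))"
  by (rule PA_consR) (simp add: consR_def thm_code_Imp)

lemma PA_four: "L = MNF \<Longrightarrow> prv PA (Imp (PrAt Pr \<phi>) (PrAt Pr (PrAt Pr \<phi>)))"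
  by (rule PA_consR) (simp add: consR_def prcode_Pr PrAt_def)

lemma PA_nec: "prv T \<phi> \<Longrightarrow> prv PA (PrAt Pr \<phi>)"
  using prov_pred_Pr unfolding prov_pred_def PrAt_def by blast

lemma PA_taut:
  assumes "taut A" shows "prv PA (interp Pr \<sigma> A)"
  unfolding completeness_PA
proof (intro allI impI)
  fix M :: "nat struct" and e assume "models M PA"
  then interpret pa_model M by unfold_locales
  have "meval (\<lambda>A. eval_fm M e (interp Pr \<sigma> A)) A = eval_fm M e (interp Pr \<sigma> A)" for A
    using suc_nonzero[of "zer M"] by (induction A) auto
  then show "eval_fm M e (interp Pr \<sigma> A)" using assms unfolding taut_def by blast
qed

lemma PA_sound: "mprv L A \<Longrightarrow> prv PA (interp Pr \<sigma> A)"
proof (induction rule: mprv.induct)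
  case (taut A)
  then show ?case by (rule PA_taut)
next
  case (mmp A B)
  then show ?case using prv.mp by simp
next
  case (nec A)
  then show ?case using PA_nec extT by simp
next
  case (rm A B)
  then show ?case using PA_M extT by simp
next
  case (four A)
  then show ?case using PA_four by simp
qed

end

section \<open>A completeness criterion for MN and MNF\<close>

text \<open>The maximal subformulas that Boolean evaluation treats as atoms.\<close>

fun tops :: "mfm \<Rightarrow> mfm set" where
  "tops (PVar p) = {PVar p}"
| "tops MBot = {}"
| "tops (MImp A B) = tops A \<union> tops B"
| "tops (Box A) = {Box A}"

fun md :: "mfm \<Rightarrow> nat" where
  "md (PVar p) = 0"
| "md MBot = 0"
| "md (MImp A B) = max (md A) (md B)"
| "md (Box A) = Suc (md A)"

lemma finite_tops: "finite (tops A)"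
  by (induction A) auto

lemma meval_tops_cong: "(\<And>B. B \<in> tops A \<Longrightarrow> v B = w B) \<Longrightarrow> meval v A = meval w A"
  by (induction A) auto

lemma Box_in_tops_md: "Box V \<in> tops A \<Longrightarrow> md V < md A"
  by (induction A) (auto simp: less_max_iff_disj)

text \<open>Lindenbaum's construction relative to \<open>D\<close>: a theory maximal among those
  omitting \<open>D\<close> respects the connectives, so its membership function is a Boolean
  valuation.\<close>

lemma ex_maximal_theory:
  assumes "\<not> mprv L D"
  shows "\<exists>v. (\<forall>A. meval v A = v A) \<and> (\<forall>A. mprv L A \<longrightarrow> v A) \<and> \<not> v D"
proof -
  define thy where "thy S \<longleftrightarrow> {A. mprv L A} \<subseteq> S \<and> (\<forall>A B. MImp A B \<in> S \<longrightarrow> A \<in> S \<longrightarrow> B \<in> S)" for S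
  define \<A> where "\<A> = {S. thy S \<and> D \<notin> S}"
  have "{A. mprv L A} \<in> \<A>" using assms mprv.mmp by (auto simp: \<A>_def thy_def)
  then have "\<A> \<noteq> {}" by blast
  moreover have "\<Union>\<C> \<in> \<A>" if "\<C> \<noteq> {}" and ch: "subset.chain \<A> \<C>" for \<C>
  proof -
    have sub: "\<And>S. S \<in> \<C> \<Longrightarrow> thy S \<and> D \<notin> S"
      and lin: "\<And>S S'. S \<in> \<C> \<Longrightarrow> S' \<in> \<C> \<Longrightarrow> S \<subseteq> S' \<or> S' \<subseteq> S"
      using ch by (auto simp: subset_chain_def \<A>_def)
    have "B \<in> \<Union>\<C>" if AB: "MImp A B \<in> \<Union>\<C>" "A \<in> \<Union>\<C>" for A B
    proof -
      from AB obtain S S' where S: "S \<in> \<C>" "MImp A B \<in> S" "S' \<in> \<C>" "A \<in> S'" by (elim UnionE)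
      have "\<exists>S''\<in>\<C>. MImp A B \<in> S'' \<and> A \<in> S''" using lin[OF S(1,3)] S by (elim disjE) auto
      then show ?thesis using sub unfolding thy_def by (meson UnionI)
    qed
    moreover have "{A. mprv L A} \<subseteq> \<Union>\<C>" using \<open>\<C> \<noteq> {}\<close> sub unfolding thy_def by blast
    ultimately show ?thesis using sub by (auto simp: \<A>_def thy_def)
  qed
  ultimately obtain S where S: "S \<in> \<A>" and max: "\<forall>S'\<in>\<A>. S \<subseteq> S' \<longrightarrow> S' = S"
    using subset_Zorn_nonempty[of \<A>] by metis
  from S have th: "\<And>A. mprv L A \<Longrightarrow> A \<in> S" and mp: "\<And>A B. MImp A B \<in> S \<Longrightarrow> A \<in> S \<Longrightarrow> B \<in> S" and D: "D \<notin> S"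
    by (auto simp: \<A>_def thy_def)
  have ta: "\<And>A. taut A \<Longrightarrow> A \<in> S" using th mprv.taut by blast
  \<comment> \<open>Otherwise the formulas implied by \<open>A\<close> over \<open>S\<close> would
    be a theory that extends \<open>S\<close>, omits \<open>D\<close> and contains
    \<open>A\<close>.\<close>
  have out: "MImp A D \<in> S" if "A \<notin> S" for A
  proof (rule ccontr)
    assume nD: "MImp A D \<notin> S"
    have K: "MImp A B \<in> S" if "B \<in> S" for B
      using mp[OF ta that, of "MImp A B"] by (simp add: taut_def)
    have "MImp A C \<in> S" if "MImp A (MImp B C) \<in> S" "MImp A B \<in> S" for B C
      using mp[OF mp[OF ta that(1)] that(2), of "MImp A C"] by (simp add: taut_def)
    then have "{B. MImp A B \<in> S} \<in> \<A>" using nD K th by (auto simp: \<A>_def thy_def)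
    moreover have "S \<subseteq> {B. MImp A B \<in> S}" using K by blast
    ultimately have "{B. MImp A B \<in> S} = S" using max by blast
    moreover have "MImp A A \<in> S" by (rule ta) (simp add: taut_def)
    ultimately show False using that by blast
  qed
  have imp: "MImp A B \<in> S \<longleftrightarrow> (A \<in> S \<longrightarrow> B \<in> S)" for A B
  proof
    assume *: "A \<in> S \<longrightarrow> B \<in> S"
    show "MImp A B \<in> S"
    proof (cases "B \<in> S")
      case True
      show ?thesis using mp[OF ta True, of "MImp A B"] by (simp add: taut_def)
    next
      case False
      then have AD: "MImp A D \<in> S" using * out by blast
      show ?thesis
      proof (rule ccontr)
        assume "MImp A B \<notin> S"
        \<comment> \<open>A form of Peirce's law: \<open>A \<longrightarrow> D\<close> and
          \<open>(A \<longrightarrow> B) \<longrightarrow> D\<close> together give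
          \<open>D\<close>.\<close>
        from mp[OF mp[OF ta AD] out[OF this], of D] show False using D by (auto simp: taut_def)
      qed
    qed
  qed (use mp in blast)
  have bot: "MBot \<notin> S" using D mp[OF ta, of MBot D] by (auto simp: taut_def)
  have "meval (\<lambda>A. A \<in> S) A = (A \<in> S)" for A by (induction A) (simp_all add: imp bot)
  then show ?thesis using th D by (intro exI[of _ "\<lambda>A. A \<in> S"]) simp
qed

definition mval :: "(nat \<Rightarrow> bool) \<Rightarrow> mfm set \<Rightarrow> mfm \<Rightarrow> bool" where
  "mval \<rho> X A = (case A of PVar p \<Rightarrow> \<rho> p | Box B \<Rightarrow> B \<in> X | _ \<Rightarrow> False)"

lemma mval_simps [simp]: "mval \<rho> X (PVar p) = \<rho> p" "mval \<rho> X (Box B) = (B \<in> X)"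
  by (simp_all add: mval_def)

text \<open>The closure rule of events transferred to modal formulas, \<open>X\<close> being the set
  of formulas whose boxes count as true.\<close>

definition closedX :: "mfm set \<Rightarrow> logic \<Rightarrow> mfm set \<Rightarrow> bool" where
  "closedX \<L> L X \<longleftrightarrow> \<L> \<subseteq> X \<and> (\<forall>A B. A \<in> X \<longrightarrow> MImp A B \<in> \<L> \<longrightarrow> B \<in> X) \<and>
     (L = MNF \<longrightarrow> (\<forall>A\<in>X. Box A \<in> X))"

definition mlogic :: "mfm set \<Rightarrow> logic \<Rightarrow> bool" where
  "mlogic \<L> L \<longleftrightarrow> (\<forall>A. taut A \<longrightarrow> A \<in> \<L>) \<and> (\<forall>A B. MImp A B \<in> \<L> \<longrightarrow> A \<in> \<L> \<longrightarrow> B \<in> \<L>) \<and>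
     (\<forall>A. A \<in> \<L> \<longrightarrow> Box A \<in> \<L>) \<and> (\<forall>A B. MImp A B \<in> \<L> \<longrightarrow> MImp (Box A) (Box B) \<in> \<L>) \<and>
     (L = MNF \<longrightarrow> (\<forall>A. MImp (Box A) (Box (Box A)) \<in> \<L>))"

text \<open>Take \<open>D\<close> in \<open>\<L>\<close> of least modal depth \<open>n\<close> among the unprovable formulas, a maximal consistent
  theory \<open>v\<close> omitting \<open>D\<close>, and let \<open>X v\<close> be the closure under \<open>\<L>\<close> of the boxed formulas of depth below
  \<open>n\<close> in \<open>v\<close>. The \<open>\<L>\<close>-consequences among those have depth below \<open>n\<close> and are therefore provable, except
  for \<open>Box A \<longrightarrow> V\<close> with \<open>Box A\<close> of depth \<open>n\<close>; \<open>lower\<close> treats these by the same argument, by induction on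
  the depth of \<open>V\<close>.\<close>

theorem mprv_complete:
  assumes log: "mlogic \<L> L"
    and sound: "\<And>X \<rho> D. closedX \<L> L X \<Longrightarrow> D \<in> \<L> \<Longrightarrow> meval (mval \<rho> X) D"
    and D: "D \<in> \<L>"
  shows "mprv L D"
proof (rule ccontr)
  assume "\<not> mprv L D"
  with D have "\<exists>n. \<exists>D\<in>\<L>. md D = n \<and> \<not> mprv L D" by blast
  from exists_least_iff[THEN iffD1, OF this] obtain n where
    n: "\<exists>D\<in>\<L>. md D = n \<and> \<not> mprv L D" and low0: "\<forall>m<n. \<not> (\<exists>D\<in>\<L>. md D = m \<and> \<not> mprv L D)" by blast
  from n obtain D where D: "D \<in> \<L>" "md D = n" "\<not> mprv L D" by blast
  have low: "mprv L E" if "E \<in> \<L>" "md E < n" for E using low0 that by blast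
  have ta: "\<And>A. taut A \<Longrightarrow> A \<in> \<L>" and mp: "\<And>A B. MImp A B \<in> \<L> \<Longrightarrow> A \<in> \<L> \<Longrightarrow> B \<in> \<L>"
    and nec: "\<And>A. A \<in> \<L> \<Longrightarrow> Box A \<in> \<L>"
    and rm: "\<And>A B. MImp A B \<in> \<L> \<Longrightarrow> MImp (Box A) (Box B) \<in> \<L>"
    and four: "\<And>A. L = MNF \<Longrightarrow> MImp (Box A) (Box (Box A)) \<in> \<L>"
    using log unfolding mlogic_def by simp_all
  have tr: "MImp A C \<in> \<L>" if "MImp A B \<in> \<L>" "MImp B C \<in> \<L>" for A B C
    using mp[OF mp[OF ta that(1)] that(2), of "MImp A C"] by (simp add: taut_def)
  have mtr: "mprv L (MImp A C)" if "mprv L (MImp A B)" "mprv L (MImp B C)" for A B C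
    using mprv.mmp[OF mprv.mmp[OF mprv.taut that(1)] that(2), of "MImp A C"] by (simp add: taut_def)
  \<comment> \<open>For \<open>n = 0\<close> no formula has depth below \<open>n\<close>; the box of
    \<open>Top\<close> is then the only source from which the members of \<open>\<L>\<close> can be
    drawn into \<open>X v\<close>.\<close>
  define Top where "Top = MImp MBot MBot"
  define X where "X v = {B. \<exists>A. (md A < n \<or> A = Top) \<and> v (Box A) \<and>
    (MImp A B \<in> \<L> \<or> L = MNF \<and> MImp (Box A) B \<in> \<L>)}" for v
  have clX: "closedX \<L> L (X v)" if v: "\<And>A. mprv L A \<Longrightarrow> v A" for v
    unfolding closedX_def
  proof (intro conjI allI impI ballI subsetI)
    fix B assume "B \<in> \<L>"
    then have "MImp Top B \<in> \<L>" using mp[OF ta, of B "MImp Top B"] by (simp add: taut_def)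
    moreover have "v (Box Top)" by (intro v mprv.nec mprv.taut) (simp add: Top_def taut_def)
    ultimately show "B \<in> X v" unfolding X_def by blast
  next
    fix B C assume "B \<in> X v" "MImp B C \<in> \<L>"
    then show "C \<in> X v" unfolding X_def using tr by blast
  next
    fix B assume L: "L = MNF" and "B \<in> X v"
    then obtain A where A: "md A < n \<or> A = Top" "v (Box A)" "MImp A B \<in> \<L> \<or> MImp (Box A) B \<in> \<L>"
      unfolding X_def by blast
    \<comment> \<open>RM yields either this formula or its variant with premise
      \<open>Box (Box A)\<close>; the latter is composed with the scheme 4.\<close>
    have "MImp (Box A) (Box B) \<in> \<L>" using A(3) rm tr[OF four[OF L]] by blast
    then show "Box B \<in> X v" unfolding X_def using A L by blast
  qed
  have agree: False if v: "\<And>A. meval v A = v A" "\<And>A. mprv L A \<Longrightarrow> v A" and E: "E \<in> \<L>" "\<not> v E"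
    and b: "\<And>V. Box V \<in> tops E \<Longrightarrow> V \<in> X v \<longleftrightarrow> v (Box V)" for v E
  proof -
    have "mval (\<lambda>p. v (PVar p)) (X v) B = v B" if "B \<in> tops E" for B
    proof -
      have "(\<exists>p. B = PVar p) \<or> (\<exists>V. B = Box V)" using that by (induction E) auto
      then show ?thesis using b that by auto
    qed
    from meval_tops_cong[OF this, of E] have "meval (mval (\<lambda>p. v (PVar p)) (X v)) E = v E" by (simp add: v(1))
    moreover have "closedX \<L> L (X v)" using v(2) by (rule clX)
    ultimately show False using sound E by blast
  qed
  have inX: "V \<in> X v" if "v (Box V)" "md V < n" for v V
  proof -
    have "MImp V V \<in> \<L>" by (rule ta) (simp add: taut_def)
    then show ?thesis unfolding X_def using that by blast
  qed
  have outX: "v (Box V)" if v: "\<And>A. meval v A = v A" "\<And>A. mprv L A \<Longrightarrow> v A" and V: "V \<in> X v" "md V < n"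
    and IH: "\<And>A. L = MNF \<Longrightarrow> md A < n \<Longrightarrow> MImp (Box A) V \<in> \<L> \<Longrightarrow> mprv L (MImp (Box A) V)" for v V
  proof -
    from V(1) obtain A where A: "md A < n \<or> A = Top" "v (Box A)" "MImp A V \<in> \<L> \<or> L = MNF \<and> MImp (Box A) V \<in> \<L>"
      unfolding X_def by blast
    have "md A < n" using A(1) V(2) by (auto simp: Top_def)
    have "mprv L (MImp (Box A) (Box V))"
      using A(3)
    proof (elim disjE conjE)
      assume "MImp A V \<in> \<L>"
      then have "mprv L (MImp A V)" using \<open>md A < n\<close> V(2) by (intro low) simp_all
      then show ?thesis by (rule mprv.rm)
    next
      assume "L = MNF" "MImp (Box A) V \<in> \<L>"
      then show ?thesis using mtr[OF mprv.four mprv.rm[OF IH]] \<open>md A < n\<close> by blast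
    qed
    from v(2)[OF this] have "meval v (MImp (Box A) (Box V))" using v(1) by blast
    then show ?thesis using A(2) by simp
  qed
  have lower: "L = MNF \<longrightarrow> md V < n \<longrightarrow> (\<forall>A. md A < n \<longrightarrow> MImp (Box A) V \<in> \<L> \<longrightarrow> mprv L (MImp (Box A) V))" for V
  proof (induction "md V" arbitrary: V rule: less_induct)
    case less
    show ?case
    proof (intro impI allI, rule ccontr)
      fix A assume L: "L = MNF" and V: "md V < n" and A: "md A < n" "MImp (Box A) V \<in> \<L>"
        and np: "\<not> mprv L (MImp (Box A) V)"
      from ex_maximal_theory[OF np] obtain v where v: "\<And>A. meval v A = v A" "\<And>A. mprv L A \<Longrightarrow> v A"
        and nv: "\<not> v (MImp (Box A) V)" by metis
      have vA: "v (Box A)" using nv v(1)[of "MImp (Box A) V"] by simp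
      show False
      proof (rule agree[OF v A(2) nv])
        fix U assume "Box U \<in> tops (MImp (Box A) V)"
        then have U: "U = A \<or> Box U \<in> tops V" by auto
        \<comment> \<open>\<open>Box A\<close> may have depth \<open>n\<close>, but it is true in
          \<open>v\<close> since the implication fails there. All other boxes come from
          \<open>V\<close>, have arguments of smaller depth than \<open>V\<close>, and fall under
          the induction.\<close>
        show "U \<in> X v \<longleftrightarrow> v (Box U)"
        proof (cases "U = A")
          case True
          then show ?thesis using vA inX A(1) by blast
        next
          case False
          then have U: "md U < md V" using U Box_in_tops_md by blast
          then have Un: "md U < n" using V by simp
          show ?thesis
          proof
            assume "U \<in> X v"
            from outX[OF v this Un] show "v (Box U)" using less[OF U] Un by blast
          qed (use inX Un in blast)
        qed
      qed
    qed
  qed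
  from ex_maximal_theory[OF D(3)] obtain v where v: "\<And>A. meval v A = v A" "\<And>A. mprv L A \<Longrightarrow> v A"
    and nv: "\<not> v D" by metis
  show False
  proof (rule agree[OF v D(1) nv])
    fix V assume "Box V \<in> tops D"
    then have V: "md V < n" using Box_in_tops_md D(2) by blast
    show "V \<in> X v \<longleftrightarrow> v (Box V)"
    proof
      assume "V \<in> X v"
      from outX[OF v this V] show "v (Box V)" using lower[of V] V by blast
    qed (use inX V in blast)
  qed
qed

section \<open>Arithmetical completeness\<close>

lemma prv_trans: "prv T (Imp \<phi> \<psi>) \<Longrightarrow> prv T (Imp \<psi> \<chi>) \<Longrightarrow> prv T (Imp \<phi> \<chi>)"
  by (rule prv.mp[OF prv.mp[OF prv.ax_S prv.mp[OF prv.ax_K]]])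

context construction
begin

abbreviation fi :: "mfm \<Rightarrow> nat" where "fi A \<equiv> code (interp Pr sg A)"

definition \<L> :: "mfm set" where "\<L> = {A. prv T (interp Pr sg A)}"

lemma mlogic_\<L>: "mlogic \<L> L"
  unfolding mlogic_def \<L>_def mem_Collect_eq interp.simps
proof (intro conjI allI impI)
  show "prv T (interp Pr sg A)" if "taut A" for A using PA_taut[OF that] extT by blast
  show "prv T (interp Pr sg B)" if "prv T (Imp (interp Pr sg A) (interp Pr sg B))" "prv T (interp Pr sg A)" for A B
    using that by (rule prv.mp)
  show "prv T (PrAt Pr (interp Pr sg A))" if "prv T (interp Pr sg A)" for A
    using PA_nec[OF that] extT by blast
  show "prv T (Imp (PrAt Pr (interp Pr sg A)) (PrAt Pr (interp Pr sg B)))"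
    if "prv T (Imp (interp Pr sg A) (interp Pr sg B))" for A B
    using PA_M[OF that] extT by blast
  show "prv T (Imp (PrAt Pr (interp Pr sg A)) (PrAt Pr (PrAt Pr (interp Pr sg A))))" if "L = MNF" for A
    using PA_four[OF that] extT by blast
qed

lemma sound_closedX:
  assumes X: "closedX \<L> L X" and D: "D \<in> \<L>"
  shows "meval (mval \<rho> X) D"
proof (rule ccontr)
  assume nD: "\<not> meval (mval \<rho> X) D"
  have LX: "\<And>A. A \<in> \<L> \<Longrightarrow> A \<in> X" and impX: "\<And>A B. A \<in> X \<Longrightarrow> MImp A B \<in> \<L> \<Longrightarrow> B \<in> X"
    and boxX: "\<And>A. L = MNF \<Longrightarrow> A \<in> X \<Longrightarrow> Box A \<in> X"
    using X unfolding closedX_def by auto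
  have ta: "taut A \<Longrightarrow> A \<in> \<L>" for A using mlogic_\<L> unfolding mlogic_def by blast
  \<comment> \<open>Only atoms of \<open>D\<close> are recorded, which keeps \<open>S\<close>
    finite. Residues modulo 3 separate true boxes, false boxes and true variables.\<close>
  define S where "S = (\<lambda>B. fi B + fi B + fi B) ` {B. Box B \<in> tops D \<and> B \<in> X} \<union>
    (\<lambda>C. Suc (fi C + fi C + fi C)) ` {C. Box C \<in> tops D \<and> C \<notin> X} \<union>
    (\<lambda>j. Suc (Suc (j + j + j))) ` {j. PVar j \<in> tops D \<and> \<rho> j}"
  have "finite (Box -` tops D)" "finite (PVar -` tops D)"
    by (intro finite_vimageI finite_tops; simp add: inj_def)+
  then have "finite {B. Box B \<in> tops D \<and> P B}" "finite {j. PVar j \<in> tops D \<and> Q j}" for P Q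
    by (auto elim: rev_finite_subset)
  then have "finite S" unfolding S_def by (intro finite_UnI finite_imageI)
  from ex_mem_code[OF this] obtain e where e: "\<forall>y. mem y e \<longleftrightarrow> y \<in> S" ..
  \<comment> \<open>Different modal formulas may have the same interpretation, so a code returns
    only some formula in \<open>X\<close>.\<close>
  have S0: "x + x + x \<in> S \<Longrightarrow> \<exists>B\<in>X. x = fi B" for x
  proof -
    have "Suc (a + a + a) \<noteq> x + x + x" "Suc (Suc (a + a + a)) \<noteq> x + x + x"
      "a + a + a = x + x + x \<longleftrightarrow> a = x" for a by presburger+
    then show "x + x + x \<in> S \<Longrightarrow> \<exists>B\<in>X. x = fi B" unfolding S_def by force
  qed
  have S1: "Suc (x + x + x) \<in> S \<Longrightarrow> \<exists>C. C \<notin> X \<and> x = fi C" for x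
  proof -
    have "a + a + a \<noteq> Suc (x + x + x)" "Suc (Suc (a + a + a)) \<noteq> Suc (x + x + x)"
      "Suc (a + a + a) = Suc (x + x + x) \<longleftrightarrow> a = x" for a by presburger+
    then show "Suc (x + x + x) \<in> S \<Longrightarrow> \<exists>C. C \<notin> X \<and> x = fi C" unfolding S_def by force
  qed
  have S2: "Suc (Suc (x + x + x)) \<in> S \<longleftrightarrow> PVar x \<in> tops D \<and> \<rho> x" for x
  proof -
    have "a + a + a \<noteq> Suc (Suc (x + x + x))" "Suc (a + a + a) \<noteq> Suc (Suc (x + x + x))"
      "Suc (Suc (a + a + a)) = Suc (Suc (x + x + x)) \<longleftrightarrow> a = x" for a by presburger+
    then show ?thesis unfolding S_def by force
  qed
  have tt: "truth_tab (pair g (pair e (pair (if meval (mval \<rho> X) A then 1 else 0) (fi A))))"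
    if "tops A \<subseteq> tops D" for A
    using that
  proof (induction A)
    case (PVar j)
    have "prcode (p2 g) g j (code (sg j))" by (simp add: prcode_sg)
    moreover have "mem (Suc (Suc (j + j + j))) e \<longleftrightarrow> \<rho> j" using e S2 PVar by simp
    ultimately have "truth_base (pair g (pair e (pair (if \<rho> j then 1 else 0) (code (sg j)))))"
      unfolding truth_base_def by (cases "\<rho> j") (simp_all, blast+)
    then show ?case unfolding truth_tab_def by (simp add: clo.clo_base)
  next
    case MBot
    have "truth_base (pair g (pair e (pair 0 (code (Eq Zero (Sc Zero))))))"
      unfolding truth_base_def by blast
    then show ?case unfolding truth_tab_def by (simp add: clo.clo_base)
  next
    case (MImp A B)
    let ?b = "\<lambda>A. if meval (mval \<rho> X) A then 1 else 0 :: nat"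
    have r: "truth_rule (pair g (pair e (pair (?b A) (fi A)))) (pair g (pair e (pair (?b B) (fi B))))
        (pair g (pair e (pair (?b (MImp A B)) (c_imp (fi A) (fi B)))))"
      unfolding truth_rule_def by (intro exI conjI, rule refl, rule refl) simp
    have ab: "truth_tab (pair g (pair e (pair (?b A) (fi A))))" "truth_tab (pair g (pair e (pair (?b B) (fi B))))"
      using MImp.prems by (intro MImp.IH; simp)+
    have "truth_tab (pair g (pair e (pair (?b (MImp A B)) (c_imp (fi A) (fi B)))))"
      using ab unfolding truth_tab_def by (rule clo.clo_rule[where R = truth_rule, OF _ _ r])
    then show ?case by (simp only: interp.simps code.simps)
  next
    case (Box B)
    have pc: "prcode (p1 g) g (fi B) (fi (Box B))" by (simp add: prcode_Pr PrAt_def)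
    have "truth_base (pair g (pair e (pair (if B \<in> X then 1 else 0) (fi (Box B)))))"
    proof (cases "B \<in> X")
      case True
      then have "mem (fi B + fi B + fi B) e" using e Box unfolding S_def by auto
      then show ?thesis using pc True unfolding truth_base_def by (simp only: if_True) blast
    next
      case False
      then have "mem (Suc (fi B + fi B + fi B)) e" using e Box unfolding S_def by auto
      then show ?thesis using pc False unfolding truth_base_def by (simp only: if_False) blast
    qed
    then show ?case unfolding truth_tab_def by (simp add: clo.clo_base)
  qed
  have "truth_tab (pair g (pair e (pair 0 (fi D))))" using tt[of D] nD by simp
  moreover have "thm_code T (fi D)" using D by (simp add: \<L>_def thm_code_code)
  ultimately have "refuted T g e" unfolding refuted_def by blast
  then obtain w where w: "rel std eF [w, g, e]" using eF by blast
  \<comment> \<open>Large enough for the refutation witness \<open>w\<close> and the assignment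
    \<open>e\<close> to lie below the stage.\<close>
  define p where "p = Suc (w + e)"
  \<comment> \<open>Invariant: each member of the closure is implied over \<open>T\<close> by the
    interpretation of a single formula in \<open>X\<close>. One formula suffices because the rule
    has one premise; the extra MNF rule replaces \<open>B\<close> by \<open>Box B\<close>.\<close>
  have cl: "cl p e x \<Longrightarrow> \<exists>B\<in>X. thm_code T (c_imp (fi B) x)" for x
  proof (induction rule: cl.induct)
    case (cl_th x)
    then have "thm_code T x" using thF unfolding th_def by blast
    then obtain \<phi> where \<phi>: "x = code \<phi>" "prv T \<phi>" unfolding thm_code_def by blast
    have "thm_code T (c_imp (fi (MImp MBot MBot)) x)"
      unfolding \<phi>(1) thm_code_Imp by (rule prv.mp[OF prv.ax_K \<phi>(2)])
    moreover have "MImp MBot MBot \<in> X" by (intro LX ta) (simp add: taut_def)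
    ultimately show ?case by blast
  next
    case (cl_pos x)
    then obtain B where B: "B \<in> X" "x = fi B" using S0 e by blast
    have "MImp B B \<in> \<L>" by (rule ta) (simp add: taut_def)
    then have "thm_code T (c_imp (fi B) x)" unfolding B(2) thm_code_Imp \<L>_def by simp
    then show ?case using B(1) by blast
  next
    case (cl_rr x y)
    then obtain B where B: "B \<in> X" "thm_code T (c_imp (fi B) x)" by blast
    then obtain \<phi> where \<phi>: "x = code \<phi>" "prv T (Imp (interp Pr sg B) \<phi>)"
      using thm_code_c_imp thm_code_Imp by metis
    from cl_rr have "consR T L g x y" using rF unfolding rr_def by blast
    then consider "thm_code T (c_imp x y)" | "L = MNF" "y = code (PrAt Pr \<phi>)"
      unfolding consR_def prcode_Pr PrAt_def \<phi>(1) by blast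
    then show ?case
    proof cases
      case 1
      from thm_code_c_imp[OF 1] obtain \<psi> where "y = code \<psi>" "prv T (Imp \<phi> \<psi>)"
        unfolding \<phi>(1) code_eq_iff by blast
      then have "thm_code T (c_imp (fi B) y)" using prv_trans[OF \<phi>(2)] by (simp only: thm_code_Imp)
      then show ?thesis using B(1) by blast
    next
      case 2
      have "thm_code T (c_imp (fi (Box B)) y)"
        unfolding 2 thm_code_Imp interp.simps using PA_M[OF \<phi>(2)] extT by blast
      then show ?thesis using boxX[OF 2(1) B(1)] by blast
    qed
  qed
  have "sev p e"
    unfolding sev_def
  proof (intro conjI allI impI notI)
    show "ev0 p e" unfolding ev0_def p_def by (rule exI[of _ w]) (simp add: w)
    fix y assume "mem (Suc (y + y + y)) e" "cl p e y"
    then obtain C B where "C \<notin> X" "y = fi C" "B \<in> X" "thm_code T (c_imp (fi B) y)" using S1 e cl by metis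
    \<comment> \<open>The implication between the interpretations puts \<open>MImp B C\<close> into
      \<open>\<L>\<close>, so \<open>C\<close> would belong to \<open>X\<close>. This also covers
      distinct \<open>B\<close> and \<open>C\<close> with equal codes.\<close>
    then show False using impX[of B C] by (simp add: \<L>_def thm_code_Imp[symmetric])
  qed
  then show False using no_event[of e p] by (simp add: p_def)
qed

lemma mprv_iff: "mprv L A \<longleftrightarrow> prv T (interp Pr sg A)"
proof
  assume "mprv L A"
  then show "prv T (interp Pr sg A)" using PA_sound extT by blast
next
  assume "prv T (interp Pr sg A)"
  then have "A \<in> \<L>" by (simp add: \<L>_def)
  then show "mprv L A" by (intro mprv_complete[OF mlogic_\<L>] sound_closedX)
qed

lemma cond_M_Pr: "cond_M T Pr"
  unfolding cond_M_def using PA_M extT by blast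

end

theorem theorem4p3:
  fixes T :: "fm set" and L :: logic
  assumes "pr_axiomatized_consistent_ext_PA T"
  shows "\<exists>Pr. Sigma1 Pr \<and> prov_pred T Pr \<and> cond_M T Pr \<and>
    (\<forall>\<sigma> A. (\<forall>p. sentence (\<sigma> p)) \<longrightarrow> mprv L A \<longrightarrow> prv PA (interp Pr \<sigma> A)) \<and>
    (\<exists>\<sigma>. (\<forall>p. sentence (\<sigma> p)) \<and> (\<forall>A. mprv L A \<longleftrightarrow> prv T (interp Pr \<sigma> A)))"
proof -
  have T: "\<forall>\<chi>\<in>T. sentence \<chi>" "prim_rec_set (code ` T)" "\<forall>\<chi>. prv PA \<chi> \<longrightarrow> prv T \<chi>" "\<not> prv T Bot"
    using assms unfolding pr_axiomatized_consistent_ext_PA_def by blast+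
  note re = re_thm_code[OF T(2)]
  from ex_matrix1[OF re] obtain thF where
    thF: "Delta0 thF" "\<forall>x. thm_code T x \<longleftrightarrow> (\<exists>w. rel std thF [w, x])" by (elim exE conjE)
  from ex_matrix3[OF re_consR[OF re, of L]] obtain rF where
    rF: "Delta0 rF" "\<forall>g x y. consR T L g x y \<longleftrightarrow> (\<exists>w. rel std rF [w, g, x, y])" by (elim exE conjE)
  from ex_matrix2[OF re_refuted[OF re]] obtain eF where
    eF: "Delta0 eF" "\<forall>g e. refuted T g e \<longleftrightarrow> (\<exists>w. rel std eF [w, g, e])" by (elim exE conjE)
  from ex_mem_formula obtain mF where
    mF: "Delta0 mF" "\<forall>y q. rel std mF [y, q] \<longleftrightarrow> mem y q" by (elim exE conjE)
  interpret construction T L thF rF eF mF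
    by unfold_locales (use T thF rF eF mF in blast)+
  show ?thesis
    using Sigma1_Pr(1) prov_pred_Pr cond_M_Pr PA_sound sentence_sg mprv_iff by blast
qed

end
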